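(* Let $U\subseteq\mathbb{R}^d$ be open, let $T>0$, and let $u,v:\overline U\times[0,T)\to\mathbb{R}$ be such that $u$ and $-v$ are upper semicontinuous on $\overline U\times[0,T)$. Assume that, in the viscosity sense, $$u_t-\mathrm{tr}\big(A(x)D^2u\big)+H(Du,x)\le0\le v_t-\mathrm{tr}\big(A(x)D^2v\big)+H(Dv,x)\quad\text{in }U\times(0,T),$$ that $$u(\cdot,0)\le v(\cdot,0)\ \text{ on }\overline U,\qquad u\le v\ \text{ on }\partial U\times[0,T),$$ and that $$\limsup_{x\in U,\ |x|\to\infty}\ \sup_{t\in[0,T)}\frac{u(x,t)}{1+|x|}\le0\le\liminf_{x\in U,\ |x|\to\infty}\ \inf_{t\in[0,T)}\frac{v(x,t)}{1+|x|}$$ (vacuous if $U$ is bounded). Then $u\le v$ in $U\times[0,T)$.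
   Context: Notation: $B_R$ is the open ball of radius $R$ centered at $0$ in $\mathbb{R}^d$; $\mathbb{S}^d$ is the set of real symmetric $d\times d$ matrices; $|\cdot|$ is the Euclidean norm (Frobenius norm for matrices); $D$, $D^2$ denote derivatives in $x$ only. Standing assumptions on the coefficients. Fix $m>1$, $n\in\mathbb{N}$, $\Lambda_1\ge1$, $\Lambda_2\ge0$. The map $A:\mathbb{R}^d\to\mathbb{S}^d$ has the form $A=\frac12\sigma^t\sigma$ with $\sigma:\mathbb{R}^d\to\mathbb{R}^{n\times d}$ satisfying $|\sigma(x)|\le\Lambda_2$ and $|\sigma(x)-\sigma(y)|\le\Lambda_2|x-y|$ for all $x,y\in\mathbb{R}^d$. The Hamiltonian $H:\mathbb{R}^d\times\mathbb{R}^d\to\mathbb{R}$, $(p,x)\mapsto H(p,x)$, satisfies: $p\mapsto H(p,x)$ is convex for every $x\in\mathbb{R}^d$; and for every $R>0$ there exist constants $0<a_R\le1$ and $M_R\ge1$ such that for all $p,q\in\mathbb{R}^d$ and $x,y\in B_R$, $$a_R|p|^m-M_R\le H(p,x)\le\Lambda_1(|p|^m+1),$$ $$|H(p,x)-H(p,y)|\le(\Lambda_1|p|^m+M_R)|x-y|,$$ $$|H(p,x)-H(q,x)|\le\Lambda_1(|p|+|q|+1)^{m-1}|p-q|.$$ Viscosity sense: for upper semicontinuous $u$, the inequality $u_t-\mathrm{tr}(A D^2u)+H(Du,x)\le0$ in $U\times(0,T)$ means that whenever $\varphi$ is smooth near $(y,s)\in U\times(0,T)$ and $u-\varphi$ has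 a local maximum at $(y,s)$, then $\varphi_t(y,s)-\mathrm{tr}(A(y)D^2\varphi(y,s))+H(D\varphi(y,s),y)\le0$. For lower semicontinuous $v$, the inequality $\ge0$ means that whenever $v-\varphi$ has a local minimum at $(y,s)$, then $\varphi_t(y,s)-\mathrm{tr}(A(y)D^2\varphi(y,s))+H(D\varphi(y,s),y)\ge0$. *)

theory Defs
  imports "HOL-Analysis.Analysis"
begin

definition usc_on :: "'a::topological_space set \<Rightarrow> ('a \<Rightarrow> real) \<Rightarrow> bool" where
  "usc_on S f \<longleftrightarrow> (\<forall>z\<in>S. \<forall>c. f z < c \<longrightarrow> (\<forall>\<^sub>F w in at z within S. f w < c))"

text \<open>On an open set, k-fold continuous differentiability via iterated directional
  derivatives.\<close>

primrec C_k_on :: "nat \<Rightarrow> 'a::real_normed_vector set \<Rightarrow> ('a \<Rightarrow> real) \<Rightarrow> bool" where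
  "C_k_on 0 W f \<longleftrightarrow> continuous_on W f"
| "C_k_on (Suc k) W f \<longleftrightarrow>
     (\<forall>z\<in>W. f differentiable (at z)) \<and>
     (\<forall>h. C_k_on k W (\<lambda>z. frechet_derivative f (at z) h))"

definition smooth_near :: "('a::real_normed_vector \<Rightarrow> real) \<Rightarrow> 'a \<Rightarrow> bool" where
  "smooth_near f z \<longleftrightarrow> (\<exists>W. open W \<and> z \<in> W \<and> (\<forall>k. C_k_on k W f))"

definition grad :: "(real^'d \<Rightarrow> real) \<Rightarrow> real^'d \<Rightarrow> real^'d" where
  "grad f x = (\<chi> i. frechet_derivative f (at x) (axis i 1))"

definition hessian :: "(real^'d \<Rightarrow> real) \<Rightarrow> real^'d \<Rightarrow> real^'d^'d" where
  "hessian f x = matrix (frechet_derivative (grad f) (at x))"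

text \<open>The matrix \<open>A = \<sigma>\<^sup>t \<sigma> / 2\<close>, where \<open>\<sigma>\<close> has \<open>'n\<close> rows and \<open>'d\<close> columns.\<close>

definition diffusion :: "(real^'d \<Rightarrow> real^'d^'n) \<Rightarrow> real^'d \<Rightarrow> real^'d^'d" where
  "diffusion \<sigma> x = (1/2) *\<^sub>R (transpose (\<sigma> x) ** \<sigma> x)"

definition HJ_operator ::
  "(real^'d \<Rightarrow> real^'d^'d) \<Rightarrow> (real^'d \<Rightarrow> real^'d \<Rightarrow> real) \<Rightarrow>
   ((real^'d) \<times> real \<Rightarrow> real) \<Rightarrow> real^'d \<Rightarrow> real \<Rightarrow> real" where
  "HJ_operator A H \<phi> y s =
     deriv (\<lambda>t. \<phi> (y, t)) s
     - trace (A y ** hessian (\<lambda>x. \<phi> (x, s)) y)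
     + H (grad (\<lambda>x. \<phi> (x, s)) y) y"

text \<open>Semicontinuity of the candidate solution is not built into the next two notions; it has to
  be assumed separately.  In \<open>H p x\<close> the gradient variable comes first.\<close>

definition viscosity_subsolution ::
  "(real^'d \<Rightarrow> real^'d^'d) \<Rightarrow> (real^'d \<Rightarrow> real^'d \<Rightarrow> real) \<Rightarrow> (real^'d) set \<Rightarrow> real \<Rightarrow>
   ((real^'d) \<times> real \<Rightarrow> real) \<Rightarrow> bool" where
  "viscosity_subsolution A H U T u \<longleftrightarrow>
     (\<forall>\<phi>. \<forall>y\<in>U. \<forall>s\<in>{0<..<T}.
        smooth_near \<phi> (y, s) \<and>
        (\<forall>\<^sub>F z in at (y, s) within U \<times> {0<..<T}. u z - \<phi> z \<le> u (y, s) - \<phi> (y, s)) \<longrightarrow>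
        HJ_operator A H \<phi> y s \<le> 0)"

definition viscosity_supersolution ::
  "(real^'d \<Rightarrow> real^'d^'d) \<Rightarrow> (real^'d \<Rightarrow> real^'d \<Rightarrow> real) \<Rightarrow> (real^'d) set \<Rightarrow> real \<Rightarrow>
   ((real^'d) \<times> real \<Rightarrow> real) \<Rightarrow> bool" where
  "viscosity_supersolution A H U T v \<longleftrightarrow>
     (\<forall>\<phi>. \<forall>y\<in>U. \<forall>s\<in>{0<..<T}.
        smooth_near \<phi> (y, s) \<and>
        (\<forall>\<^sub>F z in at (y, s) within U \<times> {0<..<T}. v z - \<phi> z \<ge> v (y, s) - \<phi> (y, s)) \<longrightarrow>
        HJ_operator A H \<phi> y s \<ge> 0)"

text \<open>The filter of \<open>x \<in> U\<close>, \<open>norm x \<rightarrow> \<infinity>\<close>.  It is \<open>bot\<close> if \<open>U\<close> is bounded; then a \<open>Limsup\<close> along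
  it is \<open>-\<infinity>\<close> and a \<open>Liminf\<close> is \<open>\<infinity>\<close>.\<close>

definition at_infinity_in :: "'a::real_normed_vector set \<Rightarrow> 'a filter" where
  "at_infinity_in U = inf at_infinity (principal U)"

end

(*
  The inequality u \<le> v is obtained from (1 - \<delta>) u - \<delta> (<x> + C0 + C t) - v \<le> 0 by letting \<delta> \<rightarrow> 0, where
  <x> = sqrt (1 + |x|^2).  Convexity of H makes the modified subsolution a strict one, and the
  sublinear growth confines the maximum of the difference to a bounded set.  Coercivity of H
  together with convexity even yields a gain of order \<delta> |p|^m in the strict inequality, which
  absorbs the error terms |p|^m |x - y| of the doubling of variables.

  The theorem on sums is proved in E = R^d x R, with time doubled as well.  Sup-convolution makes
  the doubled function semiconvex; by Jensen's lemma the set of contact points with small slope has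
  positive measure.  At such points the resolvent (I + subdifferential)^(-1) is expanding, and
  Rademacher's theorem, applied to the resolvents, gives second order expansions there (a
  restricted form of Alexandrov's theorem that does not need Sard's theorem).
*)
theory Submission
  imports Defs
begin

subsection \<open>Rademacher's theorem\<close>

text \<open>The lower bound and the Lipschitz constants of the Hamiltonian are only local:
  \<open>a\<close> and \<open>M\<close> may degenerate as the radius grows, while the radius that
  confines the maximum may grow as \<delta> \<rightarrow> 0. The constant \<open>C\<close> in the
  final bound must therefore depend on \<open>m\<close>, \<Lambda>1 and \<Lambda>2 alone. The radius
  may enter only the coefficient of the gain |p|^m; this is harmless because \<delta> and the radius
  stay fixed while the doubling parameter tends to infinity. No bound on the gradients of the
  doubled problem is available in advance, so every error that multiplies a power of |p| has to be
  weighed against that gain. The theorem on sums is kept approximate: the two slopes add up to a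
  small vector, and no limit of Hessians is taken. The resulting error in the Hamiltonian is also of
  the form small times |p|^m. A second obstacle lies at the boundary. Growth is assumed for points
  of \<open>U\<close> only, and a lower semicontinuous \<open>v\<close> may drop without control on
  the frontier. For this reason -v is replaced by a truncation that agrees with it inside
  \<open>U\<close>.\<close>

text \<open>Adding \<open>(L + 1) * t\<close> turns \<open>k\<close> into an increasing, expanding
  Lipschitz bijection \<open>G\<close>. The Lebesgue measure of the image of \<open>A\<close> under
  \<open>G\<close> is then an absolutely continuous measure in \<open>A\<close>. Its Radon-Nikodym
  density integrates to the increments of \<open>G\<close>, and Lebesgue differentiation yields the
  derivative.\<close>

lemma lipschitz_real_differentiable_ae:
  fixes k :: "real \<Rightarrow> real"
  assumes k: "L-lipschitz_on UNIV k"
  shows "negligible {t. \<not> k differentiable (at t)}"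
proof -
  have L0: "0 \<le> L" using k by (rule lipschitz_on_nonneg)
  have kL: "\<bar>k s - k t\<bar> \<le> L * \<bar>s - t\<bar>" for s t
    using lipschitz_onD[OF k, of s t] by (simp add: dist_real_def)
  define G where "G t = k t + (L + 1) * t" for t
  have G_expand: "\<bar>s - t\<bar> \<le> \<bar>G s - G t\<bar>"
    and G_mono: "s \<le> t \<Longrightarrow> G s \<le> G t" for s t
  proof -
    have *: "G b - G a \<ge> b - a" if "a \<le> b" for a b
      using kL[of b a] that by (simp add: G_def algebra_simps)
    show "\<bar>s - t\<bar> \<le> \<bar>G s - G t\<bar>" using *[of s t] *[of t s] by linarith
    show "s \<le> t \<Longrightarrow> G s \<le> G t" using *[of s t] by linarith
  qed
  have G_lip: "norm (G s - G t) \<le> (2 * L + 1) * norm (s - t)" for s t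
  proof -
    have "norm (G s - G t) \<le> \<bar>k s - k t\<bar> + \<bar>(L + 1) * (s - t)\<bar>"
      by (simp add: G_def algebra_simps)
    also have "\<dots> \<le> L * \<bar>s - t\<bar> + (L + 1) * \<bar>s - t\<bar>"
      using kL[of s t] L0 by (simp add: abs_mult)
    finally show ?thesis by (simp add: algebra_simps)
  qed
  have "(2 * L + 1)-lipschitz_on UNIV G"
    using G_lip L0 by (intro lipschitz_onI) (auto simp: dist_norm)
  then have G_cont: "continuous_on UNIV G" by (rule lipschitz_on_continuous_on)
  have "inj G" by (rule injI) (metis G_expand abs_le_zero_iff abs_zero diff_self eq_iff_diff_eq_0)
  have "surj G"
  proof (rule surjI[where f = "\<lambda>y. SOME x. G x = y"])
    fix y
    have "G (- \<bar>y - G 0\<bar>) \<le> y"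
      using G_expand[of "- \<bar>y - G 0\<bar>" 0] G_mono[of "- \<bar>y - G 0\<bar>" 0] by linarith
    moreover have "y \<le> G \<bar>y - G 0\<bar>"
      using G_expand[of "\<bar>y - G 0\<bar>" 0] G_mono[of 0 "\<bar>y - G 0\<bar>"] by linarith
    moreover have "- \<bar>y - G 0\<bar> \<le> \<bar>y - G 0\<bar>" by simp
    ultimately obtain x where "G x = y"
      using IVT'[of G "- \<bar>y - G 0\<bar>" y "\<bar>y - G 0\<bar>"] G_cont continuous_on_subset
        by blast
    then show "G (SOME x. G x = y) = y" by (rule someI)
  qed
  with \<open>inj G\<close> have bij: "bij G" by (simp add: bij_def)
  define K where "K = inv G"
  have KG [simp]: "K (G x) = x" and GK [simp]: "G (K x) = x" for x
    using bij unfolding K_def by (simp_all add: bij_is_inj bij_is_surj surj_f_inv_f)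
  have "1-lipschitz_on UNIV K"
    by (rule lipschitz_onI) (use G_expand[of "K _" "K _"] in \<open>auto simp: dist_real_def\<close>)
  then have "continuous_on UNIV K" by (rule lipschitz_on_continuous_on)
  then have [measurable]: "K \<in> borel_measurable borel" by (rule borel_measurable_continuous_onI)
  have vimage: "K -` A = G ` A" for A by (force simp: image_iff)
  \<comment> \<open>Pushing Lebesgue measure forward along the inverse \<open>K\<close> gives the
    measure of images under \<open>G\<close>; measurability of these images follows from continuity
    of \<open>K\<close>.\<close>
  define \<mu> where "\<mu> = distr lborel borel K"
  have em: "emeasure \<mu> A = emeasure lborel (G ` A)" if "A \<in> sets borel" for A
    using that by (simp add: \<mu>_def emeasure_distr vimage)
  have "absolutely_continuous lborel \<mu>"
    unfolding absolutely_continuous_def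
  proof
    fix A :: "real set" assume A: "A \<in> null_sets lborel"
    then have Ab: "A \<in> sets borel" by auto
    have "negligible A" using A
      by (meson negligible_iff_null_sets null_sets_completionI)
    then have "negligible (G ` A)"
      by (rule negligible_locally_Lipschitz_image[rotated])
         (use G_lip in \<open>auto intro!: exI[of _ UNIV] exI[of _ "2 * L + 1"]\<close>)
    moreover have "G ` A \<in> sets borel"
      using measurable_sets[OF \<open>K \<in> borel_measurable borel\<close> Ab] by (simp add: vimage)
    ultimately have "G ` A \<in> null_sets lborel"
      by (simp add: negligible_iff_emeasure0 null_sets_def)
    then show "A \<in> null_sets \<mu>" using em[OF Ab] Ab by (auto simp: null_sets_def \<mu>_def)
  qed
  moreover have "sets \<mu> = sets lborel" by (simp add: \<mu>_def)
  ultimately obtain g where g [measurable]: "g \<in> borel_measurable lborel"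
    and dens: "density lborel g = \<mu>"
    using sigma_finite_measure.Radon_Nikodym[OF sigma_finite_lborel] by blast
  define r where "r x = enn2real (g x)" for x
  have hint: "(r has_integral (G b - G a)) {a..b}" if ab: "a \<le> b" for a b
  proof -
    have "G ` {a..b} = {G a..G b}"
    proof
      show "G ` {a..b} \<subseteq> {G a..G b}" using G_mono by auto
      show "{G a..G b} \<subseteq> G ` {a..b}"
      proof
        fix y assume y: "y \<in> {G a..G b}"
        obtain x where "x \<ge> a" "x \<le> b" "G x = y"
          using IVT'[of G a y b] y ab continuous_on_subset[OF G_cont, of "{a..b}"] by auto
        then show "y \<in> G ` {a..b}" by auto
      qed
    qed
    then have "emeasure \<mu> {a..b} = ennreal (G b - G a)" using G_mono[OF that] by (simp add: em)
    then have nn: "(\<integral>\<^sup>+x. g x * indicator {a..b} x \<partial>lborel)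
        = ennreal (G b - G a)"
      unfolding dens[symmetric] by (simp add: emeasure_density)
    \<comment> \<open>The density has extended values. Its integrals over bounded intervals are
      finite, so it is finite almost everywhere there and the real function \<open>r\<close> has the
      same integrals.\<close>
    have "AE x in lborel. g x * indicator {a..b} x \<noteq> \<infinity>"
      by (rule nn_integral_PInf_AE) (auto simp: nn)
    then have "(\<integral>\<^sup>+x. ennreal (r x * indicator {a..b} x) \<partial>lborel)
        = (\<integral>\<^sup>+x. g x * indicator {a..b} x \<partial>lborel)"
      by (intro nn_integral_cong_AE, eventually_elim)
         (auto simp: r_def indicator_def less_top)
    then have "((\<lambda>x. r x * indicator {a..b} x) has_integral (G b - G a)) UNIV"
      using G_mono[OF that] unfolding nn
      by (intro nn_integral_has_integral) (auto simp: r_def[abs_def])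
    moreover have "(\<lambda>x. r x * indicator {a..b} x)
        = (\<lambda>x. if x \<in> {a..b} then r x else 0)"
      by (auto simp: indicator_def)
    ultimately show ?thesis by (simp only: has_integral_restrict_UNIV)
  qed
  have int: "r integrable_on cbox a b" for a b
    using hint[of a b] by (cases "a \<le> b") (auto simp: has_integral_integrable)
  \<comment> \<open>The averages in the differentiation theorem are over cubes with \<open>x\<close>
    as lower corner, so \<open>r\<close> itself yields only the right derivative. The reflected
    density supplies the left one.\<close>
  have hint': "((\<lambda>x. r (- x)) has_integral (G (-a) - G (-b))) {a..b}" if "a \<le> b" for a b
    using hint[of "-b" "-a"] that has_integral_reflect_real[of r _ "-a" "-b"] by simp
  have int': "(\<lambda>x. r (- x)) integrable_on cbox a b" for a b
    using hint'[of a b] by (cases "a \<le> b") (auto simp: has_integral_integrable)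
  obtain N1 where N1: "negligible N1"
    and D1: "\<And>x e. x \<notin> N1 \<Longrightarrow> 0 < e \<Longrightarrow>
      \<exists>d>0. \<forall>h. 0 < h \<and> h < d \<longrightarrow>
        norm (integral (cbox x (x + h *\<^sub>R One)) r /\<^sub>R h ^ DIM(real) - r x) < e"
    using integrable_ccontinuous_explicit[OF int] by metis
  obtain N2 where N2: "negligible N2"
    and D2: "\<And>x e. x \<notin> N2 \<Longrightarrow> 0 < e \<Longrightarrow>
      \<exists>d>0. \<forall>h. 0 < h \<and> h < d \<longrightarrow>
        norm (integral (cbox x (x
            + h *\<^sub>R One)) (\<lambda>x. r (-x)) /\<^sub>R h ^ DIM(real) - r (-x)) < e"
    using integrable_ccontinuous_explicit[OF int'] by metis
  have "k differentiable (at x)" if x: "x \<notin> N1" "x \<notin> uminus ` N2" for x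
  proof -
    have x2: "- x \<notin> N2" using x(2) by (metis image_eqI minus_minus)
    have "(G has_real_derivative r x) (at x)"
      unfolding has_field_derivative_iff LIM_def
    proof (intro allI impI)
      fix e :: real assume "0 < e"
      obtain d1 where d1: "d1 > 0" "\<And>h. 0 < h \<Longrightarrow> h < d1 \<Longrightarrow>
          norm (integral (cbox x (x + h *\<^sub>R One)) r /\<^sub>R h ^ DIM(real) - r x) < e"
        using D1[OF x(1) \<open>0 < e\<close>] by blast
      obtain d2 where d2: "d2 > 0" "\<And>h. 0 < h \<Longrightarrow> h < d2 \<Longrightarrow>
          norm (integral (cbox (-x) (-x
              + h *\<^sub>R One)) (\<lambda>x. r (-x)) /\<^sub>R h ^ DIM(real) - r x) < e"
        using D2[OF x2 \<open>0 < e\<close>] by auto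
      show "\<exists>s>0. \<forall>y. y \<noteq> x \<and> dist y x < s \<longrightarrow> dist ((G y - G x) / (y - x)) (r x) < e"
      proof (intro exI[of _ "min d1 d2"] conjI allI impI)
        show "0 < min d1 d2" using d1 d2 by simp
        fix y assume y: "y \<noteq> x \<and> dist y x < min d1 d2"
        show "dist ((G y - G x) / (y - x)) (r x) < e"
        proof (cases "y > x")
          case True
          have "integral {x..y} r = G y - G x" using hint[of x y] True by (simp add: integral_unique)
          then show ?thesis using d1(2)[of "y - x"] True y
            by (simp add: dist_real_def divide_inverse mult.commute)
        next
          case False
          then have "y < x" using y by auto
          then have "integral {-x..-y} (\<lambda>x. r (-x)) = G x - G y" using hint'[of "-x" "-y"]
            by (simp add: integral_unique)
          moreover have "(G x - G y) / (x - y) = (G y - G x) / (y - x)"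
            by (metis minus_diff_eq minus_divide_divide)
          ultimately show ?thesis using d2(2)[of "x - y"] \<open>y < x\<close> y
            by (simp add: dist_real_def divide_inverse mult.commute)
        qed
      qed
    qed
    then have "((\<lambda>t. G t - (L + 1) * t) has_real_derivative r x - (L + 1)) (at x)"
      by (auto intro!: derivative_eq_intros)
    moreover have "(\<lambda>t. G t - (L + 1) * t) = k" by (auto simp: G_def)
    ultimately show ?thesis using differentiableI has_field_derivative_def by metis
  qed
  then have "{t. \<not> k differentiable (at t)} \<subseteq> N1 \<union> uminus ` N2" by blast
  moreover have "negligible (uminus ` N2)"
    by (rule negligible_locally_Lipschitz_image[OF _ N2]) (simp, rule exI[of _ UNIV], rule exI[of _ "1::real"], simp add: abs_minus_commute)
  ultimately show ?thesis using N1 negligible_Un negligible_subset by blast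
qed

section \<open>Directional derivatives of Lipschitz functions\<close>

definition diff_quot :: "('a::real_normed_vector \<Rightarrow> real) \<Rightarrow> 'a \<Rightarrow> 'a \<Rightarrow> real \<Rightarrow> real" where
  "diff_quot f v x t = (f (x + t *\<^sub>R v) - f x) / t"

definition has_dir_deriv :: "('a::real_normed_vector \<Rightarrow> real) \<Rightarrow> 'a \<Rightarrow> 'a \<Rightarrow> bool" where
  "has_dir_deriv f v x
      \<longleftrightarrow> (\<exists>l. (diff_quot f v x \<longlongrightarrow> l) (at 0))"

text \<open>A limit along one fixed sequence gives a total function that is Borel measurable for
  continuous \<open>f\<close>; wherever the two-sided derivative exists, the values agree.\<close>

definition dir_deriv :: "('a::real_normed_vector \<Rightarrow> real) \<Rightarrow> 'a \<Rightarrow> 'a \<Rightarrow> real" where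
  "dir_deriv f v x = lim (\<lambda>n. diff_quot f v x (inverse (real (Suc n))))"

lemma filterlim_inverse_Suc_at_0: "filterlim (\<lambda>n. inverse (real (Suc n))) (at 0) sequentially"
  unfolding filterlim_at using LIMSEQ_inverse_real_of_nat by auto

lemma dir_deriv_tendsto:
  assumes "has_dir_deriv f v x"
  shows "(diff_quot f v x \<longlongrightarrow> dir_deriv f v x) (at 0)"
proof -
  obtain l where l: "(diff_quot f v x \<longlongrightarrow> l) (at 0)"
    using assms by (auto simp: has_dir_deriv_def)
  have "(\<lambda>n. diff_quot f v x (inverse (real (Suc n)))) \<longlonglongrightarrow> l"
    by (rule filterlim_compose[OF l filterlim_inverse_Suc_at_0])
  then show ?thesis using l by (simp add: dir_deriv_def limI)
qed

lemma dir_deriv_seq: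
  assumes "has_dir_deriv f v x"
  shows "(\<lambda>n. diff_quot f v x (inverse (real (Suc n))))
      \<longlonglongrightarrow> dir_deriv f v x"
  by (rule filterlim_compose[OF dir_deriv_tendsto[OF assms] filterlim_inverse_Suc_at_0])

text \<open>The Cauchy criterion does not mention the value of the limit, and its outer quantifiers
  range over integers. It thus presents the exceptional set through countable unions and
  intersections of open sets.\<close>

lemma has_dir_deriv_iff_Cauchy:
  "has_dir_deriv f v x
      \<longleftrightarrow> (\<forall>k::nat. \<exists>j::nat. \<forall>s t. 0 < \<bar>s\<bar> \<and> \<bar>s\<bar> < inverse (real (Suc j)) \<longrightarrow>
     0 < \<bar>t\<bar> \<and> \<bar>t\<bar> < inverse (real (Suc j)) \<longrightarrow>
     \<bar>diff_quot f v x s - diff_quot f v x t\<bar> \<le> inverse (real (Suc k)))" (is "_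
         \<longleftrightarrow> ?C")
proof
  assume "has_dir_deriv f v x"
  then obtain l where l: "(diff_quot f v x \<longlongrightarrow> l) (at 0)"
    by (auto simp: has_dir_deriv_def)
  show ?C
  proof
    fix k :: nat
    have "0 < inverse (real (Suc k)) / 2" by simp
    from LIM_D[OF l this] obtain d where d: "d > 0"
      "\<And>t. t \<noteq> 0 \<Longrightarrow> \<bar>t\<bar> < d
          \<Longrightarrow> \<bar>diff_quot f v x t - l\<bar> < inverse (real (Suc k)) / 2" by auto
    obtain j where j: "inverse (real (Suc j)) < d" using reals_Archimedean[OF d(1)] by blast
    have "\<bar>diff_quot f v x s - diff_quot f v x t\<bar> \<le> inverse (real (Suc k))"
      if "0 < \<bar>s\<bar> \<and> \<bar>s\<bar> < inverse (real (Suc j))" "0 < \<bar>t\<bar> \<and> \<bar>t\<bar> < inverse (real (Suc j))" for s t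
      using d(2)[of s] d(2)[of t] j that by linarith
    then show "\<exists>j. \<forall>s t. 0 < \<bar>s\<bar> \<and> \<bar>s\<bar> < inverse (real (Suc j)) \<longrightarrow>
     0 < \<bar>t\<bar> \<and> \<bar>t\<bar> < inverse (real (Suc j)) \<longrightarrow>
     \<bar>diff_quot f v x s - diff_quot f v x t\<bar> \<le> inverse (real (Suc k))" by blast
  qed
next
  assume C: ?C
  define a where "a n = diff_quot f v x (inverse (real (Suc n)))" for n
  have small: "0 < \<bar>inverse (real (Suc n))\<bar> \<and> \<bar>inverse (real (Suc n))\<bar> < inverse (real (Suc j))"
    if "n > j" for n j
    using that by (auto intro!: less_imp_inverse_less)
  have "Cauchy a"
  proof (rule metric_CauchyI)
    fix e :: real assume "e > 0"
    then obtain k where k: "inverse (real (Suc k)) < e" using reals_Archimedean by blast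
    obtain j :: nat where j: "\<And>s t. 0 < \<bar>s\<bar> \<and> \<bar>s\<bar> < inverse (real (Suc j)) \<Longrightarrow>
     0 < \<bar>t\<bar> \<and> \<bar>t\<bar> < inverse (real (Suc j)) \<Longrightarrow>
     \<bar>diff_quot f v x s - diff_quot f v x t\<bar> \<le> inverse (real (Suc k))" using C by blast
    show "\<exists>M. \<forall>m\<ge>M. \<forall>n\<ge>M. dist (a m) (a n) < e"
    proof (intro exI allI impI)
      fix m n assume "Suc j \<le> m" "Suc j \<le> n"
      then show "dist (a m) (a n) < e"
        using j[OF small[of j m] small[of j n]] k by (simp add: a_def dist_real_def)
    qed
  qed
  then obtain l where l: "a \<longlonglongrightarrow> l" using Cauchy_convergent convergent_def by blast
  have "(diff_quot f v x \<longlongrightarrow> l) (at 0)"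
  proof (rule LIM_I)
    fix e :: real assume "e > 0"
    then obtain k where k: "inverse (real (Suc k)) < e" using reals_Archimedean by blast
    obtain j :: nat where j: "\<And>s t. 0 < \<bar>s\<bar> \<and> \<bar>s\<bar> < inverse (real (Suc j)) \<Longrightarrow>
     0 < \<bar>t\<bar> \<and> \<bar>t\<bar> < inverse (real (Suc j)) \<Longrightarrow>
     \<bar>diff_quot f v x s - diff_quot f v x t\<bar> \<le> inverse (real (Suc k))" using C by blast
    have "\<bar>diff_quot f v x t - l\<bar> \<le> inverse (real (Suc k))"
      if t: "0 < \<bar>t\<bar> \<and> \<bar>t\<bar> < inverse (real (Suc j))" for t
    proof (rule tendsto_upperbound[OF tendsto_rabs[OF tendsto_diff[OF tendsto_const l]]])
      show "\<forall>\<^sub>F n in sequentially. \<bar>diff_quot f v x t - a n\<bar>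
          \<le> inverse (real (Suc k))"
        using eventually_gt_at_top[of j]
          by eventually_elim (use j[OF t small] in \<open>auto simp: a_def\<close>)
    qed simp
    then show "\<exists>s>0. \<forall>t. t \<noteq> 0 \<and> norm (t - 0) < s \<longrightarrow> norm (diff_quot f v x t - l) < e"
      using k by (intro exI[of _ "inverse (real (Suc j))"]) force
  qed
  then show "has_dir_deriv f v x" by (auto simp: has_dir_deriv_def)
qed

lemma sets_has_dir_deriv:
  fixes f :: "'a::euclidean_space \<Rightarrow> real"
  assumes f: "continuous_on UNIV f"
  shows "{x. \<not> has_dir_deriv f v x} \<in> sets borel"
proof -
  \<comment> \<open>For fixed \<open>s\<close> and \<open>t\<close> the condition on
    \<open>x\<close> is open, so the union over all increments, though uncountable, is open and
    hence Borel.\<close>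
  define Q where "Q k j
      = (\<Union>s\<in>{s. 0 < \<bar>s\<bar> \<and> \<bar>s\<bar> < inverse (real (Suc j))}.
    \<Union>t\<in>{t. 0 < \<bar>t\<bar> \<and> \<bar>t\<bar> < inverse (real (Suc j))}.
      {x. inverse (real (Suc k)) < \<bar>diff_quot f v x s - diff_quot f v x t\<bar>})" for k j :: nat
  have "open (Q k j)" for k j
    unfolding Q_def diff_quot_def
    by (intro open_UN ballI open_Collect_less continuous_intros continuous_on_divide
        continuous_on_compose2[OF f]) auto
  moreover have "{x. \<not> has_dir_deriv f v x} = (\<Union>k. \<Inter>j. Q k j)"
    unfolding has_dir_deriv_iff_Cauchy Q_def by (simp add: set_eq_iff not_le)
  ultimately show ?thesis by (auto intro!: sets.countable_UN sets.countable_INT)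
qed

text \<open>By the one-dimensional case every line in direction \<open>v\<close> meets the
  exceptional set in a null set of parameters. Fubini is applied to the pair of \<open>t\<close> and
  \<open>x\<close> rather than to a splitting of the space along \<open>v\<close>: for almost every
  \<open>t\<close> the translate of the exceptional set by \<open>t v\<close> is null, and a single
  such \<open>t\<close> suffices by translation invariance.\<close>

lemma lipschitz_has_dir_deriv_ae:
  fixes f :: "'a::euclidean_space \<Rightarrow> real"
  assumes f: "L-lipschitz_on UNIV f"
  shows "negligible {x. \<not> has_dir_deriv f v x}"
proof -
  define N where "N = {x. \<not> has_dir_deriv f v x}"
  have L0: "0 \<le> L" using f by (rule lipschitz_on_nonneg)
  have [measurable]: "N \<in> sets borel"
    unfolding N_def by (rule sets_has_dir_deriv) (rule lipschitz_on_continuous_on[OF f])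
  have line: "emeasure lborel {t. x + t *\<^sub>R v \<in> N} = 0" for x
  proof -
    define k where "k t = f (x + t *\<^sub>R v)" for t
    have "(L * norm v)-lipschitz_on UNIV k"
    proof (rule lipschitz_onI)
      fix s t :: real
      have "dist (k s) (k t) \<le> L * dist (x + s *\<^sub>R v) (x + t *\<^sub>R v)"
        unfolding k_def by (rule lipschitz_onD[OF f]) auto
      also have "dist (x + s *\<^sub>R v) (x + t *\<^sub>R v) = norm v * dist s t"
        by (simp add: dist_norm scaleR_diff_left[symmetric] mult.commute)
      finally show "dist (k s) (k t) \<le> L * norm v * dist s t" by (simp add: ac_simps)
    qed (use L0 in auto)
    then have "negligible {t. \<not> k differentiable (at t)}"
      by (rule lipschitz_real_differentiable_ae)
    moreover have "{t. x + t *\<^sub>R v \<in> N} \<subseteq> {t. \<not> k differentiable (at t)}"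
    proof clarify
      fix t assume t: "x + t *\<^sub>R v \<in> N" and "k differentiable (at t)"
      then obtain D where "DERIV k t :> D" using real_differentiable_def by blast
      then have "(diff_quot f v (x + t *\<^sub>R v) \<longlongrightarrow> D) (at 0)"
        unfolding DERIV_def diff_quot_def k_def by (simp add: algebra_simps)
      then show False using t by (auto simp: N_def has_dir_deriv_def)
    qed
    ultimately have "negligible {t. x + t *\<^sub>R v \<in> N}" using negligible_subset by blast
    moreover have "{t. x + t *\<^sub>R v \<in> N} \<in> sets borel" by measurable
    ultimately show ?thesis by (simp add: negligible_iff_emeasure0)
  qed
  have "(\<integral>\<^sup>+t. (\<integral>\<^sup>+x. indicator N (x
      + t *\<^sub>R v) \<partial>lborel) \<partial>lborel)
      = (\<integral>\<^sup>+x. (\<integral>\<^sup>+t. indicator N (x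
          + t *\<^sub>R v) \<partial>(lborel::real measure)) \<partial>lborel)"
    by (rule lborel_pair.Fubini') measurable
  also have "\<dots>
      = (\<integral>\<^sup>+x. emeasure (lborel::real measure) {t. x
          + t *\<^sub>R v \<in> N} \<partial>(lborel::'a measure))"
  proof (intro nn_integral_cong)
    fix x
    have [measurable]: "{t. x + t *\<^sub>R v \<in> N} \<in> sets borel" by measurable
    have "(\<integral>\<^sup>+t. indicator N (x + t *\<^sub>R v) \<partial>(lborel::real measure))
      = (\<integral>\<^sup>+t. indicator {t. x + t *\<^sub>R v \<in> N} t \<partial>lborel)"
      by (intro nn_integral_cong) (simp add: indicator_def)
    then show "(\<integral>\<^sup>+t. indicator N (x + t *\<^sub>R v) \<partial>(lborel::real measure))
      = emeasure lborel {t. x + t *\<^sub>R v \<in> N}" by simp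
  qed
  also have "\<dots> = 0" by (simp add: line)
  finally have "AE t in (lborel::real measure). (\<integral>\<^sup>+x. indicator N (x
      + t *\<^sub>R v) \<partial>(lborel::'a measure)) = 0"
    by (subst (asm) nn_integral_0_iff_AE) auto
  then obtain t where t: "(\<integral>\<^sup>+x. indicator N (x
      + t *\<^sub>R v) \<partial>(lborel::'a measure)) = 0"
    using eventually_happens by (fastforce simp: ae_filter_eq_bot_iff)
  have meas: "{x. x + t *\<^sub>R v \<in> N} \<in> sets borel" by measurable
  have "(\<integral>\<^sup>+x. indicator N (x + t *\<^sub>R v) \<partial>(lborel::'a measure))
      = (\<integral>\<^sup>+x. indicator {x. x + t *\<^sub>R v \<in> N} x \<partial>lborel)"
    by (intro nn_integral_cong) (simp add: indicator_def)
  then have "negligible {x. x + t *\<^sub>R v \<in> N}"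
    using t meas by (simp add: negligible_iff_emeasure0)
  then have "negligible ((+) (t *\<^sub>R v) ` {x. x + t *\<^sub>R v \<in> N})"
    by (rule negligible_translation)
  moreover have "(+) (t *\<^sub>R v) ` {x. x + t *\<^sub>R v \<in> N} = N"
  proof safe
    fix x assume "x \<in> N"
    then show "x \<in> (+) (t *\<^sub>R v) ` {x. x + t *\<^sub>R v \<in> N}"
      by (intro image_eqI[of _ _ "x - t *\<^sub>R v"]) auto
  qed (simp add: add.commute)
  ultimately show ?thesis by (simp add: N_def)
qed

lemma diff_quot_lipschitz_bound:
  assumes f: "L-lipschitz_on UNIV f"
  shows "\<bar>diff_quot f v x t\<bar> \<le> L * norm v"
proof (cases "t = 0")
  case False
  have "\<bar>f (x + t *\<^sub>R v) - f x\<bar> \<le> L * (\<bar>t\<bar> * norm v)"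
    using lipschitz_onD[OF f, of "x + t *\<^sub>R v" x] by (simp add: dist_norm)
  then show ?thesis using False by (simp add: diff_quot_def field_simps)
qed (use lipschitz_on_nonneg[OF f] in \<open>simp add: diff_quot_def\<close>)

lemma integral_lborel_translation:
  fixes h :: "'a::euclidean_space \<Rightarrow> real"
  assumes [measurable]: "h \<in> borel_measurable borel"
  shows "(\<integral>x. h (c + x) \<partial>lborel) = (\<integral>x. h x \<partial>lborel)"
proof -
  have "(\<integral>x. h x \<partial>lborel) = (\<integral>x. h x \<partial>distr lborel borel ((+) c))"
    by (simp add: lborel_distr_plus)
  also have "\<dots> = (\<integral>x. h (c + x) \<partial>lborel)"
    by (rule integral_distr) auto
  finally show ?thesis ..
qed

text \<open>Additivity holds because \<open>dir_deriv f v + dir_deriv f w\<close> and \<open>dir_deriv f (v + w)\<close> have the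
  same integral over every box: the shift by \<open>t v\<close> disappears in the limit under the integral.\<close>

lemma dir_deriv_add_ae:
  fixes f :: "'a::euclidean_space \<Rightarrow> real"
  assumes f: "L-lipschitz_on UNIV f"
  shows "negligible {x. dir_deriv f (v + w) x \<noteq> dir_deriv f v x + dir_deriv f w x}"
proof -
  have L0: "0 \<le> L" using f by (rule lipschitz_on_nonneg)
  have cont: "continuous_on UNIV f" by (rule lipschitz_on_continuous_on[OF f])
  define t where "t n = inverse (real (Suc n))" for n
  have t: "0 < t n" "t n \<le> 1" "t \<longlonglongrightarrow> 0" for n
    using LIMSEQ_inverse_real_of_nat by (auto simp: t_def[abs_def] inverse_le_1_iff)
  define q where "q v n x = diff_quot f v x (t n)" for v n x
  have q_bound: "\<bar>q v n x\<bar> \<le> L * norm v" for v n x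
    unfolding q_def by (rule diff_quot_lipschitz_bound[OF f])
  have [measurable]: "q v n \<in> borel_measurable borel" for v n
    unfolding q_def diff_quot_def
    by (intro borel_measurable_continuous_onI continuous_intros continuous_on_compose2[OF cont])
       (use t(1)[of n] in auto)
  have D_eq: "dir_deriv f v x = lim (\<lambda>n. q v n x)" for v x
    by (simp add: dir_deriv_def q_def t_def)
  have [measurable]: "dir_deriv f v \<in> borel_measurable borel" for v
    unfolding D_eq[abs_def] by measurable
  have ae: "AE x in lborel. (\<lambda>n. q v n x) \<longlonglongrightarrow> dir_deriv f v x" for v
  proof -
    have "{x. \<not> has_dir_deriv f v x} \<in> null_sets lborel"
      using lipschitz_has_dir_deriv_ae[OF f, of v] sets_has_dir_deriv[OF cont, of v]
      by (simp add: negligible_iff_emeasure0 null_sets_def)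
    then show ?thesis
      by (rule AE_I') (auto dest: dir_deriv_seq simp: q_def t_def)
  qed
  have lim: "integrable lborel (\<lambda>y. indicator (cbox a b) y * dir_deriv f w y)"
       "integrable lborel (\<lambda>y. indicator (cbox a b) (y - t n *\<^sub>R v) * q w n y)"
       "(\<lambda>n. \<integral>y. indicator (cbox a b) (y - t n *\<^sub>R v) * q w n y \<partial>lborel)
          \<longlonglongrightarrow> (\<integral>y. indicator (cbox a b) y * dir_deriv f w y \<partial>lborel)" for a b v w :: 'a and n
  proof -
    obtain R where R: "\<And>x. x \<in> cbox a b \<Longrightarrow> norm x \<le> R"
      using bounded_cbox[of a b] by (auto simp: bounded_iff)
    define W where "W y = (L * norm w) * indicator (cball 0 (R + norm v)) y" for y :: 'a
    have W: "integrable lborel W"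
      unfolding W_def
      by (intro integrable_mult_right integrable_real_indicator) (simp_all add: emeasure_lborel_cball_finite[unfolded infinity_ennreal_def])
    have dom: "norm (indicator (cbox a b) (y - t n *\<^sub>R v) * q w n y) \<le> W y" for n y
    proof (cases "y - t n *\<^sub>R v \<in> cbox a b")
      case True
      have "norm y \<le> norm (y - t n *\<^sub>R v) + norm (t n *\<^sub>R v)"
        using norm_triangle_ineq[of "y - t n *\<^sub>R v" "t n *\<^sub>R v"] by simp
      also have "norm (t n *\<^sub>R v) \<le> norm v"
        using t(1,2)[of n] by (simp add: mult_left_le_one_le)
      finally have "y \<in> cball 0 (R + norm v)" using R[OF True] by simp
      then show ?thesis using True q_bound by (simp add: W_def)
    qed (use L0 in \<open>auto simp: W_def\<close>)
    \<comment> \<open>The indicator of the shifted box converges to that of the box only off the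
      boundary of the box, which is null.\<close>
    have "negligible (cbox a b - box a b)" by (rule negligible_frontier_interval)
    then have "cbox a b - box a b \<in> null_sets lborel"
      by (simp add: negligible_iff_emeasure0 null_sets_def)
    then have "AE y in lborel. y \<notin> cbox a b - box a b" by (rule AE_not_in)
    then have conv: "AE y in lborel. (\<lambda>n. indicator (cbox a b) (y - t n *\<^sub>R v) * q w n y)
        \<longlonglongrightarrow> indicator (cbox a b) y * dir_deriv f w y"
      using ae[of w]
    proof eventually_elim
      case (elim y)
      have tv: "(\<lambda>n. y - t n *\<^sub>R v) \<longlonglongrightarrow> y"
        using tendsto_diff[OF tendsto_const tendsto_scaleR[OF t(3) tendsto_const], of y v] by simp
      have "\<forall>\<^sub>F n in sequentially. indicator (cbox a b) (y - t n *\<^sub>R v)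
          = (indicator (cbox a b) y :: real)"
      proof (cases "y \<in> box a b")
        case True
        from topological_tendstoD[OF tv open_box this] show ?thesis
          by (rule eventually_mono) (use True box_subset_cbox in \<open>auto simp: indicator_def\<close>)
      next
        case False
        then have "y \<in> - cbox a b" using elim(1) by auto
        have "open (- cbox a b)" by (simp add: open_Compl closed_cbox)
        from topological_tendstoD[OF tv this \<open>y \<in> - cbox a b\<close>] show ?thesis
          by (rule eventually_mono) (use \<open>y \<in> - cbox a b\<close> in \<open>auto simp: indicator_def\<close>)
      qed
      then show ?case
        by (intro tendsto_mult elim(2) tendsto_eventually)
    qed
    show "integrable lborel (\<lambda>y. indicator (cbox a b) y * dir_deriv f w y)"
      by (rule integrable_dominated_convergence[OF _ _ W conv]) (use dom in auto)
    show "integrable lborel (\<lambda>y. indicator (cbox a b) (y - t n *\<^sub>R v) * q w n y)"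
      by (rule Bochner_Integration.integrable_bound[OF W]) 
         (use dom in \<open>auto intro!: AE_I2 order_trans[OF _ abs_ge_self]\<close>)
    show "(\<lambda>n. \<integral>y. indicator (cbox a b) (y - t n *\<^sub>R v) * q w n y \<partial>lborel)
          \<longlonglongrightarrow> (\<integral>y. indicator (cbox a b) y * dir_deriv f w y \<partial>lborel)"
      by (rule integral_dominated_convergence[OF _ _ W conv]) (use dom in auto)
  qed
  define k where "k x = dir_deriv f (v + w) x - dir_deriv f v x - dir_deriv f w x" for x
  have k_int: "(k has_integral 0) (cbox a b)" for a b
  proof -
    let ?I = "indicator (cbox a b) :: 'a \<Rightarrow> real"
    have int_q: "integrable lborel (\<lambda>y. ?I (y - t n *\<^sub>R v') * q w' n y)" for n v' w'
      using lim(2)[of a b n v' w'] .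
    have split: "(\<integral>x. ?I x * q (v + w) n x \<partial>lborel) =
      (\<integral>y. ?I (y - t n *\<^sub>R v) * q w n y \<partial>lborel)
          + (\<integral>x. ?I x * q v n x \<partial>lborel)" for n
    proof -
      have *: "(\<integral>y. ?I (y - t n *\<^sub>R v) * q w n y \<partial>lborel)
          = (\<integral>x. ?I x * q w n (t n *\<^sub>R v + x) \<partial>lborel)"
        by (subst integral_lborel_translation[symmetric, where c = "t n *\<^sub>R v"]) simp_all
      have **: "?I x * q (v + w) n x = ?I x * q w n (t n *\<^sub>R v + x) + ?I x * q v n x" for x
      proof -
        \<comment> \<open>The increment along \<open>v + w\<close> is split at the intermediate
          point x + t v. This evaluates the quotient for \<open>w\<close> at a shifted point;
          translating the integral moves the shift onto the box.\<close>
        have "q (v + w) n x = q w n (t n *\<^sub>R v + x) + q v n x"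
          unfolding q_def diff_quot_def add_divide_distrib[symmetric]
            by (simp add: scaleR_add_right add_ac)
        then show ?thesis by (simp add: distrib_left)
      qed
      have i1: "integrable lborel (\<lambda>x. ?I x * q v n x)"
        and i2: "integrable lborel (\<lambda>x. ?I x * q (v + w) n x)"
        using int_q[of n 0] by simp_all
      have "integrable lborel (\<lambda>x. ?I x * q w n (t n *\<^sub>R v + x))"
        using Bochner_Integration.integrable_diff[OF i2 i1] unfolding ** by simp
      then show ?thesis unfolding * using i1 by (simp add: **)
    qed
    have "(\<integral>y. ?I y * dir_deriv f (v + w) y \<partial>lborel)
        = (\<integral>y. ?I y * dir_deriv f w y \<partial>lborel)
            + (\<integral>y. ?I y * dir_deriv f v y \<partial>lborel)"
    proof (rule LIMSEQ_unique)
      show "(\<lambda>n. \<integral>x. ?I x * q (v + w) n x \<partial>lborel)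
          \<longlonglongrightarrow> (\<integral>y. ?I y * dir_deriv f (v + w) y \<partial>lborel)"
        using lim(3)[of a b 0 "v + w"] by simp
      show "(\<lambda>n. \<integral>x. ?I x * q (v + w) n x \<partial>lborel) \<longlonglongrightarrow>
          (\<integral>y. ?I y * dir_deriv f w y \<partial>lborel)
              + (\<integral>y. ?I y * dir_deriv f v y \<partial>lborel)"
        unfolding split using lim(3)[of a b v w] lim(3)[of a b 0 v] by (intro tendsto_add) simp_all
    qed
    then have "(\<integral>y. ?I y * k y \<partial>lborel) = 0"
      and ik: "integrable lborel (\<lambda>y. ?I y * k y)"
      using lim(1)[of a b "v+w"] lim(1)[of a b v] lim(1)[of a b w]
      by (simp_all add: k_def right_diff_distrib)
    then have "((\<lambda>y. ?I y * k y) has_integral 0) UNIV"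
      using has_integral_integral_lborel[OF ik] by simp
    moreover have "(\<lambda>y. ?I y * k y) = (\<lambda>y. if y \<in> cbox a b then k y else 0)"
      by (auto simp: indicator_def)
    ultimately show ?thesis by (simp only: has_integral_restrict_UNIV)
  qed
  obtain N where N: "negligible N"
    and D: "\<And>x e. x \<notin> N \<Longrightarrow> 0 < e \<Longrightarrow>
      \<exists>d>0. \<forall>h. 0 < h \<and> h < d \<longrightarrow>
        norm (integral (cbox x (x + h *\<^sub>R One)) k /\<^sub>R h ^ DIM('a) - k x) < e"
    using integrable_ccontinuous_explicit[of k] k_int by (metis has_integral_integrable)
  have "k x = 0" if xN: "x \<notin> N" for x
  proof (rule ccontr)
    assume "k x \<noteq> 0"
    then obtain d where d: "d > 0" "\<And>h. 0 < h \<and> h < d \<Longrightarrow> 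
        norm (integral (cbox x (x + h *\<^sub>R One)) k /\<^sub>R h ^ DIM('a) - k x) < \<bar>k x\<bar>"
      using D[OF xN, of "\<bar>k x\<bar>"] by auto
    then show False using d(2)[of "d/2"] integral_unique[OF k_int] by simp
  qed
  then have "{x. dir_deriv f (v + w) x \<noteq> dir_deriv f v x + dir_deriv f w x} \<subseteq> N"
    by (force simp: k_def)
  then show ?thesis using N negligible_subset by blast
qed

lemma dir_deriv_scaleR:
  assumes "has_dir_deriv f v x"
  shows "dir_deriv f (c *\<^sub>R v) x = c * dir_deriv f v x"
proof (cases "c = 0")
  case True
  then show ?thesis by (simp add: dir_deriv_def diff_quot_def limI)
next
  case False
  have "((\<lambda>t. c * t) \<longlongrightarrow> 0) (at 0)" by (auto intro!: tendsto_eq_intros)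
  then have "filterlim (\<lambda>t. c * t) (at 0) (at 0)"
    using False by (auto simp: filterlim_at eventually_at intro: exI[of _ 1])
  then have "((\<lambda>t. c * diff_quot f v x (c * t)) \<longlongrightarrow> c * dir_deriv f v x) (at 0)"
    by (intro tendsto_mult tendsto_const filterlim_compose[OF dir_deriv_tendsto[OF assms]])
  moreover have "(\<lambda>t. c * diff_quot f v x (c * t)) = diff_quot f (c *\<^sub>R v) x"
    using False by (auto simp: diff_quot_def fun_eq_iff divide_simps mult.commute)
  ultimately have l: "(diff_quot f (c *\<^sub>R v) x \<longlongrightarrow> c * dir_deriv f v x) (at 0)"
    by simp
  then have "has_dir_deriv f (c *\<^sub>R v) x" by (auto simp: has_dir_deriv_def)
  from dir_deriv_tendsto[OF this] l show ?thesis by (metis LIM_unique)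
qed

lemma dir_deriv_basis_ae:
  fixes f :: "'a::euclidean_space \<Rightarrow> real"
  assumes f: "L-lipschitz_on UNIV f"
  shows "negligible {x. dir_deriv f v x \<noteq> (\<Sum>b\<in>Basis. (v \<bullet> b) * dir_deriv f b x)}"
proof -
  have "negligible {x. dir_deriv f (\<Sum>b\<in>F. (v
      \<bullet> b) *\<^sub>R b) x \<noteq> (\<Sum>b\<in>F. (v \<bullet> b) * dir_deriv f b x)}"
    if "finite F" for F :: "'a set"
    using that
  proof (induction F)
    case empty
    show ?case by (simp add: dir_deriv_def diff_quot_def limI)
  next
    case (insert b F)
    let ?s = "\<Sum>b\<in>F. (v \<bullet> b) *\<^sub>R b"
    have "negligible ({x. dir_deriv f ((v \<bullet> b) *\<^sub>R b
        + ?s) x \<noteq> dir_deriv f ((v \<bullet> b) *\<^sub>R b) x + dir_deriv f ?s x}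
       \<union> {x. \<not> has_dir_deriv f b x} \<union> {x. dir_deriv f ?s x \<noteq> (\<Sum>b\<in>F. (v \<bullet> b) * dir_deriv f b x)})"
      by (intro negligible_Un dir_deriv_add_ae[OF f] lipschitz_has_dir_deriv_ae[OF f] insert.IH)
    then show ?case
      by (rule negligible_subset) (use insert.hyps in \<open>auto simp: dir_deriv_scaleR\<close>)
  qed
  from this[OF finite_Basis] show ?thesis by (simp add: euclidean_representation)
qed

text \<open>Off a null set the directional derivatives along a countable dense set of directions
  exist and are values of one linear map. The Lipschitz bound makes the difference quotients
  equicontinuous in the direction, so finitely many of these directions control the whole compact
  unit sphere and convergence becomes uniform.\<close>

theorem rademacher_real:
  fixes f :: "'a::euclidean_space \<Rightarrow> real"
  assumes f: "L-lipschitz_on UNIV f"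
  shows "negligible {x. \<not> f differentiable (at x)}"
proof -
  have L0: "0 \<le> L" using f by (rule lipschitz_on_nonneg)
  obtain V :: "'a set" where V: "countable V"
    and dense: "\<And>X. open X \<Longrightarrow> X \<noteq> {}
        \<Longrightarrow> \<exists>d\<in>V. d \<in> X"
    by (rule countable_dense_setE) blast
  define N where "N = (\<Union>v\<in>V. {x. \<not> has_dir_deriv f v x} \<union>
     {x. dir_deriv f v x \<noteq> (\<Sum>b\<in>Basis. (v \<bullet> b) * dir_deriv f b x)})"
  have "negligible N" unfolding N_def
    by (intro negligible_countable_Union countable_image V)
       (auto intro!: negligible_Un lipschitz_has_dir_deriv_ae[OF f] dir_deriv_basis_ae[OF f])
  moreover have "f differentiable (at x)" if x: "x \<notin> N" for x
  proof -
    define A where "A h = (\<Sum>b\<in>Basis. (h \<bullet> b) * dir_deriv f b x)" for h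
    have "linear A" unfolding A_def
      by (intro linearI) (simp_all add: inner_left_distrib distrib_right sum.distrib sum_distrib_left mult.assoc)
    then have bl: "bounded_linear A" by (rule linear_conv_bounded_linear[THEN iffD1])
    then obtain C where C: "C > 0" "\<And>h. norm (A h) \<le> norm h * C"
      using bounded_linear.pos_bounded by blast
    have lim: "(diff_quot f v x \<longlongrightarrow> A v) (at 0)" if "v \<in> V" for v
      using x that dir_deriv_tendsto[of f v x] by (auto simp: N_def A_def)
    have "(f has_derivative A) (at x)"
      unfolding has_derivative_at_alt
    proof (intro conjI bl allI impI)
      fix e :: real assume "e > 0"
      \<comment> \<open>The denominator collects three errors: \<open>L\<close> for changing the
        direction inside \<open>f\<close>, \<open>C\<close> for changing it inside \<open>A\<close>,
        and 1 for the difference quotient.\<close>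
      define e' where "e' = e / (L + C + 1)"
      have e': "e' > 0" "e' * (L + C + 1) = e" using \<open>e > 0\<close> L0 C(1) by (auto simp: e'_def)
      have "sphere 0 1 \<subseteq> (\<Union>v\<in>V. ball v e')"
      proof
        fix u :: 'a
        from dense[of "ball u e'"] e'(1) obtain v where "v \<in> V" "v \<in> ball u e'"
          by (metis centre_in_ball empty_iff open_ball)
        then show "u \<in> (\<Union>v\<in>V. ball v e')" by (auto simp: dist_commute)
      qed
      from compactE_image[OF compact_sphere _ this]
      obtain F where F: "F \<subseteq> V" "finite F" "sphere 0 1
          \<subseteq> (\<Union>v\<in>F. ball v e')" by auto
      have "\<forall>\<^sub>F t in at 0. \<bar>diff_quot f v x t - A v\<bar> < e'" if "v \<in> F" for v
        using tendstoD[OF lim e'(1), of v] F(1) that by (auto simp: dist_real_def)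
      then have "\<forall>\<^sub>F t in at 0. \<forall>v\<in>F. \<bar>diff_quot f v x t - A v\<bar> < e'"
        by (intro eventually_ball_finite F(2)) auto
      then obtain d where d: "d > 0" "\<And>t v. t \<noteq> 0 \<Longrightarrow> \<bar>t\<bar> < d
          \<Longrightarrow> v \<in> F \<Longrightarrow> \<bar>diff_quot f v x t - A v\<bar> < e'"
        unfolding eventually_at by auto
      have "norm (f y - f x - A (y - x)) \<le> e * norm (y - x)" if y: "norm (y - x) < d" for y
      proof (cases "y = x")
        case True
        then show ?thesis using linear_0[OF \<open>linear A\<close>] by simp
      next
        case False
        define r where "r = norm (y - x)"
        define u where "u = (y - x) /\<^sub>R r"
        have r: "0 < r" "r < d" using False y by (auto simp: r_def)
        have yx: "y = x + r *\<^sub>R u" using r by (simp add: u_def)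
        have "u \<in> sphere 0 1" using r by (simp add: u_def r_def)
        then obtain v where v: "v \<in> F" "norm (v - u) < e'" using F(3) by (auto simp: dist_norm)
        have "\<bar>f y - f (x + r *\<^sub>R v)\<bar> \<le> L * norm (r *\<^sub>R (u - v))"
          using lipschitz_onD[OF f, of y "x + r *\<^sub>R v"] by (simp add: yx dist_norm algebra_simps)
        also have "\<dots> \<le> L * (r * e')"
          using v(2) r L0 by (intro mult_left_mono) (auto simp: norm_minus_commute)
        finally have 1: "\<bar>f y - f (x + r *\<^sub>R v)\<bar> \<le> L * (r * e')" .
        have "\<bar>(f (x + r *\<^sub>R v) - f x) / r - A v\<bar> < e'"
          using d(2)[of r v] r v(1) by (simp add: diff_quot_def)
        then have "\<bar>r * ((f (x + r *\<^sub>R v) - f x) / r - A v)\<bar> \<le> r * e'"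
          using r by (simp add: abs_mult)
        then have 2: "\<bar>f (x + r *\<^sub>R v) - f x - r * A v\<bar> \<le> r * e'"
          using r
            by (metis (no_types, lifting) less_irrefl nonzero_mult_div_cancel_left right_diff_distrib times_divide_eq_right)
        have "\<bar>r * A (v - u)\<bar> \<le> r * (norm (v - u) * C)"
          using C(2)[of "v - u"] r by (simp add: abs_mult)
        also have "\<dots> \<le> r * (e' * C)"
          using v(2) r C(1) by (intro mult_left_mono mult_right_mono) auto
        finally have 3: "\<bar>r * A v - A (y - x)\<bar> \<le> r * (e' * C)"
          using linear_diff[OF \<open>linear A\<close>, of v u] linear_scale[OF \<open>linear A\<close>, of r u]
          by (simp add: yx right_diff_distrib)
        have "\<bar>f y - f x - A (y - x)\<bar> \<le> L * (r * e') + r * e' + r * (e' * C)"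
          using 1 2 3 by linarith
        also have "\<dots> = (e' * (L + C + 1)) * r" by (simp add: algebra_simps)
        finally show ?thesis unfolding e'(2) by (simp add: r_def)
      qed
      then show "\<exists>d>0. \<forall>y. norm (y - x) < d \<longrightarrow> norm (f y - f x - A (y - x)) \<le> e * norm (y - x)"
        using d(1) by blast
    qed
    then show ?thesis by (rule differentiableI)
  qed
  then have "{x. \<not> f differentiable (at x)} \<subseteq> N" by blast
  ultimately show ?thesis using negligible_subset by blast
qed

theorem rademacher:
  fixes f :: "'a::euclidean_space \<Rightarrow> 'b::euclidean_space"
  assumes f: "L-lipschitz_on UNIV f"
  shows "negligible {x. \<not> f differentiable (at x)}"
proof -
  have "negligible (\<Union>b\<in>(Basis::'b set). {x. \<not> (\<lambda>x. f x
      \<bullet> b) differentiable (at x)})"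
  proof (intro negligible_Union finite_imageI finite_Basis)
    fix S assume "S \<in> (\<lambda>b. {x. \<not> (\<lambda>x. f x
        \<bullet> b) differentiable (at x)}) ` (Basis::'b set)"
    then obtain b :: 'b where b: "b \<in> Basis"
      and S: "S = {x. \<not> (\<lambda>x. f x \<bullet> b) differentiable (at x)}" by blast
    have "L-lipschitz_on UNIV (\<lambda>x. f x \<bullet> b)"
    proof (rule lipschitz_onI)
      fix x y
      have "dist (f x \<bullet> b) (f y \<bullet> b) \<le> dist (f x) (f y)"
        using Basis_le_norm[OF b, of "f x - f y"] by (simp add: dist_norm inner_diff_left)
      also have "\<dots> \<le> L * dist x y" by (rule lipschitz_onD[OF f]) auto
      finally show "dist (f x \<bullet> b) (f y \<bullet> b) \<le> L * dist x y" .
    qed (rule lipschitz_on_nonneg[OF f])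
    then show "negligible S" unfolding S by (rule rademacher_real)
  qed
  then show ?thesis
    by (rule negligible_subset) (auto simp: differentiable_componentwise_within[of f])
qed

subsection \<open>Second order expansions of convex functions at contact points\<close>

lemma norm_add_scaleR_sq:
  fixes a b :: "'a::real_inner"
  shows "(norm (a + t *\<^sub>R b))\<^sup>2
      = (norm a)\<^sup>2 + 2 * t * (a \<bullet> b) + t\<^sup>2 * (norm b)\<^sup>2"
  unfolding power2_norm_eq_inner
  by (simp add: inner_add_left inner_add_right inner_commute[of b a] power2_eq_square algebra_simps)

definition subgradient :: "('a::real_inner \<Rightarrow> real) \<Rightarrow> 'a \<Rightarrow> 'a \<Rightarrow> bool" where
  "subgradient F x p \<longleftrightarrow> (\<forall>y. F x + p \<bullet> (y - x) \<le> F y)"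

lemma subgradient_monotone:
  assumes "subgradient F x p" "subgradient F y q"
  shows "0 \<le> (p - q) \<bullet> (x - y)"
proof -
  have "F x + p \<bullet> (y - x) \<le> F y" "F y + q \<bullet> (x - y) \<le> F x"
    using assms by (auto simp: subgradient_def)
  then show ?thesis by (simp add: inner_diff_left inner_diff_right algebra_simps)
qed

text \<open>Convexity is carried as the existence of subgradients, the form in which a supremum of
  attained affine functions supplies it. The two subgradient inequalities at the intermediate point
  are averaged so that the linear terms cancel.\<close>

lemma subgradients_imp_convex:
  assumes "\<And>y. \<exists>q. subgradient F y q" "0 \<le> t" "t \<le> 1"
  shows "F (x + t *\<^sub>R (y - x)) \<le> (1 - t) * F x + t * F y"
proof -
  define w where "w = x + t *\<^sub>R (y - x)"
  obtain q where q: "subgradient F w q" using assms(1) by blast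
  have "F w + q \<bullet> (x - w) \<le> F x" "F w + q \<bullet> (y - w) \<le> F y"
    using q by (auto simp: subgradient_def)
  then have "(1 - t) * (F w + q \<bullet> (x - w)) + t * (F w + q \<bullet> (y - w))
      \<le> (1 - t) * F x + t * F y"
    using assms(2,3) by (intro add_mono mult_left_mono) auto
  moreover have "(1 - t) * (F w + q \<bullet> (x - w)) + t * (F w + q \<bullet> (y - w)) = F w"
    by (simp add: w_def inner_add_right inner_diff_right algebra_simps)
  ultimately show ?thesis by (simp add: w_def)
qed

section \<open>Resolvents, and convex functions touched from above by paraboloids\<close>

text \<open>The point \<open>x\<close> is the proximal point of \<open>z\<close>, the minimiser of F
  y + |y - z|^2 / 2; its optimality condition says that z - x is a subgradient.\<close>

lemma resolvent_exists:
  fixes F :: "'a::euclidean_space \<Rightarrow> real"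
  assumes F: "B-lipschitz_on UNIV F" and sub: "\<And>y. \<exists>q. subgradient F y q"
  shows "\<exists>x. subgradient F x (z - x)"
proof -
  have B0: "0 \<le> B" using F by (rule lipschitz_on_nonneg)
  define h where "h x = F x + (norm (x - z))\<^sup>2 / 2" for x
  have "continuous_on (cball z (2 * B)) h" unfolding h_def
    by (intro continuous_intros continuous_on_subset[OF lipschitz_on_continuous_on[OF F]]) auto
  then obtain x where x: "x \<in> cball z (2 * B)" "\<And>y. y \<in> cball z (2 * B)
      \<Longrightarrow> h x \<le> h y"
    using continuous_attains_inf[of "cball z (2 * B)" h] B0 by auto
  have min: "h x \<le> h y" for y
  \<comment> \<open>Beyond distance 2 B from \<open>z\<close> the quadratic term exceeds the largest
    drop that the Lipschitz constant of \<open>F\<close> allows.\<close>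
  proof (cases "y \<in> cball z (2 * B)")
    case False
    then have y: "2 * B < norm (y - z)" by (simp add: dist_norm norm_minus_commute)
    have "F z - F y \<le> B * norm (y - z)"
      using lipschitz_onD[OF F, of z y] by (simp add: dist_norm norm_minus_commute abs_le_iff)
    also have "\<dots> \<le> norm (y - z) / 2 * norm (y - z)" using y by (intro mult_right_mono) auto
    finally have "h z \<le> h y" by (simp add: h_def power2_eq_square)
    moreover have "h x \<le> h z" using x(2)[of z] B0 by simp
    ultimately show ?thesis by simp
  qed (use x in auto)
  have "F x + (z - x) \<bullet> (y - x) \<le> F y" for y
  proof -
    define c where "c = F y - F x - (z - x) \<bullet> (y - x)"
    define D where "D = (x - z) \<bullet> (y - x)"
    have D_eq: "D = c + F x - F y"
      by (simp add: c_def D_def inner_diff_left)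
    \<comment> \<open>Minimality is tested at a point of the segment from \<open>x\<close> to
      \<open>y\<close>, with \<open>F\<close> bounded there by convexity. After division by
      \<open>t\<close> the quadratic remainder disappears as t \<rightarrow> 0.\<close>
    have *: "0 \<le> c + t * ((norm (y - x))\<^sup>2 / 2)" if t: "0 < t" "t < 1" for t :: real
    proof -
      have "h x \<le> h (x + t *\<^sub>R (y - x))" by (rule min)
      also have "\<dots>
          \<le> (1 - t) * F x + t * F y + (norm (x - z + t *\<^sub>R (y - x)))\<^sup>2 / 2"
        using subgradients_imp_convex[OF sub, of t x y] t by (simp add: h_def algebra_simps)
      also have "(norm (x - z + t *\<^sub>R (y - x)))\<^sup>2
          = (norm (x - z))\<^sup>2 + 2 * t * D + t\<^sup>2 * (norm (y - x))\<^sup>2"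
        unfolding D_def by (rule norm_add_scaleR_sq)
      finally have "0 \<le> t * (c + t * ((norm (y - x))\<^sup>2 / 2))"
        by (simp add: D_eq h_def power2_eq_square field_simps)
      then show ?thesis using t by (simp add: zero_le_mult_iff)
    qed
    have "((\<lambda>t. c + t * ((norm (y - x))\<^sup>2 / 2)) \<longlongrightarrow> c
        + 0 * ((norm (y - x))\<^sup>2 / 2)) (at_right 0)"
      by (intro tendsto_intros)
    moreover have "\<forall>\<^sub>F t in at_right 0. 0 \<le> c + t * ((norm (y - x))\<^sup>2 / 2)"
      using eventually_at_right_real[OF zero_less_one] by eventually_elim (use * in auto)
    ultimately have "0 \<le> c + 0 * ((norm (y - x))\<^sup>2 / 2)"
      by (rule tendsto_lowerbound) simp
    then show ?thesis by (simp add: c_def)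
  qed
  then show ?thesis by (auto simp: subgradient_def)
qed

text \<open>The inverse of identity plus subdifferential. Monotonicity of subgradients makes the
  point unique, so the choice operator merely names it.\<close>

definition resolvent :: "('a::real_inner \<Rightarrow> real) \<Rightarrow> 'a \<Rightarrow> 'a" where
  "resolvent F z = (SOME x. subgradient F x (z - x))"

text \<open>Monotonicity yields firm nonexpansiveness, |x - y|^2 \<le> (z - w) \<bullet> (x - y),
  and Cauchy-Schwarz finishes.\<close>

lemma subgradient_nonexpansive:
  assumes "subgradient F x (z - x)" "subgradient F y (w - y)"
  shows "norm (x - y) \<le> norm (z - w)"
proof -
  have "0 \<le> ((z - w) - (x - y)) \<bullet> (x - y)"
    using subgradient_monotone[OF assms] by (simp add: algebra_simps)
  then have "(norm (x - y))\<^sup>2 \<le> (z - w) \<bullet> (x - y)"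
    by (simp add: inner_diff_left power2_norm_eq_inner)
  also have "\<dots> \<le> norm (z - w) * norm (x - y)" by (rule norm_cauchy_schwarz)
  finally show ?thesis by (cases "x = y") (auto simp: power2_eq_square)
qed

lemma resolvent_subgradient:
  fixes F :: "'a::euclidean_space \<Rightarrow> real"
  assumes F: "B-lipschitz_on UNIV F" and sub: "\<And>y. \<exists>q. subgradient F y q"
  shows "subgradient F (resolvent F z) (z - resolvent F z)"
  unfolding resolvent_def by (rule someI_ex) (rule resolvent_exists[OF assms])

lemma resolvent_eq:
  fixes F :: "'a::euclidean_space \<Rightarrow> real"
  assumes F: "B-lipschitz_on UNIV F" and sub: "\<And>y. \<exists>q. subgradient F y q"
    and "subgradient F x p"
  shows "resolvent F (x + p) = x"
  using subgradient_nonexpansive[OF resolvent_subgradient[OF F sub, of "x + p"], of x "x + p"] assms(3)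
    by simp

lemma resolvent_lipschitz:
  fixes F :: "'a::euclidean_space \<Rightarrow> real"
  assumes F: "B-lipschitz_on UNIV F" and sub: "\<And>y. \<exists>q. subgradient F y q"
  shows "norm (resolvent F z - resolvent F w) \<le> norm (z - w)"
  by (intro subgradient_nonexpansive[OF resolvent_subgradient[OF F sub] resolvent_subgradient[OF F sub]])

text \<open>A subgradient bounds \<open>F\<close> from below and the paraboloid bounds it from
  above, so their slopes cannot differ much. The difference is tested in the direction q - p; the
  lengths 1 / (2 C) and 1 / (4 C) are the ones that optimise the respective quadratic
  estimates.\<close>

lemma subgradient_near_contact:
  fixes F :: "'a::euclidean_space \<Rightarrow> real"
  assumes sub: "\<And>y. \<exists>q. subgradient F y q" and C: "C > 0"
    and par: "\<And>y. F y \<le> F x + p \<bullet> (y - x) + C * (norm (y - x))\<^sup>2"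
  shows "subgradient F x p"
    and "subgradient F y q \<Longrightarrow> norm (q - p) \<le> 4 * C * norm (y - x)"
proof -
  show p: "subgradient F x p"
  proof -
    obtain q where q: "subgradient F x q" using sub by blast
    have *: "(q - p) \<bullet> h \<le> C * (norm h)\<^sup>2" for h
      using q[unfolded subgradient_def, rule_format, of "x + h"] par[of "x + h"]
      by (simp add: inner_diff_left)
    have "(norm (q - p))\<^sup>2 / (2 * C) \<le> C * ((norm (q - p))\<^sup>2 / (2 * C)\<^sup>2)"
      using *[of "(1 / (2 * C)) *\<^sub>R (q - p)"] C
      by (simp add: power2_norm_eq_inner[symmetric] power_mult_distrib power_divide)
    also have "\<dots> = (norm (q - p))\<^sup>2 / (4 * C)" using C by (simp add: power2_eq_square)
    finally have "(norm (q - p))\<^sup>2 / (2 * C) \<le> (norm (q - p))\<^sup>2 / (4 * C)" .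
    then have "(norm (q - p))\<^sup>2 \<le> 0" using C by (simp add: field_simps)
    then show ?thesis using q by simp
  qed
  assume q: "subgradient F y q"
  have *: "(q - p) \<bullet> h \<le> C * (norm (y - x + h))\<^sup>2" for h
    using q[unfolded subgradient_def, rule_format, of "y + h"] par[of "y + h"]
      p[unfolded subgradient_def, rule_format, of y]
    by (simp add: inner_diff_left inner_diff_right inner_add_right algebra_simps)
  have "(norm (y - x + h))\<^sup>2 \<le> 2 * (norm (y - x))\<^sup>2 + 2 * (norm h)\<^sup>2" for h
    using zero_le_power2[of "norm (y - x - h)"]
    by (simp add: power2_norm_eq_inner inner_diff_left inner_diff_right inner_add_left inner_add_right inner_commute)
  then have **: "(q - p) \<bullet> h \<le> C * (2 * (norm (y - x))\<^sup>2 + 2 * (norm h)\<^sup>2)" for h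
    using *[of h] C by (meson mult_left_mono less_imp_le order_trans)
  have "(norm (q - p))\<^sup>2 / (4 * C)
      \<le> C * (2 * (norm (y - x))\<^sup>2 + 2 * ((norm (q - p))\<^sup>2 / (16 * C\<^sup>2)))"
    using **[of "(1 / (4 * C)) *\<^sub>R (q - p)"] C
    by (simp add: power2_norm_eq_inner[symmetric] power_mult_distrib power_divide)
  also have "\<dots> = 2 * C * (norm (y - x))\<^sup>2 + (norm (q - p))\<^sup>2 / (8 * C)"
    using C by (simp add: field_simps power2_eq_square)
  finally have "(norm (q - p))\<^sup>2 \<le> (4 * C * norm (y - x))\<^sup>2"
    using C by (simp add: field_simps power2_eq_square)
  then show "norm (q - p) \<le> 4 * C * norm (y - x)"
    by (rule power2_le_imp_le) (use C in simp)
qed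

text \<open>Subgradients are integrated along the segment from \<open>x\<close> to x + h in discrete
  form. On each of \<open>n\<close> pieces the increment of \<open>F\<close> lies between the slopes
  at the two ends, and the sums of these slopes differ from the expected value only by the error
  \<open>e\<close> and a term of order 1 / n.\<close>

lemma subgradient_diff_imp_expansion:
  fixes F :: "'a::euclidean_space \<Rightarrow> real"
  assumes sub: "\<And>y. \<exists>q. subgradient F y q" and X: "linear X"
    and est: "\<And>y q. norm (y - x) < d \<Longrightarrow> subgradient F y q \<Longrightarrow>
      norm (q - p - X (y - x)) \<le> e * norm (y - x)"
    and h: "norm h < d" and e: "e \<ge> 0"
  shows "\<bar>F (x + h) - F x - p \<bullet> h - X h \<bullet> h / 2\<bar> \<le> e * (norm h)\<^sup>2"
proof -
  have step: "\<bar>F (x + h) - F x - p \<bullet> h - X h \<bullet> h / 2\<bar>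
      \<le> e * (norm h)\<^sup>2 + \<bar>X h \<bullet> h\<bar> / (2 * real n)"
    if n: "n > 0" for n :: nat
  proof -
    define y where "y k = x + (real k / real n) *\<^sub>R h" for k :: nat
    define c where "c = X h \<bullet> h"
    have qb: "\<bar>q \<bullet> h - p \<bullet> h - real k / real n * c\<bar> \<le> e * (norm h)\<^sup>2"
      if k: "k \<le> n" and q: "subgradient F (y k) q" for k q
    proof -
      have kn: "0 \<le> real k / real n" "real k / real n \<le> 1" using k n by auto
      have yx: "norm (y k - x) \<le> norm h"
        using kn mult_right_mono[OF kn(2), of "norm h"] by (simp add: y_def)
      have "q \<bullet> h - p \<bullet> h - real k / real n * c = (q - p - X (y k - x)) \<bullet> h"
        by (simp add: y_def c_def inner_diff_left linear_scale[OF X])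
      also have "\<bar>\<dots>\<bar> \<le> norm (q - p - X (y k - x)) * norm h"
        by (rule Cauchy_Schwarz_ineq2)
      also have "\<dots> \<le> (e * norm (y k - x)) * norm h"
        using est[of "y k" q] yx h q by (intro mult_right_mono) auto
      also have "\<dots> \<le> (e * norm h) * norm h"
        using yx e by (intro mult_right_mono mult_left_mono) auto
      finally show ?thesis by (simp add: power2_eq_square)
    qed
    have yy: "y (Suc k) - y k = (1 / real n) *\<^sub>R h" for k
      by (simp add: y_def scaleR_left_diff_distrib[symmetric] diff_divide_distrib[symmetric])
    define r where "r = (e * (norm h)\<^sup>2) / real n"
    have up: "F (y (Suc k)) - F (y k)
        \<le> (p \<bullet> h) / real n + real (Suc k) * (c / (real n)\<^sup>2) + r"
      and lo: "F (y (Suc k)) - F (y k) \<ge> (p \<bullet> h) / real n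
          + real k * (c / (real n)\<^sup>2) - r"
      if "k < n" for k
    proof -
      obtain q where q: "subgradient F (y (Suc k)) q" using sub by blast
      have "F (y (Suc k)) - F (y k) \<le> q \<bullet> (y (Suc k) - y k)"
        using q[unfolded subgradient_def, rule_format, of "y k"] by (simp add: inner_diff_right)
      also have "\<dots> = (q \<bullet> h) / real n" by (simp add: yy)
      also have "\<dots>
          \<le> (p \<bullet> h + real (Suc k) / real n * c + e * (norm h)\<^sup>2) / real n"
        using qb[of "Suc k" q] q that n by (intro divide_right_mono) auto
      also have "\<dots> = (p \<bullet> h) / real n + real (Suc k) * (c / (real n)\<^sup>2) + r"
        by (simp add: r_def add_divide_distrib power2_eq_square del: of_nat_Suc)
      finally show "F (y (Suc k)) - F (y k)
          \<le> (p \<bullet> h) / real n + real (Suc k) * (c / (real n)\<^sup>2) + r" .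
      obtain q where q: "subgradient F (y k) q" using sub by blast
      have "(p \<bullet> h) / real n + real k * (c / (real n)\<^sup>2) - r
          = (p \<bullet> h + real k / real n * c - e * (norm h)\<^sup>2) / real n"
        by (simp add: r_def add_divide_distrib diff_divide_distrib power2_eq_square)
      also have "\<dots> \<le> (q \<bullet> h) / real n"
        using qb[of k q] q that n by (intro divide_right_mono) auto
      also have "\<dots> = q \<bullet> (y (Suc k) - y k)" by (simp add: yy)
      also have "\<dots> \<le> F (y (Suc k)) - F (y k)"
        using q[unfolded subgradient_def, rule_format, of "y (Suc k)"] by simp
      finally show "F (y (Suc k)) - F (y k) \<ge> (p \<bullet> h) / real n
          + real k * (c / (real n)\<^sup>2) - r" .
    qed
    \<comment> \<open>With slopes at right ends the node numbers add up to m (m + 1) / 2, with left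
      ends to m (m - 1) / 2. The discrepancy for m = n is the source of the term |X h \<bullet> h| /
      (2 n).\<close>
    have upm: "F (y m) - F (y 0)
        \<le> real m * (p \<bullet> h) / real n + real m * (real m + 1) / 2 * (c / (real n)\<^sup>2)
            + real m * r"
      and lom: "F (y m) - F (y 0) \<ge> real m * (p \<bullet> h) / real n
          + real m * (real m - 1) / 2 * (c / (real n)\<^sup>2) - real m * r"
      if "m \<le> n" for m using that
    proof (induction m)
      case (Suc m)
      case 1
      show ?case using Suc.IH(1) up[of m] 1 by (simp add: field_simps)
      case 2
      show ?case using Suc.IH(2) lo[of m] 2 by (simp add: field_simps)
    qed simp_all
    have y0n: "y 0 = x" "y n = x + h" using n by (simp_all add: y_def)
    have nr: "real n * r = e * (norm h)\<^sup>2" using n by (simp add: r_def)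
    have n1: "real n * (real n + 1) / 2 * (c / (real n)\<^sup>2) = c / 2 + c / (2 * real n)"
      "real n * (real n - 1) / 2 * (c / (real n)\<^sup>2) = c / 2 - c / (2 * real n)"
      using n by (simp_all add: power2_eq_square field_simps)
    have "F (x + h) - F x \<le> p \<bullet> h + (c / 2 + c / (2 * real n)) + e * (norm h)\<^sup>2"
      using upm[of n] n unfolding y0n nr n1 by simp
    moreover have "F (x + h) - F x \<ge> p \<bullet> h
        + (c / 2 - c / (2 * real n)) - e * (norm h)\<^sup>2"
      using lom[of n] n unfolding y0n nr n1 by simp
    moreover have "\<bar>c / (2 * real n)\<bar> = \<bar>c\<bar> / (2 * real n)" by simp
    ultimately show ?thesis unfolding c_def[symmetric] by linarith
  qed
  have lim: "(\<lambda>n. e * (norm h)\<^sup>2 + \<bar>X h \<bullet> h\<bar> / 2 * inverse (real n))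
      \<longlonglongrightarrow> e * (norm h)\<^sup>2 + \<bar>X h \<bullet> h\<bar> / 2 * 0"
    by (intro tendsto_intros lim_inverse_n)
  have ev: "\<forall>\<^sub>F n in sequentially. \<bar>F (x
      + h) - F x - p \<bullet> h - X h \<bullet> h / 2\<bar>
      \<le> e * (norm h)\<^sup>2 + \<bar>X h \<bullet> h\<bar> / 2 * inverse (real n)"
    using eventually_gt_at_top[of "0::nat"]
  proof eventually_elim
    case (elim n)
    have "\<bar>X h \<bullet> h\<bar> / (2 * real n)
        = \<bar>X h \<bullet> h\<bar> / 2 * inverse (real n)"
      by (simp only: divide_inverse inverse_mult_distrib mult.assoc)
    then show ?case using step[OF elim] by simp
  qed
  show ?thesis using tendsto_lowerbound[OF lim ev] by simp
qed

text \<open>At a point where \<open>F\<close> is touched from above by a paraboloid, the resolvent is expanding, so a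
  derivative of the resolvent is automatically invertible and Sard's theorem is not needed.\<close>

lemma alexandrov_at_contact:
  fixes F :: "'a::euclidean_space \<Rightarrow> real"
  assumes F: "B-lipschitz_on UNIV F" and sub: "\<And>y. \<exists>q. subgradient F y q" and C: "C > 0"
    and par: "\<And>y. F y \<le> F x + p \<bullet> (y - x) + C * (norm (y - x))\<^sup>2"
    and diff: "resolvent F differentiable (at (x + p))"
  obtains X where "linear X"
    "\<And>e. e > 0 \<Longrightarrow> \<exists>d>0. \<forall>h. norm h < d \<longrightarrow>
      \<bar>F (x + h) - F x - p \<bullet> h - X h \<bullet> h / 2\<bar> \<le> e * (norm h)\<^sup>2"
proof -
  define J where "J = resolvent F"
  define z where "z = x + p"
  define c where "c = 1 + 4 * C"
  have c: "c > 1" using C by (simp add: c_def)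
  have p: "subgradient F x p" by (rule subgradient_near_contact(1)[OF sub C par])
  have Jz: "J z = x" unfolding J_def z_def by (rule resolvent_eq[OF F sub p])
  have J_eq: "J (y + q) = y" if "subgradient F y q" for y q
    unfolding J_def by (rule resolvent_eq[OF F sub that])
  have near: "norm (q - p) \<le> 4 * C * norm (y - x)" if "subgradient F y q" for y q
    by (rule subgradient_near_contact(2)[OF sub C par that])
  have near': "norm ((y + q) - z) \<le> c * norm (y - x)" if "subgradient F y q" for y q
  proof -
    have "norm ((y + q) - z) = norm ((y - x) + (q - p))" by (simp add: z_def algebra_simps)
    also have "\<dots> \<le> norm (y - x) + norm (q - p)" by (rule norm_triangle_ineq)
    finally show ?thesis using near[OF that] by (simp add: c_def algebra_simps)
  qed
  \<comment> \<open>Every point is of the form y + q with y its resolvent and q a subgradient at y,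
    so the bound on subgradients near \<open>x\<close> becomes a lower Lipschitz bound for
    \<open>J\<close> at \<open>z\<close>.\<close>
  have expand: "norm (z' - z) \<le> c * norm (J z' - J z)" for z'
  proof -
    have "subgradient F (J z') (z' - J z')" unfolding J_def by (rule resolvent_subgradient[OF F sub])
    from near'[OF this] show ?thesis by (simp add: Jz)
  qed
  obtain L where L: "(J has_derivative L) (at z)"
    using diff unfolding differentiable_def J_def z_def by blast
  then have bl: "bounded_linear L" by (rule has_derivative_bounded_linear)
  then have lin: "linear L" by (rule bounded_linear.linear)
  have L_est: "\<exists>d>0. \<forall>w. norm (w - z) < d \<longrightarrow> norm (J w - J z - L (w - z)) \<le> e * norm (w - z)" if "e > 0" for e
    using L that unfolding has_derivative_at_alt by blast
  \<comment> \<open>The lower bound passes to the derivative along rays. It makes \<open>L\<close>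
    injective, and an injective linear map of a finite-dimensional space into itself is
    invertible.\<close>
  have L_lower: "norm h \<le> c * norm (L h)" for h
  proof (cases "h = 0")
    case False
    show ?thesis
    proof (rule field_le_epsilon)
      fix e :: real assume "e > 0"
      define e1 where "e1 = e / (c * norm h)"
      have e1: "e1 > 0" "c * (e1 * norm h) = e" using \<open>e > 0\<close> c False by (auto simp: e1_def)
      obtain d where d: "d > 0" "\<And>w. norm (w - z) < d
          \<Longrightarrow> norm (J w - J z - L (w - z)) \<le> e1 * norm (w - z)"
        using L_est[OF e1(1)] by blast
      define t where "t = d / (2 * norm h)"
      have t: "t > 0" "norm (t *\<^sub>R h) < d" using d(1) False by (auto simp: t_def)
      have "t * norm h \<le> c * norm (J (z + t *\<^sub>R h) - J z)"
        using expand[of "z + t *\<^sub>R h"] t by simp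
      also have "norm (J (z + t *\<^sub>R h) - J z)
          \<le> norm (L (t *\<^sub>R h)) + e1 * norm (t *\<^sub>R h)"
        using d(2)[of "z + t *\<^sub>R h"] t norm_triangle_ineq2[of "J (z
            + t *\<^sub>R h) - J z" "L (t *\<^sub>R h)"] by simp
      also have "\<dots> = t * (norm (L h) + e1 * norm h)"
        using t by (simp add: linear_scale[OF lin] algebra_simps)
      finally have "t * norm h \<le> c * (t * (norm (L h) + e1 * norm h))" using c by simp
      also have "\<dots> = t * (c * norm (L h) + c * (e1 * norm h))" by (simp add: algebra_simps)
      finally have "t * norm h \<le> t * (c * norm (L h) + e)" unfolding e1(2) .
      then show "norm h \<le> c * norm (L h) + e" using t(1) by simp
    qed
  qed (use c in simp)
  have "inj L"
    unfolding linear_injective_0[OF lin]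
  proof (intro allI impI)
    fix h assume "L h = 0"
    then show "h = 0" using L_lower[of h] by simp
  qed
  then obtain Li where Li: "linear Li" "\<And>h. Li (L h) = h" "\<And>h. L (Li h) = h"
    using linear_injective_isomorphism[OF lin] by blast
  have Li_bound: "norm (Li h) \<le> c * norm h" for h
    using L_lower[of "Li h"] by (simp add: Li)
  \<comment> \<open>Since \<open>J\<close> inverts identity plus subdifferential, its derivative
    should be the inverse of I + X; this dictates X = L^(-1) - I.\<close>
  define X where "X h = Li h - h" for h
  have X: "linear X" unfolding X_def by (intro linear_compose_sub Li linear_id[unfolded id_def])
  moreover have "\<exists>d>0. \<forall>h. norm h < d \<longrightarrow>
      \<bar>F (x + h) - F x - p \<bullet> h - X h \<bullet> h / 2\<bar>
          \<le> e * (norm h)\<^sup>2" if e: "e > 0" for e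
  proof -
    \<comment> \<open>One factor \<open>c\<close> is lost in applying \<open>Li\<close>, the other
      in passing from |w - z| to |y - x|.\<close>
    define e1 where "e1 = e / c\<^sup>2"
    have e1: "e1 > 0" "c * (e1 * c) = e" using e c by (auto simp: e1_def power2_eq_square)
    obtain d where d: "d > 0" "\<And>w. norm (w - z) < d
        \<Longrightarrow> norm (J w - J z - L (w - z)) \<le> e1 * norm (w - z)"
      using L_est[OF e1(1)] by blast
    have est: "norm (q - p - X (y - x)) \<le> e * norm (y - x)"
      if y: "norm (y - x) < d / c" and q: "subgradient F y q" for y q
    proof -
      define w where "w = y + q"
      have wz: "norm (w - z) \<le> c * norm (y - x)" unfolding w_def by (rule near'[OF q])
      also have "\<dots> < d" using y c by (simp add: field_simps)
      finally have *: "norm (y - x - L (w - z)) \<le> e1 * norm (w - z)"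
        using d(2)[of w] by (simp add: w_def J_eq[OF q] Jz)
      have "q - p - X (y - x) = - Li (y - x - L (w - z))"
        unfolding X_def linear_diff[OF Li(1), of "y - x" "L (w - z)"] Li(2)
        by (simp add: w_def z_def)
      then have "norm (q - p - X (y - x)) \<le> c * norm (y - x - L (w - z))"
        using Li_bound by simp
      also have "\<dots> \<le> c * (e1 * (c * norm (y - x)))"
        using * wz c e1(1) by (intro mult_left_mono order_trans[OF *] mult_left_mono) auto
      also have "\<dots> = e * norm (y - x)" using e1(2) by (simp add: mult.assoc[symmetric])
      finally show ?thesis .
    qed
    show ?thesis
    proof (intro exI[of _ "d / c"] conjI allI impI)
      show "0 < d / c" using d(1) c by simp
      fix h :: 'a assume "norm h < d / c"
      then show "\<bar>F (x + h) - F x - p \<bullet> h - X h \<bullet> h / 2\<bar>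
          \<le> e * (norm h)\<^sup>2"
        using subgradient_diff_imp_expansion[OF sub X, of x "d / c" p e h] est e by auto
    qed
  qed
  ultimately show ?thesis using that by blast
qed

section \<open>Upper contact sets and Jensen's lemma\<close>

definition contact_point :: "('a::real_inner \<Rightarrow> real) \<Rightarrow> 'a \<Rightarrow> 'a \<Rightarrow> bool" where
  "contact_point \<Psi> w P
      \<longleftrightarrow> (\<forall>w'. \<Psi> w' \<le> \<Psi> w + P \<bullet> (w' - w))"

text \<open>Quadratic decay beats the linear term. The radius is explicit and uniform over all
  slopes of norm at most 1, so that a tolerance can be chosen from it before the contact point is
  known.\<close>

lemma contact_point_bound:
  fixes \<Psi> :: "'a::real_inner \<Rightarrow> real"
  assumes coerc: "\<And>w. \<Psi> w \<le> c1 - c2 * (norm w)\<^sup>2" and c2: "c2 > 0"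
    and P: "norm P \<le> 1" and le: "\<Psi> 0 \<le> \<Psi> w - P \<bullet> w"
  shows "norm w \<le> 1 + (1 + \<bar>c1 - \<Psi> 0\<bar>) / c2"
proof (rule ccontr)
  define r where "r = norm w"
  assume "\<not> ?thesis"
  then have r: "r > 1 + (1 + \<bar>c1 - \<Psi> 0\<bar>) / c2" by (simp add: r_def)
  then have r1: "r > 1" using c2 by (smt (verit) divide_nonneg_pos)
  have "c2 * r > 1 + \<bar>c1 - \<Psi> 0\<bar>" using r c2 by (simp add: field_simps)
  then have "r * (c2 * r - 1) > r * \<bar>c1 - \<Psi> 0\<bar>"
    using r1 by (intro mult_strict_left_mono) auto
  moreover have "r * \<bar>c1 - \<Psi> 0\<bar> \<ge> 1 * \<bar>c1 - \<Psi> 0\<bar>"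
    using r1 by (intro mult_right_mono) auto
  ultimately have "c2 * r\<^sup>2 - r > c1 - \<Psi> 0" by (simp add: algebra_simps power2_eq_square)
  moreover have "\<bar>P \<bullet> w\<bar> \<le> r"
  proof -
    have "\<bar>P \<bullet> w\<bar> \<le> norm P * norm w" by (rule Cauchy_Schwarz_ineq2)
    also have "\<dots> \<le> 1 * norm w" using P by (intro mult_right_mono) auto
    finally show ?thesis by (simp add: r_def)
  qed
  ultimately show False using coerc[of w] le by (simp add: r_def)
qed

text \<open>Jensen's lemma: the slope is a Lipschitz function on the contact set and takes all small
  values there.\<close>

lemma contact_set_not_negligible:
  fixes \<Psi> :: "'a::euclidean_space \<Rightarrow> real"
  assumes cont: "continuous_on UNIV \<Psi>"
    and coerc: "\<And>w. \<Psi> w \<le> c1 - c2 * (norm w)\<^sup>2" and c2: "c2 > 0"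
    and semi: "\<And>w. \<exists>q. \<forall>w'. \<Psi> w
        + q \<bullet> (w' - w) - C * (norm (w' - w))\<^sup>2 \<le> \<Psi> w'" and C: "C > 0"
    and \<delta>: "0 < \<delta>" "\<delta> \<le> 1"
  shows "\<not> negligible {w. \<exists>P. norm P < \<delta> \<and> contact_point \<Psi> w P}"
proof
  define G where "G = {w. \<exists>P. norm P < \<delta> \<and> contact_point \<Psi> w P}"
  assume "negligible {w. \<exists>P. norm P < \<delta> \<and> contact_point \<Psi> w P}"
  then have "negligible G" by (simp add: G_def)
  \<comment> \<open>Semiconvexity supplies some slope \<open>q\<close> from below, contact the slope
    \<open>P\<close> from above; testing both in direction (q - P) / (2 C) forces q = P.\<close>
  have lower: "\<Psi> w + P \<bullet> (w' - w) - C * (norm (w' - w))\<^sup>2 \<le> \<Psi> w'"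
    if cp: "contact_point \<Psi> w P" for w P w'
  proof -
    obtain q where q: "\<And>w'. \<Psi> w + q \<bullet> (w' - w) - C * (norm (w' - w))\<^sup>2
        \<le> \<Psi> w'" using semi by blast
    have *: "(q - P) \<bullet> h \<le> C * (norm h)\<^sup>2" for h
      using q[of "w + h"] cp[unfolded contact_point_def, rule_format, of "w + h"]
      by (simp add: inner_diff_left)
    have "(norm (q - P))\<^sup>2 / (2 * C) \<le> C * ((norm (q - P))\<^sup>2 / (2 * C)\<^sup>2)"
      using *[of "(1 / (2 * C)) *\<^sub>R (q - P)"] C
      by (simp add: power2_norm_eq_inner[symmetric] power_mult_distrib power_divide)
    also have "\<dots> = (norm (q - P))\<^sup>2 / (4 * C)" using C by (simp add: power2_eq_square)
    finally have "(norm (q - P))\<^sup>2 \<le> 0" using C by (simp add: field_simps)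
    then show ?thesis using q by simp
  qed
  have slope: "norm (P' - P) \<le> 4 * C * norm (w' - w)"
    if cp: "contact_point \<Psi> w P" and cp': "contact_point \<Psi> w' P'" for w P w' P'
  proof (cases "P' = P")
    case False
    define D where "D = P' - P"
    \<comment> \<open>The lower paraboloid with slope \<open>P'\<close> at \<open>w'\<close> is
      compared at w' + h with the upper affine function of \<open>w\<close>; the upper affine
      function of \<open>w'\<close>, evaluated at \<open>w\<close>, removes the values of
      \<Psi>.\<close>
    have *: "D \<bullet> h \<le> C * (norm h)\<^sup>2 - D \<bullet> (w' - w)" for h
    proof -
      have "\<Psi> w' + P' \<bullet> h - C * (norm h)\<^sup>2 \<le> \<Psi> (w' + h)"
        using lower[OF cp', of "w' + h"] by simp
      moreover have "\<Psi> (w' + h) \<le> \<Psi> w + P \<bullet> (w' + h - w)"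
        using cp by (auto simp: contact_point_def)
      moreover have "\<Psi> w \<le> \<Psi> w' + P' \<bullet> (w - w')"
        using cp' by (auto simp: contact_point_def)
      ultimately show ?thesis by (simp add: D_def inner_diff_left inner_diff_right inner_add_right)
    qed
    have "(norm D)\<^sup>2 / (2 * C)
        \<le> C * ((norm D)\<^sup>2 / (2 * C)\<^sup>2) - D \<bullet> (w' - w)"
      using *[of "(1 / (2 * C)) *\<^sub>R D"] C
      by (simp add: power2_norm_eq_inner[symmetric] power_mult_distrib power_divide)
    also have "C * ((norm D)\<^sup>2 / (2 * C)\<^sup>2) = (norm D)\<^sup>2 / (4 * C)"
      using C by (simp add: power2_eq_square)
    finally have "(norm D)\<^sup>2 / (4 * C) \<le> - (D \<bullet> (w' - w))"
      using C by (simp add: field_simps)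
    also have "\<dots> \<le> norm D * norm (w' - w)"
      using Cauchy_Schwarz_ineq2[of D "w' - w"] by linarith
    finally have "(norm D)\<^sup>2 / (4 * C) \<le> norm D * norm (w' - w)" .
    then have "norm D * norm D \<le> norm D * (4 * C * norm (w' - w))"
      using C by (simp add: field_simps power2_eq_square)
    then show ?thesis using False by (simp add: D_def)
  qed (use C in simp)
  define s where "s w = (SOME P. norm P < \<delta> \<and> contact_point \<Psi> w P)" for w
  have s: "contact_point \<Psi> w (s w)" if "w \<in> G" for w
    using that someI_ex[of "\<lambda>P. norm P < \<delta> \<and> contact_point \<Psi> w P"]
      by (simp add: G_def s_def)
  have "negligible (s ` G)"
    using slope[OF s s]
    by (intro negligible_locally_Lipschitz_image[OF order_refl \<open>negligible G\<close>])
       (auto intro!: exI[of _ UNIV] exI[of _ "4 * C"])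
  moreover have "ball 0 \<delta> \<subseteq> s ` G"
  proof
    fix P :: 'a assume "P \<in> ball 0 \<delta>"
    then have P: "norm P < \<delta>" "norm P \<le> 1" using \<delta> by auto
    define W where "W = 1 + (1 + \<bar>c1 - \<Psi> 0\<bar>) / c2"
    have W0: "0 \<le> W" using c2 by (simp add: W_def)
    obtain w where w: "w \<in> cball 0 W" "\<And>w'. w' \<in> cball 0 W
        \<Longrightarrow> \<Psi> w' - P \<bullet> w' \<le> \<Psi> w - P \<bullet> w"
      using continuous_attains_sup[of "cball 0 W" "\<lambda>w. \<Psi> w - P \<bullet> w"] W0
      by (force intro!: continuous_intros continuous_on_subset[OF cont])
    have "\<Psi> w' - P \<bullet> w' \<le> \<Psi> w - P \<bullet> w" for w'
    proof (cases "w' \<in> cball 0 W")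
      case False
      then have "\<not> \<Psi> 0 \<le> \<Psi> w' - P \<bullet> w'"
        using contact_point_bound[OF coerc c2 P(2), of w'] by (auto simp: W_def)
      then show ?thesis using w(2)[of 0] W0 by simp
    qed (use w in auto)
    then have "contact_point \<Psi> w P" by (simp add: contact_point_def inner_diff_right algebra_simps)
    then have "w \<in> G" using P by (auto simp: G_def)
    moreover have "s w = P"
      using slope[OF s[OF \<open>w \<in> G\<close>] \<open>contact_point \<Psi> w P\<close>] by simp
    ultimately show "P \<in> s ` G" by blast
  qed
  ultimately have "negligible (ball (0::'a) \<delta>)" by (rule negligible_subset)
  then show False using \<delta> open_not_negligible[of "ball (0::'a) \<delta>"] by auto
qed

subsection \<open>The theorem on sums\<close>

lemma usc_onI:
  assumes "\<And>z c. z \<in> S \<Longrightarrow> f z < c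
      \<Longrightarrow> \<forall>\<^sub>F w in at z within S. f w < c"
  shows "usc_on S f"
  using assms by (simp add: usc_on_def)

lemma usc_onD:
  "usc_on S f \<Longrightarrow> z \<in> S \<Longrightarrow> f z < c
      \<Longrightarrow> \<forall>\<^sub>F w in at z within S. f w < c"
  by (simp add: usc_on_def)

lemma usc_on_subset: "usc_on S f \<Longrightarrow> T \<subseteq> S \<Longrightarrow> usc_on T f"
  unfolding usc_on_def by (meson at_le filter_leD subsetD)

lemma continuous_on_imp_usc_on: "continuous_on S f \<Longrightarrow> usc_on S f"
  unfolding usc_on_def continuous_on_def by (auto dest: order_tendstoD(2))

lemma usc_on_add:
  assumes "usc_on S f" "usc_on S g"
  shows "usc_on S (\<lambda>z. f z + g z)"
proof (rule usc_onI)
  fix z c assume z: "z \<in> S" "f z + g z < c"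
  define e where "e = (c - (f z + g z)) / 2"
  have "\<forall>\<^sub>F w in at z within S. f w < f z
      + e" "\<forall>\<^sub>F w in at z within S. g w < g z + e"
    using z by (auto intro!: usc_onD[OF assms(1)] usc_onD[OF assms(2)] simp: e_def)
  then show "\<forall>\<^sub>F w in at z within S. f w + g w < c"
    by eventually_elim (auto simp: e_def field_simps)
qed

lemma usc_on_cmult:
  assumes "usc_on S f" "0 < k"
  shows "usc_on S (\<lambda>z. k * f z)"
proof (rule usc_onI)
  fix z c assume z: "z \<in> S" "k * f z < c"
  then have "\<forall>\<^sub>F w in at z within S. f w < c / k"
    using assms(2) by (intro usc_onD[OF assms(1)]) (auto simp: field_simps)
  then show "\<forall>\<^sub>F w in at z within S. k * f w < c"
    by eventually_elim (use assms(2) in \<open>auto simp: field_simps\<close>)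
qed

lemma usc_on_min:
  assumes "usc_on S f" "usc_on S g"
  shows "usc_on S (\<lambda>z. min (f z) (g z))"
proof (rule usc_onI)
  fix z c assume z: "z \<in> S" "min (f z) (g z) < c"
  then consider "f z < c" | "g z < c" by linarith
  then show "\<forall>\<^sub>F w in at z within S. min (f w) (g w) < c"
    by cases (auto dest: usc_onD[OF assms(1) z(1)] usc_onD[OF assms(2) z(1)] elim!: eventually_mono)
qed

text \<open>If every point \<open>x\<close> were beaten by some \<open>m x\<close>, finitely many
  values \<open>f (m x)\<close> would strictly dominate \<open>f\<close> on \<open>K\<close>. The
  largest of them is itself a value of \<open>f\<close> on \<open>K\<close>, hence smaller than
  another one.\<close>

lemma usc_on_attains_sup:
  assumes K: "compact K" "K \<noteq> {}" and f: "usc_on K f"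
  shows "\<exists>x\<in>K. \<forall>y\<in>K. f y \<le> f x"
proof (rule ccontr)
  assume "\<not> ?thesis"
  then have "\<forall>x\<in>K. \<exists>y\<in>K. f x < f y" by (auto simp: not_le)
  then obtain m where m: "\<And>x. x \<in> K \<Longrightarrow> m x \<in> K" "\<And>x. x \<in> K
      \<Longrightarrow> f x < f (m x)" by metis
  have "\<exists>V. open V \<and> x \<in> V \<and> (\<forall>w\<in>V \<inter> K. f w < f (m x))"
    if "x \<in> K" for x
    using usc_onD[OF f that m(2)[OF that]] m(2)[OF that]
    unfolding eventually_at_topological by auto
  then obtain V where V: "\<And>x. x \<in> K \<Longrightarrow> open (V x)" "\<And>x. x \<in> K
      \<Longrightarrow> x \<in> V x"
    "\<And>x w. x \<in> K \<Longrightarrow> w \<in> V x \<Longrightarrow> w \<in> K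
        \<Longrightarrow> f w < f (m x)" by (metis IntI)
  have "K \<subseteq> (\<Union>x\<in>K. V x)" using V(2) by blast
  from compactE_image[OF K(1) V(1) this]
  obtain C where C: "C \<subseteq> K" "finite C" "K \<subseteq> (\<Union>x\<in>C. V x)" by metis
  have "C \<noteq> {}" using C(3) K(2) by auto
  have "Max ((\<lambda>x. f (m x)) ` C) \<in> (\<lambda>x. f (m x)) ` C"
    using C(2) \<open>C \<noteq> {}\<close> by (intro Max_in) auto
  then obtain x where x: "x \<in> C" "f (m x) = Max ((\<lambda>x. f (m x)) ` C)" by auto
  have "m x \<in> K" using x(1) C(1) m(1) by blast
  then obtain y where y: "y \<in> C" "m x \<in> V y" using C(3) by blast
  have "f (m x) < f (m y)" using V(3)[of y "m x"] y C(1) \<open>m x \<in> K\<close> by blast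
  moreover have "f (m y) \<le> f (m x)" unfolding x(2) using y(1) C(2) by (intro Max_ge) auto
  ultimately show False by simp
qed

section \<open>Superjets and sup-convolutions\<close>

text \<open>A one-sided second order expansion relative to \<open>S\<close>. Hessians are kept as
  maps, entering through their quadratic forms, because they arise from derivatives of resolvents on
  an abstract Euclidean space.\<close>

definition superjet :: "'a::real_inner set \<Rightarrow> ('a \<Rightarrow> real) \<Rightarrow> 'a \<Rightarrow> 'a \<Rightarrow> ('a \<Rightarrow> 'a) \<Rightarrow> bool" where
  "superjet S f z p X \<longleftrightarrow> (\<forall>e>0. \<forall>\<^sub>F w in at z within S.
     f w \<le> f z + p \<bullet> (w - z) + X (w - z) \<bullet> (w - z) / 2 + e * (norm (w - z))\<^sup>2)"

text \<open>\<open>F y - l / 2 * (norm y)\<^sup>2\<close> is the sup-convolution of \<open>f\<close>, attained at \<open>a y\<close>.\<close>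

lemma sup_convolution:
  fixes f :: "'a::euclidean_space \<Rightarrow> real"
  assumes K: "compact K" "K \<noteq> {}" and f: "usc_on K f" and l: "l > 0"
  obtains a F B where
    "\<And>y. a y \<in> K"
    "\<And>x y. x \<in> K
        \<Longrightarrow> l * (x \<bullet> y) + f x - l / 2 * (norm x)\<^sup>2 \<le> F y"
    "\<And>y. F y = l * (a y \<bullet> y) + f (a y) - l / 2 * (norm (a y))\<^sup>2"
    "B-lipschitz_on UNIV F"
    "\<And>y. subgradient F y (l *\<^sub>R a y)"
proof -
  define k where "k y x = l * (x \<bullet> y) + f x - l / 2 * (norm x)\<^sup>2" for x y
  have "usc_on K (k y)" for y
  proof -
    have "usc_on K (\<lambda>x. f x + (l * (x \<bullet> y) - l / 2 * (norm x)\<^sup>2))"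
      by (intro usc_on_add f continuous_on_imp_usc_on continuous_intros)
    moreover have "k y = (\<lambda>x. f x + (l * (x \<bullet> y) - l / 2 * (norm x)\<^sup>2))"
      by (auto simp: k_def)
    ultimately show ?thesis by simp
  qed
  then have "\<exists>x\<in>K. \<forall>x'\<in>K. k y x' \<le> k y x" for y
    by (rule usc_on_attains_sup[OF K])
  then obtain a where a: "\<And>y. a y \<in> K" "\<And>y x. x \<in> K
      \<Longrightarrow> k y x \<le> k y (a y)" by metis
  define F where "F y = k y (a y)" for y
  obtain R where R: "\<And>x. x \<in> K \<Longrightarrow> norm x \<le> R"
    using compact_imp_bounded[OF K(1)] by (auto simp: bounded_iff)
  have R0: "0 \<le> R" using R[OF a(1)] norm_ge_zero order_trans by blast
  have sg: "subgradient F y (l *\<^sub>R a y)" for y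
    unfolding subgradient_def
  proof
    fix y'
    have "F y + (l *\<^sub>R a y) \<bullet> (y' - y) = k y' (a y)"
      by (simp add: F_def k_def inner_diff_right algebra_simps)
    also have "\<dots> \<le> F y'" unfolding F_def using a by blast
    finally show "F y + (l *\<^sub>R a y) \<bullet> (y' - y) \<le> F y'" .
  qed
  have Fle: "F y - F y' \<le> l * R * norm (y - y')" for y y'
  proof -
    have "F y - F y' \<le> (l *\<^sub>R a y) \<bullet> (y - y')"
      using sg[of y, unfolded subgradient_def, rule_format, of y'] by (simp add: inner_diff_right)
    also have "\<dots> \<le> norm (l *\<^sub>R a y) * norm (y - y')" by (rule norm_cauchy_schwarz)
    also have "\<dots> \<le> l * R * norm (y - y')"
      using R[OF a(1)] l by (intro mult_right_mono) auto
    finally show ?thesis .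
  qed
  have "(l * R)-lipschitz_on UNIV F"
  proof (rule lipschitz_onI)
    fix y y'
    show "dist (F y) (F y') \<le> l * R * dist y y'"
      using Fle[of y y'] Fle[of y' y] by (simp add: dist_norm norm_minus_commute abs_le_iff)
  qed (use l R0 in simp)
  then show ?thesis
    using that[of a F "l * R"] a sg by (auto simp: F_def k_def)
qed

text \<open>Moving \<open>y\<close> and the maximiser \<open>a\<close> by the same \<open>h\<close>
  leaves their distance unchanged, so an expansion of the sup-convolution at \<open>y\<close>
  becomes a one-sided expansion of \<open>f\<close> at \<open>a\<close>. The terms with
  \<open>l\<close> account for the quadratic that separates the convex \<open>F\<close> from the
  sup-convolution.\<close>

lemma superjet_sup_convolution:
  fixes f F :: "'a::euclidean_space \<Rightarrow> real"
  assumes F_ge: "\<And>x y. x \<in> K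
      \<Longrightarrow> l * (x \<bullet> y) + f x - l / 2 * (norm x)\<^sup>2 \<le> F y"
    and F_eq: "F y = l * (a \<bullet> y) + f a - l / 2 * (norm a)\<^sup>2"
    and exp: "\<And>e. e > 0 \<Longrightarrow> \<exists>d>0. \<forall>h. norm h < d \<longrightarrow>
      \<bar>F (y + h) - F y - p \<bullet> h - X h \<bullet> h / 2\<bar> \<le> e * (norm h)\<^sup>2"
  shows "superjet K f a (p - l *\<^sub>R y) (\<lambda>h. X h - l *\<^sub>R h)"
  unfolding superjet_def
proof (intro allI impI)
  fix e :: real assume "e > 0"
  then obtain d where d: "d > 0" "\<And>h. norm h < d \<Longrightarrow>
      \<bar>F (y + h) - F y - p \<bullet> h - X h \<bullet> h / 2\<bar>
          \<le> e * (norm h)\<^sup>2" using exp by blast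
  have "\<forall>\<^sub>F w in at a within K. w \<in> K \<and> norm (w - a) < d"
    using d(1) by (auto simp: eventually_at dist_norm intro!: exI[of _ d])
  then show "\<forall>\<^sub>F w in at a within K. f w \<le> f a + (p - l *\<^sub>R y) \<bullet> (w - a)
      + (X (w - a) - l *\<^sub>R (w - a)) \<bullet> (w - a) / 2 + e * (norm (w - a))\<^sup>2"
  proof eventually_elim
    case (elim w)
    define h where "h = w - a"
    have w: "w = a + h" by (simp add: h_def)
    have "l * ((a + h) \<bullet> (y + h)) + f w - l / 2 * (norm (a + h))\<^sup>2 \<le> F (y + h)"
      using F_ge[of w "y + h"] elim by (simp add: w)
    moreover have "F (y + h) \<le> F y + p \<bullet> h + X h \<bullet> h / 2 + e * (norm h)\<^sup>2"
      using d(2)[of h] elim by (simp add: h_def abs_le_iff)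
    moreover have "l / 2 * (norm (a + h))\<^sup>2
        = l / 2 * (norm a)\<^sup>2 + l * (a \<bullet> h) + l / 2 * (norm h)\<^sup>2"
      using norm_add_scaleR_sq[of a 1 h] by (simp add: algebra_simps)
    moreover have "l * ((a + h) \<bullet> (y + h))
        = l * (a \<bullet> y) + l * (a \<bullet> h) + l * (y \<bullet> h) + l * (norm h)\<^sup>2"
      by (simp add: inner_add_left inner_add_right inner_commute power2_norm_eq_inner algebra_simps)
    moreover have "(p - l *\<^sub>R y) \<bullet> h = p \<bullet> h - l * (y \<bullet> h)"
      "(X h - l *\<^sub>R h) \<bullet> h = X h \<bullet> h - l * (norm h)\<^sup>2"
      by (simp_all add: inner_diff_left power2_norm_eq_inner)
    ultimately show ?case
      unfolding F_eq h_def[symmetric] by argo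
  qed
qed

lemma norm_add_sq:
  fixes a b :: "'a::real_inner"
  shows "(norm (a + b))\<^sup>2 = (norm a)\<^sup>2 + 2 * (a \<bullet> b) + (norm b)\<^sup>2"
  using norm_add_scaleR_sq[of a 1 b] by simp

lemma norm_Pair_sq: "(norm (x, y))\<^sup>2 = (norm x)\<^sup>2 + (norm y)\<^sup>2"
  by (simp add: norm_Pair)

lemma norm_diff_sq_le:
  fixes x y :: "'a::real_inner"
  shows "(norm (x - y))\<^sup>2 \<le> 2 * (norm x)\<^sup>2 + 2 * (norm y)\<^sup>2"
  using zero_le_power2[of "norm (x + y)"] norm_add_sq[of x y] norm_add_sq[of x "- y"]
  by simp

text \<open>The penalisation \<open>\<alpha> |x - y|\<^sup>2 / 2\<close> is replaced by its sup-convolution with parameter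
  \<open>4 \<alpha>\<close>, which is \<open>\<alpha> |x - y|\<^sup>2\<close>.\<close>

lemma doubling_penalty_le:
  fixes x y a b :: "'a::real_inner"
  assumes "\<alpha> \<ge> 0"
  shows "\<alpha> / 2 * (norm (a - b))\<^sup>2
      \<le> 2 * \<alpha> * (norm (x - a))\<^sup>2 + 2 * \<alpha> * (norm (y - b))\<^sup>2
          + \<alpha> * (norm (x - y))\<^sup>2"
proof -
  define w where "w = x - y"
  define s where "s = x - a"
  define r where "r = y - b"
  have "(norm (a - b))\<^sup>2 = (norm (w - (s - r)))\<^sup>2"
    by (simp add: w_def s_def r_def algebra_simps)
  also have "\<dots> \<le> 2 * (norm w)\<^sup>2 + 2 * (norm (s - r))\<^sup>2" by (rule norm_diff_sq_le)
  also have "(norm (s - r))\<^sup>2 \<le> 2 * (norm s)\<^sup>2 + 2 * (norm r)\<^sup>2"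
    by (rule norm_diff_sq_le)
  finally have "(norm (a - b))\<^sup>2
      \<le> 2 * (norm w)\<^sup>2 + 4 * (norm s)\<^sup>2 + 4 * (norm r)\<^sup>2" by simp
  then have "\<alpha> / 2 * (norm (a - b))\<^sup>2
      \<le> \<alpha> / 2 * (2 * (norm w)\<^sup>2 + 4 * (norm s)\<^sup>2 + 4 * (norm r)\<^sup>2)"
    using assms by (intro mult_left_mono) auto
  then show ?thesis by (simp add: w_def s_def r_def algebra_simps)
qed

lemma differentiable_Pair_components:
  fixes J1 :: "'a::euclidean_space \<Rightarrow> 'b::euclidean_space"
    and J2 :: "'c::euclidean_space \<Rightarrow> 'd::euclidean_space"
  assumes "(\<lambda>z. (J1 (fst z), J2 (snd z))) differentiable (at (z1, z2))"
  shows "J1 differentiable (at z1)" "J2 differentiable (at z2)"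
proof -
  obtain D where D: "((\<lambda>z. (J1 (fst z), J2 (snd z))) has_derivative D) (at (z1, z2))"
    using assms by (auto simp: differentiable_def)
  have "((\<lambda>h. (h, z2)) has_derivative (\<lambda>h. (h, 0))) (at z1)" by (intro derivative_intros)
  from has_derivative_fst[OF has_derivative_compose[OF this D]]
  show "J1 differentiable (at z1)" by (auto simp: differentiable_def)
  have "((\<lambda>h. (z1, h)) has_derivative (\<lambda>h. (0, h))) (at z2)" by (intro derivative_intros)
  from has_derivative_snd[OF has_derivative_compose[OF this D]]
  show "J2 differentiable (at z2)" by (auto simp: differentiable_def)
qed

text \<open>The tolerance \<eta> reflects that Jensen's lemma gives contact with a small slope
  \<open>P\<close> rather than an exact maximum; the two components of \<open>P\<close> add up to p
  + q. Carrying \<eta> along avoids a passage to the limit in the Hessians. The bound on the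
  quadratic forms is the Hessian of \<alpha> |x - y|^2.\<close>

theorem theorem_on_sums:
  fixes f g :: "'a::euclidean_space \<Rightarrow> real"
  assumes K: "compact K" "K \<noteq> {}" and f: "usc_on K f" and g: "usc_on K g"
    and \<alpha>: "\<alpha> > 0" and \<eta>: "\<eta> > 0"
  obtains x y p q X Y where "x \<in> K" "y \<in> K"
    "\<And>x' y'. x' \<in> K \<Longrightarrow> y' \<in> K \<Longrightarrow>
      f x' + g y' - \<alpha> / 2 * (norm (x' - y'))\<^sup>2
          \<le> f x + g y - \<alpha> / 2 * (norm (x - y))\<^sup>2 + \<eta>"
    "norm (p + q) \<le> \<eta>" "linear X" "linear Y" "superjet K f x p X" "superjet K g y q Y"
    "\<And>\<xi> \<zeta>. X \<xi> \<bullet> \<xi> + Y \<zeta> \<bullet> \<zeta>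
        \<le> 2 * \<alpha> * (norm (\<xi> - \<zeta>))\<^sup>2"
proof -
  have l: "4 * \<alpha> > 0" using \<alpha> by simp
  obtain a F B1 where a: "\<And>y. a y \<in> K"
    and F_ge: "\<And>x y. x \<in> K
        \<Longrightarrow> 4 * \<alpha> * (x \<bullet> y) + f x - 4 * \<alpha> / 2 * (norm x)\<^sup>2
            \<le> F y"
    and F_eq: "\<And>y. F y
        = 4 * \<alpha> * (a y \<bullet> y) + f (a y) - 4 * \<alpha> / 2 * (norm (a y))\<^sup>2"
    and F_lip: "B1-lipschitz_on UNIV F"
      and F_sub: "\<And>y. subgradient F y ((4 * \<alpha>) *\<^sub>R a y)"
    by (rule sup_convolution[OF K f l]) blast
  obtain b G B2 where b: "\<And>y. b y \<in> K"
    and G_ge: "\<And>x y. x \<in> K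
        \<Longrightarrow> 4 * \<alpha> * (x \<bullet> y) + g x - 4 * \<alpha> / 2 * (norm x)\<^sup>2
            \<le> G y"
    and G_eq: "\<And>y. G y
        = 4 * \<alpha> * (b y \<bullet> y) + g (b y) - 4 * \<alpha> / 2 * (norm (b y))\<^sup>2"
    and G_lip: "B2-lipschitz_on UNIV G"
      and G_sub: "\<And>y. subgradient G y ((4 * \<alpha>) *\<^sub>R b y)"
    by (rule sup_convolution[OF K g l]) blast
  have F_sub': "\<exists>q. subgradient F y q" and G_sub': "\<exists>q. subgradient G y q" for y
    using F_sub G_sub by blast+
  obtain R where R: "\<And>x. x \<in> K \<Longrightarrow> norm x \<le> R"
    using compact_imp_bounded[OF K(1)] by (auto simp: bounded_iff)
  \<comment> \<open>The terms with 2 \<alpha> turn the convex \<open>F\<close> and \<open>G\<close>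
    back into sup-convolutions, and the last one is the sup-convolution of the doubling penalty.
    \<open>DQ\<close> is the gradient of \<open>Q\<close>.\<close>
  define Q where "Q w
      = 2 * \<alpha> * (norm (fst w))\<^sup>2 + 2 * \<alpha> * (norm (snd w))\<^sup>2
          + \<alpha> * (norm (fst w - snd w))\<^sup>2"
    for w :: "'a \<times> 'a"
  define DQ where "DQ w
      = ((4 * \<alpha>) *\<^sub>R fst w
          + (2 * \<alpha>) *\<^sub>R (fst w - snd w), (4 * \<alpha>) *\<^sub>R snd w - (2 * \<alpha>) *\<^sub>R (fst w - snd w))"
    for w :: "'a \<times> 'a"
  have Q_add: "Q (w + h) = Q w + DQ w \<bullet> h + Q h" for w h
  proof -
    have "fst (w + h) - snd (w + h) = (fst w - snd w) + (fst h - snd h)" by simp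
    then show ?thesis
      unfolding Q_def DQ_def
      by (simp only: fst_add snd_add norm_add_sq) (simp add: inner_prod_def inner_simps algebra_simps)
  qed
  define \<Psi> where "\<Psi> w = F (fst w) + G (snd w) - Q w" for w
  define \<Phi> where "\<Phi> x y = f x + g y - \<alpha> / 2 * (norm (x - y))\<^sup>2" for x y
  have \<Psi>_le: "\<Psi> (x, y) \<le> \<Phi> (a x) (b y)" for x y
  proof -
    have ns: "(norm (x - a x))\<^sup>2 = (norm x)\<^sup>2 - 2 * (a x \<bullet> x) + (norm (a x))\<^sup>2"
      "(norm (y - b y))\<^sup>2 = (norm y)\<^sup>2 - 2 * (b y \<bullet> y) + (norm (b y))\<^sup>2"
      using norm_add_sq[of x "- a x"] norm_add_sq[of y "- b y"] by (simp_all add: inner_commute)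
    have "\<Psi> (x, y) = f (a x) + g (b y)
      - (2 * \<alpha> * (norm (x - a x))\<^sup>2 + 2 * \<alpha> * (norm (y - b y))\<^sup>2
          + \<alpha> * (norm (x - y))\<^sup>2)"
      unfolding ns by (simp add: \<Psi>_def Q_def F_eq G_eq algebra_simps)
    then show ?thesis
      using doubling_penalty_le[of \<alpha> "a x" "b y" x y] \<alpha> by (simp add: \<Phi>_def)
  qed
  \<comment> \<open>The shift by a quarter of x - y is where the sup-convolution of the penalty is
    attained. Together with the previous bound it shows that \<Psi> has the same supremum as \<Phi>
    over pairs from \<open>K\<close>.\<close>
  have \<Psi>_ge: "\<Phi> x y
      \<le> \<Psi> (x - (1/4) *\<^sub>R (x - y), y + (1/4) *\<^sub>R (x - y))" (is "_
          \<le> \<Psi> (?x', ?y')")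
    if xy: "x \<in> K" "y \<in> K" for x y
  proof -
    define e where "e = (1/4) *\<^sub>R (x - y)"
    have xy_e: "x - y = 4 *\<^sub>R e" by (simp add: e_def)
    have "(x - e) - (y + e) = (x - y) - 2 *\<^sub>R e" by (simp add: scaleR_2)
    also have "\<dots> = 2 *\<^sub>R e" unfolding xy_e by (simp flip: scaleR_left_diff_distrib)
    finally have d: "(x - e) - (y + e) = 2 *\<^sub>R e" .
    have 1: "f x - 2 * \<alpha> * (norm e)\<^sup>2 + 2 * \<alpha> * (norm (x - e))\<^sup>2
        \<le> F (x - e)"
      using F_ge[OF xy(1), of "x - e"] norm_add_sq[of x "- e"]
      by (simp add: inner_diff_right power2_norm_eq_inner algebra_simps)
    have 2: "g y - 2 * \<alpha> * (norm e)\<^sup>2 + 2 * \<alpha> * (norm (y + e))\<^sup>2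
        \<le> G (y + e)"
      using G_ge[OF xy(2), of "y + e"] norm_add_sq[of y e]
      by (simp add: inner_add_right power2_norm_eq_inner algebra_simps)
    have "\<alpha> * (norm ((x - e) - (y + e)))\<^sup>2
        = 4 * \<alpha> * (norm e)\<^sup>2" "\<alpha> / 2 * (norm (x - y))\<^sup>2
            = 8 * \<alpha> * (norm e)\<^sup>2"
      unfolding d xy_e by (simp_all add: power_mult_distrib)
    then show ?thesis using 1 2
      unfolding \<Phi>_def \<Psi>_def Q_def e_def[symmetric] fst_conv snd_conv by linarith
  qed
  have cont: "continuous_on UNIV \<Psi>"
    unfolding \<Psi>_def Q_def
    by (intro continuous_intros continuous_on_compose2[OF lipschitz_on_continuous_on[OF F_lip]]
        continuous_on_compose2[OF lipschitz_on_continuous_on[OF G_lip]]) auto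
  define c1 where "c1 = F 0 + G 0 + B1\<^sup>2 / (4 * \<alpha>) + B2\<^sup>2 / (4 * \<alpha>)"
  have young: "B * r \<le> B\<^sup>2 / (4 * \<alpha>) + \<alpha> * r\<^sup>2" for B r
  proof -
    have "0 \<le> (B - 2 * \<alpha> * r)\<^sup>2 / (4 * \<alpha>)" using \<alpha> by simp
    also have "\<dots> = B\<^sup>2 / (4 * \<alpha>) + \<alpha> * r\<^sup>2 - B * r"
      using \<alpha> by (simp add: power2_eq_square field_simps)
    finally show ?thesis by simp
  qed
  have coerc: "\<Psi> w \<le> c1 - \<alpha> * (norm w)\<^sup>2" for w
  proof -
    have "F (fst w) \<le> F 0 + B1 * norm (fst w)" "G (snd w) \<le> G 0 + B2 * norm (snd w)"
      using lipschitz_onD[OF F_lip, of "fst w" 0] lipschitz_onD[OF G_lip, of "snd w" 0] 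
      by (auto simp: dist_real_def)
    moreover have "\<alpha> * (norm w)\<^sup>2
        = \<alpha> * (norm (fst w))\<^sup>2 + \<alpha> * (norm (snd w))\<^sup>2"
      using norm_Pair_sq[of "fst w" "snd w"] by (simp add: distrib_left)
    moreover have "0 \<le> \<alpha> * (norm (fst w - snd w))\<^sup>2" using \<alpha> by simp
    ultimately show ?thesis
      using young[of B1 "norm (fst w)"] young[of B2 "norm (snd w)"]
        unfolding \<Psi>_def Q_def c1_def by argo
  qed
  have semi: "\<exists>q. \<forall>w'. \<Psi> w
      + q \<bullet> (w' - w) - (4 * \<alpha>) * (norm (w' - w))\<^sup>2 \<le> \<Psi> w'" for w
  proof (intro exI allI)
    fix w'
    define h where "h = w' - w"
    have w': "w' = w + h" by (simp add: h_def)
    have "F (fst w) + ((4 * \<alpha>) *\<^sub>R a (fst w)) \<bullet> fst h \<le> F (fst w')"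
      "G (snd w) + ((4 * \<alpha>) *\<^sub>R b (snd w)) \<bullet> snd h \<le> G (snd w')"
      using F_sub[of "fst w", unfolded subgradient_def, rule_format, of "fst w'"]
        G_sub[of "snd w", unfolded subgradient_def, rule_format, of "snd w'"] by (simp_all add: h_def)
    moreover have "Q h \<le> 4 * \<alpha> * (norm h)\<^sup>2"
    proof -
      have "\<alpha> * (norm (fst h - snd h))\<^sup>2
          \<le> \<alpha> * (2 * (norm (fst h))\<^sup>2 + 2 * (norm (snd h))\<^sup>2)"
        using \<alpha> by (intro mult_left_mono norm_diff_sq_le) auto
      then show ?thesis using norm_Pair_sq[of "fst h" "snd h"] by (simp add: Q_def algebra_simps)
    qed
    moreover have "((4 * \<alpha>) *\<^sub>R a (fst w), (4 * \<alpha>) *\<^sub>R b (snd w)) \<bullet> h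
        = ((4 * \<alpha>) *\<^sub>R a (fst w)) \<bullet> fst h
            + ((4 * \<alpha>) *\<^sub>R b (snd w)) \<bullet> snd h"
      by (simp add: inner_prod_def)
    ultimately show "\<Psi> w
        + (((4 * \<alpha>) *\<^sub>R a (fst w), (4 * \<alpha>) *\<^sub>R b (snd w)) - DQ w)
            \<bullet> (w' - w)
        - (4 * \<alpha>) * (norm (w' - w))\<^sup>2 \<le> \<Psi> w'"
      unfolding h_def[symmetric] \<Psi>_def using Q_add[of w h] 
      by (simp add: w'[symmetric] inner_diff_left)
  qed
  define W where "W = 1 + (1 + \<bar>c1 - \<Psi> 0\<bar>) / \<alpha>"
  have W0: "0 \<le> W" using \<alpha> by (simp add: W_def)
  have R0: "0 \<le> R" using R[OF a] norm_ge_zero order_trans by blast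
  \<comment> \<open>The denominator pays for two uses of |P| < \<delta>: twice \<delta> bounds the
    sum of the components of \<open>P\<close>, and \<delta> (W + 4 R) bounds the loss in the
    maximum, the contact point having norm at most \<open>W\<close> and its competitor at most 4
    R.\<close>
  define \<delta> where "\<delta> = min 1 (\<eta> / (2 + W + 4 * R))"
  have \<delta>: "0 < \<delta>" "\<delta> \<le> 1" using \<eta> W0 R0 by (auto simp: \<delta>_def)
  have "\<delta> * (2 + W + 4 * R) \<le> \<eta> / (2 + W + 4 * R) * (2 + W + 4 * R)"
    using W0 R0 by (intro mult_right_mono) (auto simp: \<delta>_def)
  then have \<delta>_le: "\<delta> * (2 + W + 4 * R) \<le> \<eta>" using W0 R0 by simp
  have "0 \<le> \<delta> * (W + 4 * R)" using \<delta>(1) W0 R0 by simp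
  moreover have "\<delta> * (2 + W + 4 * R) = 2 * \<delta> + \<delta> * (W + 4 * R)"
    by (simp add: algebra_simps)
  ultimately have \<delta>2: "2 * \<delta> \<le> \<eta>"
    and \<delta>W: "\<delta> * (W + 4 * R) \<le> \<eta>"
    using \<delta>_le \<delta>(1) by linarith+
  define S where "S = {w. \<exists>P. norm P < \<delta> \<and> contact_point \<Psi> w P}"
  have S: "\<not> negligible S"
    unfolding S_def by (rule contact_set_not_negligible[OF cont coerc \<alpha> semi l \<delta>])
  define JJ where "JJ z = (resolvent F (fst z), resolvent G (snd z))" for z
  have JJ_lip: "norm (JJ z - JJ z') \<le> norm (z - z')" for z z'
  proof (rule power2_le_imp_le)
    have "(norm (JJ z - JJ z'))\<^sup>2 = (norm (resolvent F (fst z) - resolvent F (fst z')))\<^sup>2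
        + (norm (resolvent G (snd z) - resolvent G (snd z')))\<^sup>2"
      by (simp add: JJ_def norm_Pair_sq)
    also have "\<dots> \<le> (norm (fst z - fst z'))\<^sup>2 + (norm (snd z - snd z'))\<^sup>2"
      using resolvent_lipschitz[OF F_lip F_sub'] resolvent_lipschitz[OF G_lip G_sub']
      by (intro add_mono power_mono) auto
    also have "\<dots> = (norm (z - z'))\<^sup>2"
      using norm_Pair_sq[of "fst (z - z')" "snd (z - z')"] unfolding prod.collapse by simp
    finally show "(norm (JJ z - JJ z'))\<^sup>2 \<le> (norm (z - z'))\<^sup>2" .
  qed simp
  \<comment> \<open>What has to be differentiable is the resolvent at the sum of point and slope, so
    the contact set is pulled back along the resolvents. A nonexpansive map sends null sets to null
    sets; the preimage of the non-null contact set is therefore not null and meets the points of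
    differentiability.\<close>
  define S' where "S' = JJ -` S"
  have "S \<subseteq> JJ ` S'"
  proof
    fix w assume "w \<in> S"
    have "JJ (fst w + (4 * \<alpha>) *\<^sub>R a (fst w), snd w + (4 * \<alpha>) *\<^sub>R b (snd w))
        = w"
      by (simp add: JJ_def resolvent_eq[OF F_lip F_sub' F_sub] resolvent_eq[OF G_lip G_sub' G_sub])
    then show "w \<in> JJ ` S'"
      using \<open>w \<in> S\<close> unfolding S'_def by (metis image_eqI vimageI)
  qed
  then have "\<not> negligible (JJ ` S')" using S negligible_subset by blast
  then have "\<not> negligible S'"
    using negligible_locally_Lipschitz_image[of S' JJ] JJ_lip
    by (metis order_refl open_UNIV UNIV_I mult_1)
  moreover have "negligible {z. \<not> JJ differentiable (at z)}"
    by (rule rademacher[of 1], rule lipschitz_onI) (use JJ_lip in \<open>simp_all add: dist_norm del: split_paired_All\<close>)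
  ultimately obtain z where "z \<in> S'" and JJ_diff: "JJ differentiable (at z)"
    using negligible_subset by blast
  define x where "x = fst (JJ z)"
  define y where "y = snd (JJ z)"
  have JJz: "JJ z = (x, y)" by (simp add: x_def y_def)
  obtain P where P: "norm P < \<delta>" and cp: "contact_point \<Psi> (x, y) P"
    using \<open>z \<in> S'\<close> by (auto simp: S'_def S_def JJz)
  have Pw: "\<Psi> w \<le> \<Psi> (x, y) + P \<bullet> (w - (x, y))" for w
    using cp unfolding contact_point_def by blast
  define pF where "pF = fst (DQ (x, y) + P)"
  define pG where "pG = snd (DQ (x, y) + P)"
  have CI: "F (x + h) + G (y + k) \<le> F x + G y + pF \<bullet> h + pG \<bullet> k + Q (h, k)" for h k
  proof -
    have "\<Psi> ((x, y) + (h, k)) \<le> \<Psi> (x, y) + P \<bullet> (h, k)"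
      using Pw[of "(x, y) + (h, k)"] by simp
    moreover have "pF \<bullet> h + pG \<bullet> k = DQ (x, y) \<bullet> (h, k) + P \<bullet> (h, k)"
      by (simp add: pF_def pG_def inner_prod_def inner_add_left)
    ultimately show ?thesis unfolding \<Psi>_def Q_add by simp
  qed
  \<comment> \<open>Freezing one variable in the joint contact inequality leaves Q (h, 0) = 3
    \<alpha> |h|^2.\<close>
  have parF: "F y' \<le> F x + pF \<bullet> (y' - x) + 3 * \<alpha> * (norm (y' - x))\<^sup>2" for y'
    using CI[of "y' - x" 0] by (simp add: Q_def)
  have parG: "G y' \<le> G y + pG \<bullet> (y' - y) + 3 * \<alpha> * (norm (y' - y))\<^sup>2" for y'
    using CI[of 0 "y' - y"] by (simp add: Q_def norm_minus_commute[of y y'])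
  have \<alpha>3: "3 * \<alpha> > 0" using \<alpha> by simp
  \<comment> \<open>The point \<open>z\<close> was found on the resolvent side. Uniqueness of the
    subgradient at a contact point identifies it with \<open>x\<close> plus the contact
    slope.\<close>
  have zF: "fst z = x + pF"
  proof -
    have "subgradient F x (fst z - x)"
      using resolvent_subgradient[OF F_lip F_sub', of "fst z"] by (simp add: x_def JJ_def)
    from subgradient_near_contact(2)[OF F_sub' \<alpha>3 parF this] show ?thesis
      by (simp add: algebra_simps)
  qed
  have zG: "snd z = y + pG"
  proof -
    have "subgradient G y (snd z - y)"
      using resolvent_subgradient[OF G_lip G_sub', of "snd z"] by (simp add: y_def JJ_def)
    from subgradient_near_contact(2)[OF G_sub' \<alpha>3 parG this] show ?thesis
      by (simp add: algebra_simps)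
  qed
  have dF: "resolvent F differentiable (at (x + pF))" and dG: "resolvent G differentiable (at (y + pG))"
    using differentiable_Pair_components[of "resolvent F" "resolvent G" "x + pF" "y + pG"] JJ_diff
    unfolding JJ_def zF[symmetric] zG[symmetric] by simp_all
  obtain X where X: "linear X" "\<And>e. e > 0
      \<Longrightarrow> \<exists>d>0. \<forall>h. norm h < d \<longrightarrow>
      \<bar>F (x + h) - F x - pF \<bullet> h - X h \<bullet> h / 2\<bar> \<le> e * (norm h)\<^sup>2"
    using alexandrov_at_contact[OF F_lip F_sub' \<alpha>3 parF dF] by blast
  obtain Y where Y: "linear Y" "\<And>e. e > 0
      \<Longrightarrow> \<exists>d>0. \<forall>h. norm h < d \<longrightarrow>
      \<bar>G (y + h) - G y - pG \<bullet> h - Y h \<bullet> h / 2\<bar> \<le> e * (norm h)\<^sup>2"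
    using alexandrov_at_contact[OF G_lip G_sub' \<alpha>3 parG dG] by blast
  \<comment> \<open>The first order terms of both expansions cancel against those of the contact
    inequality; homogeneity of degree two then compares the quadratic forms.\<close>
  have hess: "X \<xi> \<bullet> \<xi> + Y \<zeta> \<bullet> \<zeta> \<le> 2 * Q (\<xi>, \<zeta>)"
    for \<xi> \<zeta>
  proof (rule field_le_epsilon)
    fix e :: real assume "e > 0"
    define s where "s = 1 + (norm \<xi>)\<^sup>2 + (norm \<zeta>)\<^sup>2"
    have s: "s \<ge> 1" by (simp add: s_def)
    define e' where "e' = e / (2 * s)"
    have e': "e' > 0" "2 * (e' * s) = e" using \<open>e > 0\<close> s by (auto simp: e'_def)
    obtain d1 where d1: "d1 > 0" "\<And>h. norm h < d1 \<Longrightarrow>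
        \<bar>F (x + h) - F x - pF \<bullet> h - X h \<bullet> h / 2\<bar>
            \<le> e' * (norm h)\<^sup>2" using X(2)[OF e'(1)] by blast
    obtain d2 where d2: "d2 > 0" "\<And>h. norm h < d2 \<Longrightarrow>
        \<bar>G (y + h) - G y - pG \<bullet> h - Y h \<bullet> h / 2\<bar>
            \<le> e' * (norm h)\<^sup>2" using Y(2)[OF e'(1)] by blast
    define t where "t = min d1 d2 / (1 + norm \<xi> + norm \<zeta>)"
    have t: "t > 0" using d1(1) d2(1) by (simp add: t_def add_pos_nonneg)
    have "t * (1 + norm \<xi> + norm \<zeta>) = min d1 d2"
      by (simp add: t_def add_pos_nonneg less_imp_neq[symmetric])
    moreover have "t * norm \<xi> < t * (1 + norm \<xi> + norm \<zeta>)" "t * norm \<zeta> < t * (1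
        + norm \<xi> + norm \<zeta>)"
      using t by (auto intro!: mult_strict_left_mono add_pos_nonneg)
    ultimately have "t * norm \<xi> < min d1 d2" "t * norm \<zeta> < min d1 d2" by auto
    then have "norm (t *\<^sub>R \<xi>) < d1" "norm (t *\<^sub>R \<zeta>) < d2" using t by auto
    from d1(2)[OF this(1)] d2(2)[OF this(2)] CI[of "t *\<^sub>R \<xi>" "t *\<^sub>R \<zeta>"]
    have "X (t *\<^sub>R \<xi>) \<bullet> (t *\<^sub>R \<xi>) / 2
        + Y (t *\<^sub>R \<zeta>) \<bullet> (t *\<^sub>R \<zeta>) / 2
        \<le> Q (t *\<^sub>R \<xi>, t *\<^sub>R \<zeta>) + e' * (norm (t *\<^sub>R \<xi>))\<^sup>2
            + e' * (norm (t *\<^sub>R \<zeta>))\<^sup>2"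
      by linarith
    moreover have "X (t *\<^sub>R \<xi>) \<bullet> (t *\<^sub>R \<xi>)
        = t\<^sup>2 * (X \<xi> \<bullet> \<xi>)" "Y (t *\<^sub>R \<zeta>)
            \<bullet> (t *\<^sub>R \<zeta>) = t\<^sup>2 * (Y \<zeta> \<bullet> \<zeta>)"
      by (simp_all add: linear_scale[OF X(1)] linear_scale[OF Y(1)] power2_eq_square)
    moreover have "(norm (t *\<^sub>R \<xi>))\<^sup>2
        = t\<^sup>2 * (norm \<xi>)\<^sup>2" "(norm (t *\<^sub>R \<zeta>))\<^sup>2
            = t\<^sup>2 * (norm \<zeta>)\<^sup>2"
      by (simp_all add: power_mult_distrib)
    moreover have "Q (t *\<^sub>R \<xi>, t *\<^sub>R \<zeta>) = t\<^sup>2 * Q (\<xi>, \<zeta>)"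
      by (simp add: Q_def scaleR_diff_right[symmetric] power_mult_distrib algebra_simps del: scaleR_diff_right)
    ultimately have "t\<^sup>2 * (X \<xi> \<bullet> \<xi> + Y \<zeta> \<bullet> \<zeta>)
        \<le> t\<^sup>2 * (2 * Q (\<xi>, \<zeta>) + 2 * (e' * ((norm \<xi>)\<^sup>2
            + (norm \<zeta>)\<^sup>2)))"
      by (simp add: algebra_simps)
    then have "X \<xi> \<bullet> \<xi> + Y \<zeta> \<bullet> \<zeta>
        \<le> 2 * Q (\<xi>, \<zeta>) + 2 * (e' * ((norm \<xi>)\<^sup>2 + (norm \<zeta>)\<^sup>2))"
      using t by (simp add: mult_le_cancel_left)
    also have "e' * ((norm \<xi>)\<^sup>2 + (norm \<zeta>)\<^sup>2) \<le> e' * s"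
      using e'(1) by (intro mult_left_mono) (auto simp: s_def)
    finally show "X \<xi> \<bullet> \<xi> + Y \<zeta> \<bullet> \<zeta> \<le> 2 * Q (\<xi>, \<zeta>) + e"
      using e'(2) by simp
  qed
  show ?thesis
  proof (rule that[of "a x" "b y" "pF - (4 * \<alpha>) *\<^sub>R x" "pG - (4 * \<alpha>) *\<^sub>R y"
        "\<lambda>h. X h - (4 * \<alpha>) *\<^sub>R h" "\<lambda>h. Y h - (4 * \<alpha>) *\<^sub>R h"])
    show "a x \<in> K" "b y \<in> K" by (rule a b)+
    show "linear (\<lambda>h. X h - (4 * \<alpha>) *\<^sub>R h)" "linear (\<lambda>h. Y h - (4 * \<alpha>) *\<^sub>R h)"
      by (intro linear_compose_sub X Y linear_scale_self)+
    show "superjet K f (a x) (pF - (4 * \<alpha>) *\<^sub>R x) (\<lambda>h. X h - (4 * \<alpha>) *\<^sub>R h)"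
      by (rule superjet_sup_convolution[OF F_ge F_eq X(2)])
    show "superjet K g (b y) (pG - (4 * \<alpha>) *\<^sub>R y) (\<lambda>h. Y h - (4 * \<alpha>) *\<^sub>R h)"
      by (rule superjet_sup_convolution[OF G_ge G_eq Y(2)])
    have "norm ((pF - (4 * \<alpha>) *\<^sub>R x) + (pG - (4 * \<alpha>) *\<^sub>R y))
        = norm (fst P + snd P)"
      by (simp add: pF_def pG_def DQ_def algebra_simps)
    also have "\<dots> \<le> norm (fst P) + norm (snd P)" by (rule norm_triangle_ineq)
    also have "\<dots> \<le> norm P + norm P"
      using norm_fst_le[of "fst P" "snd P"] norm_snd_le[of "snd P" "fst P"] by simp
    finally show "norm ((pF - (4 * \<alpha>) *\<^sub>R x) + (pG - (4 * \<alpha>) *\<^sub>R y))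
        \<le> \<eta>"
      using P \<delta>2 by simp
    show "(X \<xi> - (4 * \<alpha>) *\<^sub>R \<xi>) \<bullet> \<xi>
        + (Y \<zeta> - (4 * \<alpha>) *\<^sub>R \<zeta>) \<bullet> \<zeta>
            \<le> 2 * \<alpha> * (norm (\<xi> - \<zeta>))\<^sup>2" for \<xi> \<zeta>
      using hess[of \<xi> \<zeta>] by (simp add: Q_def inner_diff_left power2_norm_eq_inner)
    fix x0 y0 assume 0: "x0 \<in> K" "y0 \<in> K"
    define w0 where "w0 = (x0 - (1/4) *\<^sub>R (x0 - y0), y0 + (1/4) *\<^sub>R (x0 - y0))"
    have "norm w0 \<le> norm (x0 - (1/4) *\<^sub>R (x0 - y0)) + norm (y0 + (1/4) *\<^sub>R (x0 - y0))"
      unfolding w0_def by (rule norm_Pair_le)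
    moreover have "norm (x0 - y0) \<le> R + R"
      using norm_triangle_ineq4[of x0 y0] R[OF 0(1)] R[OF 0(2)] by linarith
    ultimately have w0: "norm w0 \<le> 4 * R"
      using norm_triangle_ineq4[of x0 "(1/4) *\<^sub>R (x0 - y0)"] norm_triangle_ineq[of y0 "(1/4) *\<^sub>R (x0 - y0)"] R[OF 0(1)] R[OF 0(2)] R0
      unfolding norm_scaleR by simp
    have "norm (x, y) \<le> W"
      unfolding W_def
    proof (rule contact_point_bound[OF coerc \<alpha>])
      show "norm P \<le> 1" using P \<delta> by simp
      show "\<Psi> 0 \<le> \<Psi> (x, y) - P \<bullet> (x, y)"
        using Pw[of 0] unfolding inner_diff_right by simp
    qed
    have "\<Phi> x0 y0 \<le> \<Psi> w0" unfolding w0_def by (rule \<Psi>_ge[OF 0])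
    also have "\<dots> \<le> \<Psi> (x, y) + P \<bullet> (w0 - (x, y))" by (rule Pw)
    also have "P \<bullet> (w0 - (x, y)) \<le> norm P * norm (w0 - (x, y))" by (rule norm_cauchy_schwarz)
    also have "\<dots> \<le> \<delta> * (W + 4 * R)"
      using P \<delta>(1) w0 \<open>norm (x, y) \<le> W\<close> norm_triangle_ineq4[of w0 "(x, y)"]
        by (intro mult_mono) auto
    also have "\<dots> \<le> \<eta>" by (rule \<delta>W)
    finally have "\<Phi> x0 y0 \<le> \<Psi> (x, y) + \<eta>" by simp
    also have "\<dots> \<le> \<Phi> (a x) (b y) + \<eta>" using \<Psi>_le by simp
    finally show "f x0 + g y0 - \<alpha> / 2 * (norm (x0 - y0))\<^sup>2
        \<le> f (a x) + g (b y) - \<alpha> / 2 * (norm (a x - b y))\<^sup>2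
            + \<eta>" by (simp add: \<Phi>_def)
  qed
qed

subsection \<open>Test functions and jets\<close>

lemma superjet_open_subset:
  assumes "superjet K f z p X" "open S" "z \<in> S" "S \<subseteq> K" "S \<subseteq> T"
  shows "superjet T f z p X"
  using assms(1) unfolding superjet_def
  by (simp add: at_within_open_subset[OF assms(3,2,4)] at_within_open_subset[OF assms(3,2,5)])

text \<open>A quadratic bound from above suffices for \<open>g\<close>. This admits the penalty
  below, whose squared positive part is not twice differentiable.\<close>

lemma superjet_add_touching:
  assumes f: "superjet S f z p X"
    and g: "\<And>w. w \<in> S
        \<Longrightarrow> g w \<le> g z + q \<bullet> (w - z) + Y (w - z) \<bullet> (w - z) / 2"
  shows "superjet S (\<lambda>w. f w + g w) z (p + q) (\<lambda>h. X h + Y h)"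
  unfolding superjet_def
proof (intro allI impI)
  fix e :: real assume "e > 0"
  then have ev: "\<forall>\<^sub>F w in at z within S. f w
      \<le> f z + p \<bullet> (w - z) + X (w - z) \<bullet> (w - z) / 2 + e * (norm (w - z))\<^sup>2"
    using f by (simp add: superjet_def)
  have "\<forall>\<^sub>F w in at z within S. w \<in> S" by (simp add: eventually_at_filter)
  with ev show "\<forall>\<^sub>F w in at z within S. f w + g w
      \<le> f z + g z + (p + q) \<bullet> (w - z)
      + (X (w - z) + Y (w - z)) \<bullet> (w - z) / 2 + e * (norm (w - z))\<^sup>2"
  proof eventually_elim
    case (elim w)
    then show ?case using g[of w] by (simp add: inner_add_left add_divide_distrib)
  qed
qed

lemma superjet_cmult:
  assumes f: "superjet S f z p X" and k: "k > 0"
  shows "superjet S (\<lambda>w. k * f w) z (k *\<^sub>R p) (\<lambda>h. k *\<^sub>R X h)"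
  unfolding superjet_def
proof (intro allI impI)
  fix e :: real assume "e > 0"
  then have "\<forall>\<^sub>F w in at z within S. f w
      \<le> f z + p \<bullet> (w - z) + X (w - z) \<bullet> (w - z) / 2 + e / k * (norm (w - z))\<^sup>2"
    using f k unfolding superjet_def by (meson divide_pos_pos)
  then show "\<forall>\<^sub>F w in at z within S. k * f w
      \<le> k * f z + (k *\<^sub>R p) \<bullet> (w - z)
      + (k *\<^sub>R X (w - z)) \<bullet> (w - z) / 2 + e * (norm (w - z))\<^sup>2"
  proof eventually_elim
    case (elim w)
    from mult_left_mono[OF this, of k] show ?case using k by (simp add: algebra_simps)
  qed
qed

lemma superjet_cong:
  assumes "\<And>w. w \<in> S \<Longrightarrow> f w = g w" "z \<in> S" "superjet S f z p X"
  shows "superjet S g z p X"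
proof -
  have "\<forall>\<^sub>F w in at z within S. w \<in> S" by (simp add: eventually_at_filter)
  then show ?thesis
    using assms unfolding superjet_def by (auto elim: eventually_elim2)
qed

section \<open>Quadratic test functions\<close>

lemma C_k_on_const: "C_k_on k W (\<lambda>z. c)"
  by (induction k arbitrary: c) (simp_all add: frechet_derivative_const)

lemma C_k_on_affine:
  fixes q z0 :: "'a::real_inner"
  shows "C_k_on k W (\<lambda>z. c + q \<bullet> (z - z0))"
proof (cases k)
  case 0
  then show ?thesis by (auto intro!: continuous_intros)
next
  case (Suc j)
  have d: "((\<lambda>z. c + q \<bullet> (z - z0)) has_derivative (\<lambda>h. q \<bullet> h)) (at z)"
    for z
    by (auto intro!: derivative_eq_intros)
  then have "(\<lambda>z. c + q \<bullet> (z - z0)) differentiable (at z)" for z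
    by (auto simp: differentiable_def)
  moreover have "frechet_derivative (\<lambda>z. c + q \<bullet> (z - z0)) (at z)
      = (\<lambda>h. q \<bullet> h)" for z
    using frechet_derivative_at[OF d] by simp
  ultimately show ?thesis using Suc by (simp add: C_k_on_const)
qed

lemma has_derivative_quadratic:
  fixes B :: "'a::euclidean_space \<Rightarrow> 'a"
  assumes B: "linear B"
  shows "((\<lambda>z. c + q \<bullet> (z - z0) + B (z - z0) \<bullet> (z - z0)) has_derivative
     (\<lambda>h. q \<bullet> h + (B h + adjoint B h) \<bullet> (z - z0))) (at z)"
proof -
  have bl: "bounded_linear B" using B by (simp add: linear_conv_bounded_linear)
  have "((\<lambda>z. c + q \<bullet> (z - z0) + B (z - z0) \<bullet> (z - z0)) has_derivative
     (\<lambda>h. q \<bullet> h + (B (z - z0) \<bullet> h + B h \<bullet> (z - z0)))) (at z)"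
    by (rule derivative_eq_intros bounded_linear.has_derivative[OF bl] refl)+ simp
  moreover have "B (z - z0) \<bullet> h = adjoint B h \<bullet> (z - z0)" for h
    using adjoint_works[OF B, of "z - z0" h] by (simp add: inner_commute)
  ultimately show ?thesis by (simp add: inner_add_left add.commute)
qed

lemma smooth_near_quadratic:
  fixes B :: "'a::euclidean_space \<Rightarrow> 'a"
  assumes B: "linear B"
  shows "smooth_near (\<lambda>z. c + q \<bullet> (z - z0) + B (z - z0) \<bullet> (z - z0)) y"
proof -
  let ?f = "\<lambda>z. c + q \<bullet> (z - z0) + B (z - z0) \<bullet> (z - z0)"
  note d = has_derivative_quadratic[OF B, of c q z0]
  have diff: "?f differentiable (at z)" for z using d by (auto simp: differentiable_def)
  have fd: "frechet_derivative ?f (at z)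
      = (\<lambda>h. q \<bullet> h + (B h + adjoint B h) \<bullet> (z - z0))" for z
    using frechet_derivative_at[OF d] by simp
  have "C_k_on k UNIV ?f" for k
  proof (cases k)
    case 0
    have "continuous_on UNIV ?f"
      using diff by (simp add: differentiable_imp_continuous_on differentiable_on_def)
    then show ?thesis using 0 by simp
  next
    case (Suc j)
    then show ?thesis using diff by (simp add: fd C_k_on_affine del: inner_add_left)
  qed
  then show ?thesis unfolding smooth_near_def by (intro exI[of _ UNIV]) auto
qed

lemma chi_inner_axis: "(\<chi> i. (v :: real^'d) \<bullet> axis i 1) = v"
  by (simp add: vec_eq_iff inner_axis)

lemma grad_quadratic:
  fixes B :: "real^'d \<Rightarrow> real^'d"
  assumes B: "linear B"
  shows "grad (\<lambda>x. c + q \<bullet> (x - y) + B (x - y) \<bullet> (x - y))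
      = (\<lambda>x. q + (B (x - y) + adjoint B (x - y)))"
proof
  fix x
  have "frechet_derivative (\<lambda>x. c + q \<bullet> (x - y) + B (x - y) \<bullet> (x - y)) (at x)
      = (\<lambda>h. q \<bullet> h + (B h + adjoint B h) \<bullet> (x - y))"
    using frechet_derivative_at[OF has_derivative_quadratic[OF B]] by simp
  also have "\<dots> = (\<lambda>h. (q + (B (x - y) + adjoint B (x - y))) \<bullet> h)"
    using adjoint_works[OF B] adjoint_clauses(2)[OF B]
    by (auto simp: fun_eq_iff inner_add_left inner_add_right inner_commute)
  finally show "grad (\<lambda>x. c + q \<bullet> (x - y) + B (x - y) \<bullet> (x - y)) x
      = q + (B (x - y) + adjoint B (x - y))"
    by (simp only: grad_def chi_inner_axis)
qed

lemma hessian_quadratic: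
  fixes B :: "real^'d \<Rightarrow> real^'d"
  assumes B: "linear B"
  shows "hessian (\<lambda>x. c + q \<bullet> (x - y) + B (x - y) \<bullet> (x - y)) x
      = matrix (\<lambda>h. B h + adjoint B h)"
proof -
  have bl: "bounded_linear B" "bounded_linear (adjoint B)"
    using B adjoint_linear[OF B] by (simp_all add: linear_conv_bounded_linear)
  have "((\<lambda>x. q + (B (x - y) + adjoint B (x - y))) has_derivative (\<lambda>h. B h
      + adjoint B h)) (at x)"
    by (rule derivative_eq_intros bounded_linear.has_derivative[OF bl(1)] bounded_linear.has_derivative[OF bl(2)] refl)+ simp
  from frechet_derivative_at[OF this] show ?thesis
    by (simp add: hessian_def grad_quadratic[OF B])
qed

text \<open>Cyclicity of the trace rewrites it through the quadratic form of \<open>M\<close> on the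
  rows of \<sigma>. In this shape rows taken at two different points can be inserted into the matrix
  inequality of the theorem on sums.\<close>

lemma trace_diffusion:
  fixes \<sigma> :: "real^'d \<Rightarrow> real^'d^'n" and M :: "real^'d \<Rightarrow> real^'d"
  assumes M: "linear M"
  shows "trace (diffusion \<sigma> x ** matrix M)
      = (\<Sum>i\<in>UNIV. M (\<sigma> x $ i) \<bullet> (\<sigma> x $ i)) / 2"
proof -
  let ?S = "\<sigma> x" and ?N = "matrix M"
  have "trace (diffusion \<sigma> x ** ?N) = trace ((transpose ?S ** ?S) ** ?N) / 2"
    unfolding diffusion_def trace_def matrix_matrix_mult_def[of _ ?N]
    by (simp add: sum_divide_distrib)
  also have "trace ((transpose ?S ** ?S) ** ?N) = trace (transpose ?S ** (?S ** ?N))"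
    by (simp add: matrix_mul_assoc)
  also have "\<dots> = trace ((?S ** ?N) ** transpose ?S)" by (rule trace_mul_sym)
  also have "\<dots> = trace (?S ** (?N ** transpose ?S))" by (simp add: matrix_mul_assoc)
  also have "\<dots> = (\<Sum>i\<in>UNIV. (?N *v (?S $ i)) \<bullet> (?S $ i))"
    by (simp add: trace_def matrix_matrix_mult_def transpose_def matrix_vector_mult_def inner_vec_def
        mult.commute)
  also have "\<dots> = (\<Sum>i\<in>UNIV. M (?S $ i) \<bullet> (?S $ i))"
    using M by (simp add: matrix_works linear_matrix_vector_mul_eq)
  finally show ?thesis .
qed

text \<open>The spatial Hessian is a block plus its adjoint; both have the same quadratic form,
  which cancels the factor 1/2 of the diffusion matrix. The zero time component of the vectors
  selects the spatial block of \<open>B\<close>.\<close>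

lemma HJ_operator_quadratic:
  fixes \<sigma> :: "real^'d \<Rightarrow> real^'d^'n"
    and B :: "(real^'d) \<times> real \<Rightarrow> (real^'d) \<times> real"
  assumes B: "linear B"
  shows "HJ_operator (diffusion \<sigma>) H (\<lambda>z. c + q \<bullet> (z - (y, s))
      + B (z - (y, s)) \<bullet> (z - (y, s))) y s
    = snd q - (\<Sum>i\<in>UNIV. B (\<sigma> y $ i, 0) \<bullet> (\<sigma> y $ i, 0)) + H (fst q) y"
proof -
  let ?\<phi> = "\<lambda>z. c + q \<bullet> (z - (y, s)) + B (z - (y, s)) \<bullet> (z - (y, s))"
  define B1 where "B1 h = fst (B (h, 0))" for h
  have B1: "linear B1"
  proof (rule linearI)
    show "B1 (h + k) = B1 h + B1 k" for h k
      using linear_add[OF B, of "(h, 0)" "(k, 0)"] by (simp add: B1_def)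
    show "B1 (r *\<^sub>R h) = r *\<^sub>R B1 h" for r h
      using linear_scale[OF B, of r "(h, 0)"] by (simp add: B1_def)
  qed
  have \<phi>x: "(\<lambda>x. ?\<phi> (x, s))
      = (\<lambda>x. c + fst q \<bullet> (x - y) + B1 (x - y) \<bullet> (x - y))"
    by (simp add: inner_prod_def B1_def)
  have "B (0, \<tau>) \<bullet> (0, \<tau>) = \<tau>\<^sup>2 * snd (B (0, 1))" for \<tau> :: real
    using linear_scale[OF B, of \<tau> "(0, 1)"] by (simp add: inner_prod_def power2_eq_square)
  then have "(\<lambda>t. ?\<phi> (y, t))
      = (\<lambda>t. c + snd q * (t - s) + (t - s)\<^sup>2 * snd (B (0, 1)))"
    by (simp add: inner_prod_def)
  moreover have "((\<lambda>t. c + snd q * (t - s)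
      + (t - s)\<^sup>2 * snd (B (0, 1))) has_real_derivative snd q) (at s)"
    by (auto intro!: derivative_eq_intros)
  ultimately have dt: "deriv (\<lambda>t. ?\<phi> (y, t)) s = snd q" by (simp add: DERIV_imp_deriv)
  have "linear (\<lambda>h. B1 h + adjoint B1 h)" using B1 by (intro linear_compose_add adjoint_linear)
  then have "trace (diffusion \<sigma> y ** hessian (\<lambda>x. ?\<phi> (x, s)) y)
      = (\<Sum>i\<in>UNIV. (B1 (\<sigma> y $ i)
          + adjoint B1 (\<sigma> y $ i)) \<bullet> (\<sigma> y $ i)) / 2"
    unfolding \<phi>x hessian_quadratic[OF B1] by (rule trace_diffusion)
  also have "\<dots> = (\<Sum>i\<in>UNIV. B (\<sigma> y $ i, 0) \<bullet> (\<sigma> y $ i, 0))"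
    unfolding sum_divide_distrib
  proof (rule sum.cong)
    fix i
    have "adjoint B1 (\<sigma> y $ i) \<bullet> (\<sigma> y $ i)
        = B1 (\<sigma> y $ i) \<bullet> (\<sigma> y $ i)"
      using adjoint_works[OF B1, of "\<sigma> y $ i" "\<sigma> y $ i"] by (simp add: inner_commute)
    then show "(B1 (\<sigma> y $ i) + adjoint B1 (\<sigma> y $ i)) \<bullet> (\<sigma> y $ i) / 2
        = B (\<sigma> y $ i, 0) \<bullet> (\<sigma> y $ i, 0)"
      by (simp add: inner_add_left B1_def inner_prod_def)
  qed simp
  finally have tr: "trace (diffusion \<sigma> y ** hessian (\<lambda>x. ?\<phi> (x, s)) y)
      = (\<Sum>i\<in>UNIV. B (\<sigma> y $ i, 0) \<bullet> (\<sigma> y $ i, 0))" .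
  have "grad (\<lambda>x. ?\<phi> (x, s)) y = fst q"
    unfolding \<phi>x grad_quadratic[OF B1]
      using linear_0[OF B1] linear_0[OF adjoint_linear[OF B1]] by simp
  then show ?thesis unfolding HJ_operator_def dt tr by simp
qed

lemma norm_matrix_sq:
  fixes S :: "real^'d^'n"
  shows "(norm S)\<^sup>2 = (\<Sum>i\<in>UNIV. (norm (S $ i))\<^sup>2)"
  by (simp add: norm_vec_def L2_set_def sum_nonneg)

text \<open>The range up to 1/2 lets the same limit serve for the perturbed test functions and for
  \<delta> \<rightarrow> 0 in the comparison.\<close>

lemma le_zero_of_le_eps_mult:
  fixes a K :: real
  assumes "\<And>e. 0 < e \<Longrightarrow> e \<le> 1/2 \<Longrightarrow> a \<le> e * K"
  shows "a \<le> 0"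
proof (rule tendsto_lowerbound)
  show "((\<lambda>e. e * K) \<longlongrightarrow> 0) (at_right 0)" by (auto intro!: tendsto_eq_intros)
  have "\<forall>\<^sub>F e in at_right 0. e \<in> {0<..<1/2::real}"
    by (intro eventually_at_right_real) auto
  then show "\<forall>\<^sub>F e in at_right 0. a \<le> e * K" by eventually_elim (use assms in auto)
qed simp

text \<open>The test function is the quadratic of the jet with an additional e |h|^2, which absorbs
  the little-o term. The slope is unchanged, so \<open>e\<close> enters only linearly through the
  trace.\<close>

lemma viscosity_subsolution_superjet:
  fixes \<sigma> :: "real^'d \<Rightarrow> real^'d^'n"
  assumes sub: "viscosity_subsolution (diffusion \<sigma>) H U T u" and y: "y \<in> U" "s \<in> {0<..<T}"
    and jet: "superjet (U \<times> {0<..<T}) u (y, s) p X" and X: "linear X"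
  shows "snd p - (\<Sum>i\<in>UNIV. X (\<sigma> y $ i, 0) \<bullet> (\<sigma> y $ i, 0)) / 2
      + H (fst p) y \<le> 0" (is "?a \<le> 0")
proof (rule le_zero_of_le_eps_mult)
  fix e :: real assume e: "e > 0"
  define B where "B h = (1/2) *\<^sub>R X h + e *\<^sub>R h" for h
  have B: "linear B" unfolding B_def using X
    by (intro linear_compose_add linear_compose_scale_right linear_scale_self)
  have Bq: "B h \<bullet> h = X h \<bullet> h / 2 + e * (norm h)\<^sup>2" for h
    by (simp add: B_def inner_add_left power2_norm_eq_inner)
  let ?\<phi> = "\<lambda>z. 0 + p \<bullet> (z - (y, s)) + B (z - (y, s)) \<bullet> (z - (y, s))"
  have "\<forall>\<^sub>F z in at (y, s) within U \<times> {0<..<T}. u z - ?\<phi> z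
      \<le> u (y, s) - ?\<phi> (y, s)"
    using jet[unfolded superjet_def, rule_format, OF e]
    by (rule eventually_mono) (simp add: Bq)
  then have "HJ_operator (diffusion \<sigma>) H ?\<phi> y s \<le> 0"
    using sub y smooth_near_quadratic[OF B, of 0 p "(y, s)" "(y, s)"]
      unfolding viscosity_subsolution_def by blast
  then have "snd p - (\<Sum>i\<in>UNIV. B (\<sigma> y $ i, 0) \<bullet> (\<sigma> y $ i, 0))
      + H (fst p) y \<le> 0"
    unfolding HJ_operator_quadratic[OF B] .
  also have "(\<Sum>i\<in>UNIV. B (\<sigma> y $ i, 0) \<bullet> (\<sigma> y $ i, 0))
      = (\<Sum>i\<in>UNIV. X (\<sigma> y $ i, 0) \<bullet> (\<sigma> y $ i, 0)) / 2
          + e * (norm (\<sigma> y))\<^sup>2"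
    unfolding norm_matrix_sq by (simp add: Bq norm_Pair sum.distrib sum_distrib_left sum_divide_distrib)
  finally show "?a \<le> e * (norm (\<sigma> y))\<^sup>2" by simp
qed

text \<open>A superjet of -v is minus a subjet of \<open>v\<close>: the test function has slope -q
  and Hessian -Y up to the error, and the supersolution inequality is stated after a change of
  sign.\<close>

lemma viscosity_supersolution_superjet:
  fixes \<sigma> :: "real^'d \<Rightarrow> real^'d^'n"
  assumes super: "viscosity_supersolution (diffusion \<sigma>) H U T v"
    and y: "y \<in> U" "s \<in> {0<..<T}"
    and jet: "superjet (U \<times> {0<..<T}) (\<lambda>z. - v z) (y, s) q Y" and Y: "linear Y"
  shows "snd q - (\<Sum>i\<in>UNIV. Y (\<sigma> y $ i, 0)
      \<bullet> (\<sigma> y $ i, 0)) / 2 - H (- fst q) y \<le> 0" (is "?a \<le> 0")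
proof (rule le_zero_of_le_eps_mult)
  fix e :: real assume e: "e > 0"
  define B where "B h = (-1/2) *\<^sub>R Y h + (- e) *\<^sub>R h" for h
  have B: "linear B" unfolding B_def using Y
    by (intro linear_compose_add linear_compose_scale_right linear_scale_self)
  have Bq: "B h \<bullet> h = - (Y h \<bullet> h / 2) - e * (norm h)\<^sup>2" for h
    by (simp add: B_def inner_add_left inner_diff_left power2_norm_eq_inner)
  let ?\<phi> = "\<lambda>z. 0 + (- q) \<bullet> (z - (y, s)) + B (z - (y, s)) \<bullet> (z - (y, s))"
  have "\<forall>\<^sub>F z in at (y, s) within U \<times> {0<..<T}. v z - ?\<phi> z \<ge> v (y, s) - ?\<phi> (y, s)"
    using jet[unfolded superjet_def, rule_format, OF e]
    by (rule eventually_mono) (simp add: Bq)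
  then have "HJ_operator (diffusion \<sigma>) H ?\<phi> y s \<ge> 0"
    using super y smooth_near_quadratic[OF B, of 0 "- q" "(y, s)" "(y, s)"]
      unfolding viscosity_supersolution_def by blast
  then have "0
      \<le> snd (- q) - (\<Sum>i\<in>UNIV. B (\<sigma> y $ i, 0) \<bullet> (\<sigma> y $ i, 0))
          + H (fst (- q)) y"
    unfolding HJ_operator_quadratic[OF B] .
  also have "(\<Sum>i\<in>UNIV. B (\<sigma> y $ i, 0) \<bullet> (\<sigma> y $ i, 0))
      = - ((\<Sum>i\<in>UNIV. Y (\<sigma> y $ i, 0)
          \<bullet> (\<sigma> y $ i, 0)) / 2) - e * (norm (\<sigma> y))\<^sup>2"
    unfolding norm_matrix_sq
    by (simp add: Bq norm_Pair sum_subtractf sum_negf sum_distrib_left sum_divide_distrib)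
  finally show "?a \<le> e * (norm (\<sigma> y))\<^sup>2" by simp
qed

subsection \<open>Comparison\<close>

lemma usc_on_sequence:
  fixes f :: "'a::metric_space \<Rightarrow> real"
  assumes "usc_on K f" "z \<in> K" "f z < c" "\<And>n. x n \<in> K" "x \<longlonglongrightarrow> z"
  shows "\<forall>\<^sub>F n in sequentially. f (x n) < c"
proof -
  have "\<forall>\<^sub>F w in nhds z. w \<noteq> z \<longrightarrow> w \<in> K \<longrightarrow> f w < c"
    using usc_onD[OF assms(1,2,3)] by (simp add: eventually_at_filter)
  then have "\<forall>\<^sub>F w in nhds z. w \<in> K \<longrightarrow> f w < c"
    by (rule eventually_mono) (use assms(3) in auto)
  then have "\<forall>\<^sub>F n in sequentially. x n \<in> K \<longrightarrow> f (x n) < c"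
    using assms(5) by (rule eventually_compose_filterlim)
  then show ?thesis by (rule eventually_mono) (use assms(4) in auto)
qed

text \<open>The penalty times \<alpha> tends to zero because the approximate maxima for successive
  values of \<alpha> converge and their differences dominate it. Semicontinuity keeps the limit
  point at a positive value.\<close>

lemma doubling_sequence:
  fixes f g :: "'a::euclidean_space \<Rightarrow> real"
  assumes K: "compact K" and f: "usc_on K f" and g: "usc_on K g"
    and z0: "z0 \<in> K" "f z0 + g z0 > 0"
  obtains \<alpha> :: "nat \<Rightarrow> real" and x y p q :: "nat \<Rightarrow> 'a"
    and X Y :: "nat \<Rightarrow> 'a \<Rightarrow> 'a" and z where
    "z \<in> K" "f z + g z > 0" "\<And>n. x n \<in> K" "\<And>n. y n \<in> K" "x
        \<longlonglongrightarrow> z" "y \<longlonglongrightarrow> z"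
    "\<And>n. \<alpha> n > 0" "(\<lambda>n. \<alpha> n * (norm (x n - y n))\<^sup>2)
        \<longlonglongrightarrow> 0" "(\<lambda>n. norm (p n + q n)) \<longlonglongrightarrow> 0"
    "\<And>n. linear (X n)" "\<And>n. linear (Y n)"
    "\<And>n. superjet K f (x n) (p n) (X n)" "\<And>n. superjet K g (y n) (q n) (Y n)"
    "\<And>n \<xi> \<zeta>. X n \<xi> \<bullet> \<xi> + Y n \<zeta> \<bullet> \<zeta>
        \<le> 2 * \<alpha> n * (norm (\<xi> - \<zeta>))\<^sup>2"
proof -
  define \<alpha> :: "nat \<Rightarrow> real" where "\<alpha> n = 2 ^ n" for n
  define \<eta> :: "nat \<Rightarrow> real" where "\<eta> n = (1 / 2) ^ n" for n
  have \<alpha>: "\<alpha> n > 0" "\<alpha> n \<ge> 1" and \<eta>: "\<eta> n > 0" for n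
    by (simp_all add: \<alpha>_def \<eta>_def)
  have \<eta>0: "\<eta> \<longlonglongrightarrow> 0"
    unfolding \<eta>_def by (intro LIMSEQ_realpow_zero) auto
  define good where "good n t
      \<longleftrightarrow> (case t of (x, y, p, q, X, Y) \<Rightarrow> x \<in> K \<and> y \<in> K \<and>
      (\<forall>x'\<in>K. \<forall>y'\<in>K. f x' + g y' - \<alpha> n / 2 * (norm (x' - y'))\<^sup>2
          \<le> f x + g y - \<alpha> n / 2 * (norm (x - y))\<^sup>2 + \<eta> n) \<and>
      norm (p + q)
          \<le> \<eta> n \<and> linear X \<and> linear Y \<and> superjet K f x p X \<and> superjet K g y q Y \<and>
      (\<forall>\<xi> \<zeta>. X \<xi> \<bullet> \<xi> + Y \<zeta> \<bullet> \<zeta>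
          \<le> 2 * \<alpha> n * (norm (\<xi> - \<zeta>))\<^sup>2))" for n and t :: "'a \<times> 'a \<times> 'a \<times> 'a \<times> ('a \<Rightarrow> 'a) \<times> ('a \<Rightarrow> 'a)"
  have "\<exists>t. good n t" for n
  proof -
    have "K \<noteq> {}" using z0 by auto
    obtain x y p q X Y where "x \<in> K" "y \<in> K"
      "\<And>x' y'. x' \<in> K \<Longrightarrow> y' \<in> K \<Longrightarrow>
        f x' + g y' - \<alpha> n / 2 * (norm (x' - y'))\<^sup>2
            \<le> f x + g y - \<alpha> n / 2 * (norm (x - y))\<^sup>2 + \<eta> n"
      "norm (p + q) \<le> \<eta> n" "linear X" "linear Y" "superjet K f x p X" "superjet K g y q Y"
      "\<And>\<xi> \<zeta>. X \<xi> \<bullet> \<xi> + Y \<zeta> \<bullet> \<zeta>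
          \<le> 2 * \<alpha> n * (norm (\<xi> - \<zeta>))\<^sup>2"
      by (rule theorem_on_sums[OF K \<open>K \<noteq> {}\<close> f g \<alpha>(1)[of n] \<eta>[of n]]) blast
    then have "good n (x, y, p, q, X, Y)" by (simp add: good_def)
    then show ?thesis by blast
  qed
  then obtain t where t: "\<And>n. good n (t n)" by metis
  define x y p q X Y where "x n = fst (t n)" and "y n = fst (snd (t n))"
    and "p n = fst (snd (snd (t n)))"
    and "q n = fst (snd (snd (snd (t n))))" and "X n = fst (snd (snd (snd (snd (t n)))))"
    and "Y n = snd (snd (snd (snd (snd (t n)))))" for n
  have "t n = (x n, y n, p n, q n, X n, Y n)" for n
    by (simp add: x_def y_def p_def q_def X_def Y_def)
  with t have G: "good n (x n, y n, p n, q n, X n, Y n)" for n by metis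
  have xK: "x n \<in> K" and yK: "y n \<in> K" for n using G[of n] by (auto simp: good_def)
  define c where "c n = f (x n) + g (y n) - \<alpha> n / 2 * (norm (x n - y n))\<^sup>2" for n
  have max: "f x' + g y' - \<alpha> n / 2 * (norm (x' - y'))\<^sup>2 \<le> c n + \<eta> n"
    if "x' \<in> K" "y' \<in> K" for x' y' n
    using G[of n] that by (auto simp: good_def c_def)
  have c_lower: "f z0 + g z0 \<le> c n + \<eta> n" for n using max[OF z0(1) z0(1), of n] by simp
  \<comment> \<open>The maximiser of level n + 1 competes at level \<open>n\<close>, where \<alpha>
    is half as large; the saving is a quarter of the new \<alpha> times the squared
    distance.\<close>
  have step: "c (Suc n) + \<alpha> (Suc n) / 4 * (norm (x (Suc n) - y (Suc n)))\<^sup>2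
      \<le> c n + \<eta> n" for n
    using max[OF xK[of "Suc n"] yK[of "Suc n"], of n] by (simp add: c_def \<alpha>_def field_simps)
  \<comment> \<open>Since 2 \<eta> halves at each level by exactly the error of one comparison,
    adding it makes the sequence decreasing, and its differences bound the penalties.\<close>
  define e where "e n = c n + 2 * \<eta> n" for n
  have \<eta>S: "2 * \<eta> (Suc n) = \<eta> n" for n by (simp add: \<eta>_def)
  have gap: "\<alpha> (Suc n) / 4 * (norm (x (Suc n) - y (Suc n)))\<^sup>2 \<le> e n - e (Suc n)" for n
    using step[of n] \<eta>S[of n] by (simp add: e_def)
  have "e (Suc n) \<le> e n" for n
  proof -
    have "0 \<le> \<alpha> (Suc n) / 4 * (norm (x (Suc n) - y (Suc n)))\<^sup>2"
      using \<alpha>(1)[of "Suc n"] by (intro mult_nonneg_nonneg) auto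
    then show ?thesis using gap[of n] by linarith
  qed
  then have "decseq e" by (rule decseq_SucI)
  moreover have "f z0 + g z0 \<le> e n" for n using c_lower[of n] \<eta>[of n] by (simp add: e_def)
  ultimately obtain L where L: "e \<longlonglongrightarrow> L"
    using decseq_convergent[of e "f z0 + g z0"] by blast
  have "(\<lambda>n. 4 * (e n - e (Suc n))) \<longlonglongrightarrow> 4 * (L - L)"
    by (intro tendsto_intros L LIMSEQ_Suc[OF L])
  then have "(\<lambda>n. 4 * (e n - e (Suc n))) \<longlonglongrightarrow> 0" by simp
  then have "(\<lambda>n. \<alpha> (Suc n) * (norm (x (Suc n) - y (Suc n)))\<^sup>2)
      \<longlonglongrightarrow> 0"
  proof (rule Lim_null_comparison[rotated], intro always_eventually allI)
    fix n show "norm (\<alpha> (Suc n) * (norm (x (Suc n) - y (Suc n)))\<^sup>2)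
        \<le> 4 * (e n - e (Suc n))"
      using gap[of n] \<alpha>(1)[of "Suc n"] by (simp add: abs_mult)
  qed
  then have pen: "(\<lambda>n. \<alpha> n * (norm (x n - y n))\<^sup>2) \<longlonglongrightarrow> 0"
    by (rule LIMSEQ_imp_Suc)
  have "(\<lambda>n. (norm (x n - y n))\<^sup>2) \<longlonglongrightarrow> 0"
  proof (rule Lim_null_comparison[OF _ pen], rule always_eventually, rule allI)
    fix n show "norm ((norm (x n - y n))\<^sup>2) \<le> \<alpha> n * (norm (x n - y n))\<^sup>2"
      using mult_right_mono[OF \<alpha>(2)[of n], of "(norm (x n - y n))\<^sup>2"] by simp
  qed
  from tendsto_real_sqrt[OF this] have "(\<lambda>n. norm (x n - y n)) \<longlonglongrightarrow> 0"
    by simp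
  then have xy: "(\<lambda>n. x n - y n) \<longlonglongrightarrow> 0" by (rule tendsto_norm_zero_cancel)
  have "seq_compact K" using K by (simp add: compact_eq_seq_compact_metric)
  then obtain z r where z: "z \<in> K" and r: "strict_mono r"
    and xr: "(x \<circ> r) \<longlonglongrightarrow> z"
    unfolding seq_compact_def using xK by blast
  have yr: "(y \<circ> r) \<longlonglongrightarrow> z"
    using tendsto_diff[OF xr LIMSEQ_subseq_LIMSEQ[OF xy r]] by (simp add: o_def)
  have "f z0 + g z0 \<le> f z + g z"
  proof (rule ccontr)
    assume neg: "\<not> ?thesis"
    define d where "d = (f z0 + g z0 - (f z + g z)) / 4"
    have d: "d > 0" using neg by (simp add: d_def)
    have "\<forall>\<^sub>F n in sequentially. f ((x \<circ> r) n) < f z + d"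
      by (rule usc_on_sequence[OF f z _ _ xr]) (use d xK in auto)
    moreover have "\<forall>\<^sub>F n in sequentially. g ((y \<circ> r) n) < g z + d"
      by (rule usc_on_sequence[OF g z _ _ yr]) (use d yK in auto)
    moreover have "\<forall>\<^sub>F n in sequentially. (\<eta> \<circ> r) n < d"
      using order_tendstoD(2)[OF LIMSEQ_subseq_LIMSEQ[OF \<eta>0 r] d] .
    ultimately have "\<forall>\<^sub>F n in sequentially. False"
    proof eventually_elim
      case (elim n)
      have "c (r n) \<le> f (x (r n)) + g (y (r n))"
        unfolding c_def using \<alpha>(1)[of "r n"] by simp
      then show False using elim c_lower[of "r n"] d by (simp add: d_def field_simps)
    qed
    then show False by simp
  qed
  then have pos: "f z + g z > 0" using z0 by simp
  have "(\<lambda>n. norm (p n + q n)) \<longlonglongrightarrow> 0"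
    by (rule Lim_null_comparison[OF _ \<eta>0]) (use G in \<open>auto simp: good_def intro!: always_eventually\<close>)
  from LIMSEQ_subseq_LIMSEQ[OF this r] have pq: "(\<lambda>n. norm (p (r n) + q (r n)))
      \<longlonglongrightarrow> 0" by (simp add: o_def)
  show ?thesis
  proof (rule that[of z "x \<circ> r" "y \<circ> r" "\<alpha> \<circ> r" "p \<circ> r" "q \<circ> r" "X \<circ> r" "Y \<circ> r"])
    show "(\<lambda>n. (\<alpha> \<circ> r) n * (norm ((x \<circ> r) n - (y \<circ> r) n))\<^sup>2)
        \<longlonglongrightarrow> 0"
      using LIMSEQ_subseq_LIMSEQ[OF pen r] by (simp add: o_def)
  qed (use z pos xr yr pq xK yK \<alpha> G in \<open>auto simp: good_def\<close>)
qed

section \<open>The gain from convexity and coercivity of the Hamiltonian\<close>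

lemma powr_add_le:
  fixes a b m :: real
  assumes "0 \<le> a" "0 \<le> b" "0 < m"
  shows "(a + b) powr m \<le> 2 powr m * (a powr m + b powr m)"
proof -
  have "(a + b) powr m \<le> (2 * max a b) powr m" using assms by (intro powr_mono2) auto
  also have "\<dots> = 2 powr m * max a b powr m" using assms by (simp add: powr_mult)
  also have "max a b powr m \<le> a powr m + b powr m" by (auto simp: max_def)
  finally show ?thesis by simp
qed

text \<open>Convexity with superlinear growth gives more than Jensen's inequality: writing
  \<open>(1 - \<delta>) p + \<delta> e\<close> as a convex combination with a slightly smaller weight on \<open>p\<close> leaves a
  multiple of \<open>- H p\<close> over, and \<open>H p\<close> is coercive.\<close>

lemma convex_coercive_gain:
  assumes m: "m > 1" and L: "\<Lambda> \<ge> 1" and a: "0 < a" "a \<le> 1" and M: "M \<ge> 1"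
  obtains c where "0 < c" "c \<le> 1/2"
    "\<And>h p e \<delta>. convex_on UNIV h
        \<Longrightarrow> (\<And>p. a * norm p powr m - M \<le> h p) \<Longrightarrow>
       (\<And>p. h p \<le> \<Lambda> * (norm p powr m + 1)) \<Longrightarrow> norm e \<le> 1
           \<Longrightarrow> 0 < \<delta> \<Longrightarrow> \<delta> \<le> 1/2 \<Longrightarrow>
      h ((1 - \<delta>) *\<^sub>R p + \<delta> *\<^sub>R e :: 'a::real_normed_vector) \<le>
        (1 - \<delta>) * h p + \<delta> * (1 + 2 * \<Lambda> * (2 powr m + 1) - c * norm p powr m)"
proof -
  \<comment> \<open>The first bound gives k M \<le> 1, so the lower order constant of the coercivity
    costs at most \<delta>, whatever \<open>M\<close> is. The second makes the growth of
    \<open>h\<close> at the auxiliary point \<open>q\<close>, of order k^m, at most half of the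
    coercive gain of order k a.\<close>
  define k where "k = min (1 / M) ((a / (4 * \<Lambda> * 2 powr m)) powr (1 / (m - 1)))"
  have b0: "0 < a / (4 * \<Lambda> * 2 powr m)" using a L by simp
  have kM: "k \<le> 1 / M" by (simp add: k_def)
  also have "1 / M \<le> 1" using M by simp
  finally have k1: "k \<le> 1" .
  have "0 < k" using M a L by (simp add: k_def)
  moreover have "k * M \<le> 1" using kM M by (simp add: pos_le_divide_eq)
  ultimately have k: "0 < k" "k \<le> 1" "k * M \<le> 1" using k1 by auto
  have "k powr (m - 1) \<le> ((a / (4 * \<Lambda> * 2 powr m)) powr (1 / (m - 1))) powr (m - 1)"
    using k(1) m by (intro powr_mono2) (auto simp: k_def)
  also have "\<dots> = a / (4 * \<Lambda> * 2 powr m)" using m a L by (simp add: powr_powr abs_mult)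
  finally have "4 * \<Lambda> * 2 powr m * k powr (m - 1) \<le> a" using L by (simp add: field_simps)
  then have "4 * \<Lambda> * 2 powr m * k powr (m - 1) * k \<le> a * k"
    using k(1) by (intro mult_right_mono) auto
  moreover have "k powr (m - 1) * k = k powr m" using k(1) by (simp add: powr_diff)
  ultimately have km: "4 * \<Lambda> * 2 powr m * k powr m \<le> a * k" by (simp add: mult.assoc)
  show ?thesis
  proof (rule that[of "k * a / 2"])
    show "0 < k * a / 2" "k * a / 2 \<le> 1/2" using k a mult_le_one[of k a] by auto
    fix h :: "'a \<Rightarrow> real" and p e :: 'a and \<delta> :: real
    assume conv: "convex_on UNIV h" and lo: "\<And>p. a * norm p powr m - M \<le> h p"
      and up: "\<And>p. h p \<le> \<Lambda> * (norm p powr m + 1)" and e: "norm e \<le> 1"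
        and \<delta>: "0 < \<delta>" "\<delta> \<le> 1/2"
    \<comment> \<open>The weight on \<open>p\<close> drops from 1 - \<delta> to 1 - \<delta> - k
      \<delta>; the point \<open>q\<close> is what the remaining weight must carry to give the same
      combination.\<close>
    define \<mu> where "\<mu> = (1 + k) * \<delta>"
    have "(1 + k) * \<delta> \<le> 2 * (1/2)" using k \<delta> by (intro mult_mono) auto
    then have \<mu>: "0 \<le> \<mu>" "\<mu> \<le> 1" using k \<delta> by (auto simp: \<mu>_def)
    define q where "q = (1 / (1 + k)) *\<^sub>R (k *\<^sub>R p + e)"
    have "\<mu> *\<^sub>R q = \<delta> *\<^sub>R (k *\<^sub>R p + e)"
      using k by (simp add: \<mu>_def q_def)
    then have comb: "(1 - \<mu>) *\<^sub>R p + \<mu> *\<^sub>R q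
        = (1 - \<delta>) *\<^sub>R p + \<delta> *\<^sub>R e"
      by (simp add: \<mu>_def algebra_simps)
    have "h ((1 - \<mu>) *\<^sub>R p + \<mu> *\<^sub>R q) \<le> (1 - \<mu>) * h p + \<mu> * h q"
      using conv \<mu> by (intro convex_onD) auto
    then have 1: "h ((1 - \<delta>) *\<^sub>R p + \<delta> *\<^sub>R e)
        \<le> (1 - \<mu>) * h p + \<mu> * h q" by (simp add: comb)
    have "norm q \<le> norm (k *\<^sub>R p + e)"
      using k by (simp add: q_def divide_le_eq mult_le_cancel_left1 norm_ge_zero)
    also have "\<dots> \<le> k * norm p + 1" using norm_triangle_ineq[of "k *\<^sub>R p" e] e k by simp
    finally have "norm q powr m \<le> (k * norm p + 1) powr m" using m by (intro powr_mono2) auto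
    also have "\<dots> \<le> 2 powr m * ((k * norm p) powr m + 1 powr m)"
      using k m by (intro powr_add_le) auto
    also have "(k * norm p) powr m = k powr m * norm p powr m" using k by (simp add: powr_mult)
    finally have "h q \<le> \<Lambda> * (2 powr m * (k powr m * norm p powr m + 1) + 1)"
      using up[of q] L by (smt (verit) mult_left_mono powr_one_eq_one)
    moreover have "0 \<le> \<Lambda> * (2 powr m * (k powr m * norm p powr m + 1) + 1)" using L by simp
    ultimately have "\<mu> * h q
        \<le> (2 * \<delta>) * (\<Lambda> * (2 powr m * (k powr m * norm p powr m + 1) + 1))"
      using \<mu> k \<delta>
        by (intro order_trans[OF mult_left_mono mult_right_mono]) (auto simp: \<mu>_def)
    also have "\<dots>
        = \<delta> * (2 * \<Lambda> * (2 powr m + 1))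
            + \<delta> * ((2 * \<Lambda> * 2 powr m * k powr m) * norm p powr m)"
      by (simp add: algebra_simps)
    also have "(2 * \<Lambda> * 2 powr m * k powr m) * norm p powr m \<le> (a * k / 2) * norm p powr m"
      using km by (intro mult_right_mono) auto
    finally have 2: "\<mu> * h q
        \<le> \<delta> * (2 * \<Lambda> * (2 powr m + 1)) + \<delta> * ((a * k / 2) * norm p powr m)"
      using \<delta> by simp
    have "(1 - \<mu>) * h p = (1 - \<delta>) * h p - \<delta> * (k * h p)"
      by (simp add: \<mu>_def algebra_simps)
    moreover have "k * h p \<ge> k * (a * norm p powr m - M)" using k lo by (intro mult_left_mono) auto
    then have "\<delta> * (k * h p) \<ge> \<delta> * (k * (a * norm p powr m - M))"
      by (rule mult_left_mono) (use \<delta> in auto)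
    moreover have "\<delta> * (k * M) \<le> \<delta> * 1"
      by (rule mult_left_mono) (use k \<delta> in auto)
    ultimately show "h ((1 - \<delta>) *\<^sub>R p + \<delta> *\<^sub>R e) \<le>
        (1 - \<delta>) * h p + \<delta> * (1 + 2 * \<Lambda> * (2 powr m
            + 1) - k * a / 2 * norm p powr m)"
      using 1 2 by (simp add: algebra_simps)
  qed
qed

section \<open>The penalty function\<close>

definition bracket :: "'a::real_normed_vector \<Rightarrow> real" where
  "bracket x = sqrt (1 + (norm x)\<^sup>2)"

lemma bracket_sq: "(bracket x)\<^sup>2 = 1 + (norm x)\<^sup>2"
  by (simp add: bracket_def add_nonneg_nonneg)

lemma bracket_ge_1: "1 \<le> bracket x"
  by (simp add: bracket_def)

lemma norm_le_bracket: "norm x \<le> bracket x"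
  by (simp add: bracket_def real_le_rsqrt)

lemma continuous_on_bracket: "continuous_on S (\<lambda>z. bracket (f z))" if "continuous_on S f"
  unfolding bracket_def by (intro continuous_intros that)

text \<open>This is the inequality 2 a b \<le> a^2 + b^2 for the two brackets, which gives slope and
  curvature of the touching paraboloid without differentiating the square root.\<close>

lemma bracket_le_touching:
  fixes x x0 :: "'a::real_inner"
  shows "bracket x
      \<le> bracket x0 + ((1 / bracket x0) *\<^sub>R x0) \<bullet> (x - x0)
          + (norm (x - x0))\<^sup>2 / (2 * bracket x0)"
proof -
  have b: "bracket x0 > 0" using bracket_ge_1[of x0] by simp
  have "2 * bracket x0 * bracket x \<le> (bracket x0)\<^sup>2 + (bracket x)\<^sup>2"
    using sum_squares_bound[of "bracket x0" "bracket x"] by simp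
  also have "(bracket x)\<^sup>2
      = (bracket x0)\<^sup>2 + 2 * (x0 \<bullet> (x - x0)) + (norm (x - x0))\<^sup>2"
    using norm_add_sq[of x0 "x - x0"] by (simp add: bracket_sq)
  finally have "bracket x
      \<le> (2 * (bracket x0)\<^sup>2 + 2 * (x0 \<bullet> (x - x0))
          + (norm (x - x0))\<^sup>2) / (2 * bracket x0)"
    using b by (simp add: pos_le_divide_eq mult.commute)
  also have "\<dots>
      = bracket x0 + ((1 / bracket x0) *\<^sub>R x0) \<bullet> (x - x0)
          + (norm (x - x0))\<^sup>2 / (2 * bracket x0)"
    using b by (simp add: add_divide_distrib power2_eq_square)
  finally show ?thesis .
qed

lemma pos_part_sq_le_touching:
  fixes a b :: real
  shows "(max 0 b)\<^sup>2 \<le> (max 0 a)\<^sup>2 + 2 * max 0 a * (b - a) + (b - a)\<^sup>2"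
proof (cases "0 \<le> a")
  case True
  have "(max 0 b)\<^sup>2 \<le> b\<^sup>2" by (simp add: max_def)
  also have "b\<^sup>2 = a\<^sup>2 + 2 * a * (b - a) + (b - a)\<^sup>2"
    by (simp add: power2_eq_square algebra_simps)
  finally show ?thesis using True by (simp add: max_def)
next
  case False
  then have "(max 0 b)\<^sup>2 \<le> (b - a)\<^sup>2" by (intro abs_le_square_iff[THEN iffD1]) auto
  then show ?thesis using False by (simp add: max_def)
qed

text \<open>The bracket dominates sublinear growth, \<open>C0\<close> is room for a truncation, and
  \<open>C\<close> times the time makes the inequality strict. The last term vanishes up to time
  \<open>t1\<close>, where the comparison is wanted, and is made large at the top of the
  cylinder.\<close>

definition penalty :: "real \<Rightarrow> real \<Rightarrow> real \<Rightarrow> real \<Rightarrow> real \<Rightarrow> 'a::real_normed_vector \<times> real \<Rightarrow> real" where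
  "penalty \<delta> C0 C N t1 z
      = \<delta> * (bracket (fst z) + C0 + C * snd z) + N * (max 0 (snd z - t1))\<^sup>2"

lemma continuous_on_penalty: "continuous_on S (penalty \<delta> C0 C N t1)"
  unfolding penalty_def by (intro continuous_intros continuous_on_bracket)

lemma penalty_touching:
  fixes x :: "'a::real_inner"
  assumes "\<delta> \<ge> 0" "N \<ge> 0"
  shows "penalty \<delta> C0 C N t1 w \<le> penalty \<delta> C0 C N t1 (x, t)
    + ((\<delta> / bracket x) *\<^sub>R x, \<delta> * C + 2 * N * max 0 (t - t1)) \<bullet> (w - (x, t))
    + ((\<delta> / bracket x) *\<^sub>R fst (w - (x, t)), 2 * N * snd (w - (x, t)))
        \<bullet> (w - (x, t)) / 2"
proof -
  have "\<delta> * bracket (fst w)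
      \<le> \<delta> * (bracket x + ((1 / bracket x) *\<^sub>R x) \<bullet> (fst w - x)
          + (norm (fst w - x))\<^sup>2 / (2 * bracket x))"
    using assms(1) by (rule mult_left_mono[OF bracket_le_touching])
  moreover have "N * (max 0 (snd w - t1))\<^sup>2
      \<le> N * ((max 0 (t - t1))\<^sup>2 + 2 * max 0 (t - t1) * (snd w - t) + (snd w - t)\<^sup>2)"
    using assms(2) pos_part_sq_le_touching[of "snd w - t1" "t - t1"] by (intro mult_left_mono) auto
  moreover have E1: "((\<delta> / bracket x) *\<^sub>R x, \<delta> * C
      + 2 * N * max 0 (t - t1)) \<bullet> (w - (x, t))
      = \<delta> * (((1 / bracket x) *\<^sub>R x) \<bullet> (fst w - x)) + (\<delta> * C
          + 2 * N * max 0 (t - t1)) * (snd w - t)"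
    by (simp add: inner_prod_def)
  moreover have E2: "((\<delta> / bracket x) *\<^sub>R fst (w - (x, t)), 2 * N * snd (w - (x, t)))
      \<bullet> (w - (x, t)) / 2
      = \<delta> * ((norm (fst w - x))\<^sup>2 / (2 * bracket x)) + N * (snd w - t)\<^sup>2"
  proof -
    have "((\<delta> / bracket x) *\<^sub>R fst (w - (x, t)), 2 * N * snd (w - (x, t)))
        \<bullet> (w - (x, t))
        = \<delta> / bracket x * (norm (fst w - x))\<^sup>2 + 2 * N * (snd w - t)\<^sup>2"
      by (simp only: inner_prod_def fst_conv snd_conv fst_diff snd_diff inner_scaleR_left power2_norm_eq_inner)
        (simp add: power2_eq_square)
    then show ?thesis by (simp add: add_divide_distrib)
  qed
  ultimately show ?thesis
    unfolding E1 E2 penalty_def fst_conv snd_conv by argo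
qed

section \<open>The doubled equation and comparison on bounded cylinders\<close>

text \<open>\<open>Z\<close> stands for (|P| + 1)^m with \<open>P\<close> the gradient of
  \<open>u\<close>, on which there is no bound. Every error of that order has a coefficient
  vanishing in the doubling limit, whereas the gain on the left keeps a fixed one.\<close>

lemma doubled_inequality:
  fixes \<sigma> :: "real^'d \<Rightarrow> real^'d^'n"
    and u v :: "(real^'d) \<times> real \<Rightarrow> real"
  assumes m: "m > 1" and \<Lambda>1: "\<Lambda>1 \<ge> 1" and \<Lambda>2: "\<Lambda>2 \<ge> 0"
    and sigma_bounded: "\<And>x. norm (\<sigma> x) \<le> \<Lambda>2"
    and sigma_lipschitz: "\<And>x y. norm (\<sigma> x - \<sigma> y) \<le> \<Lambda>2 * norm (x - y)"
    and sub: "viscosity_subsolution (diffusion \<sigma>) H U T u"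
    and super: "viscosity_supersolution (diffusion \<sigma>) H U T v"
    and S: "open S" "S \<subseteq> U \<times> {0<..<T}" "S
        \<subseteq> K" "(x, t) \<in> S" "(y, s) \<in> S"
    and \<delta>: "0 < \<delta>" "\<delta> \<le> 1/2" and N: "N \<ge> 0"
      and C: "C = C1 + \<Lambda>2\<^sup>2 / 2 + 2"
    and jet_u: "superjet K (\<lambda>z. (1 - \<delta>) * u z - penalty \<delta> C0 C N t1 z) (x, t) p X"
      and X: "linear X"
    and jet_v: "superjet K (\<lambda>z. - v z) (y, s) q Y" and Y: "linear Y"
    and \<alpha>: "\<alpha> > 0"
      and hess: "\<And>\<xi> \<zeta>. X \<xi> \<bullet> \<xi> + Y \<zeta> \<bullet> \<zeta>
          \<le> 2 * \<alpha> * (norm (\<xi> - \<zeta>))\<^sup>2"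
    and gain: "\<And>P e. norm e \<le> 1
        \<Longrightarrow> H ((1 - \<delta>) *\<^sub>R P + \<delta> *\<^sub>R e) x
            \<le> (1 - \<delta>) * H P x + \<delta> * (C1 - c * norm P powr m)"
    and c: "0 < c" "c \<le> 1/2"
    and Hx: "\<And>P. \<bar>H P x - H P y\<bar> \<le> (\<Lambda>1 * norm P powr m + M) * norm (x - y)"
      and M: "M \<ge> 1"
    and Hp: "\<And>P Q. \<bar>H P y - H Q y\<bar>
        \<le> \<Lambda>1 * (norm P + norm Q + 1) powr (m - 1) * norm (P - Q)"
    and pq: "norm (p + q) \<le> 1"
  obtains Z where "Z \<ge> 0" "\<delta> + \<delta> / 2 + \<delta> * c / 2 powr m * Z \<le>
     norm (p + q) + \<Lambda>2\<^sup>2 * (\<alpha> * (norm ((x, t) - (y, s)))\<^sup>2)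
         + M * norm ((x, t) - (y, s))
     + (\<Lambda>1 * norm ((x, t) - (y, s)) + \<Lambda>1 * 4 powr m * norm (p + q)) * Z"
proof -
  define l where "l = 1 - \<delta>"
  have l: "0 < l" "l \<le> 1" using \<delta> by (auto simp: l_def)
  define \<theta> where "\<theta> = norm (p + q)"
  define D where "D = norm ((x, t) - (y, s))"
  have D: "norm (x - y) \<le> D" unfolding D_def using norm_fst_le[of "x - y" "t - s"] by simp
  define Xp where "Xp h = ((\<delta> / bracket x) *\<^sub>R fst h, 2 * N * snd h)"
    for h :: "(real^'d) \<times> real"
  define pp where "pp = ((\<delta> / bracket x) *\<^sub>R x, \<delta> * C + 2 * N * max 0 (t - t1))"
  have Xp: "linear Xp" unfolding Xp_def by (rule linearI) (auto simp: algebra_simps)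
  have b: "bracket x \<ge> 1" by (rule bracket_ge_1)
  have "superjet K (\<lambda>z. ((1 - \<delta>) * u z - penalty \<delta> C0 C N t1 z)
      + penalty \<delta> C0 C N t1 z) (x, t) (p + pp) (\<lambda>h. X h + Xp h)"
    by (rule superjet_add_touching[OF jet_u]) (use penalty_touching[of \<delta> N] \<delta> N in \<open>simp add: pp_def Xp_def\<close>)
  then have "superjet K (\<lambda>z. (1 / l) * ((1 - \<delta>) * u z - penalty \<delta> C0 C N t1 z
      + penalty \<delta> C0 C N t1 z)) (x, t)
      ((1 / l) *\<^sub>R (p + pp)) (\<lambda>h. (1 / l) *\<^sub>R (X h + Xp h))"
    using l by (intro superjet_cmult) auto
  moreover have "(\<lambda>z. (1 / l) * ((1 - \<delta>) * u z - penalty \<delta> C0 C N t1 z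
      + penalty \<delta> C0 C N t1 z)) = u"
    using l by (simp add: l_def)
  ultimately have "superjet K u (x, t) ((1 / l) *\<^sub>R (p + pp)) (\<lambda>h. (1 / l) *\<^sub>R (X h
      + Xp h))" by simp
  then have ju: "superjet (U \<times> {0<..<T}) u (x, t) ((1 / l) *\<^sub>R (p
      + pp)) (\<lambda>h. (1 / l) *\<^sub>R (X h + Xp h))"
    by (rule superjet_open_subset) (use S in auto)
  have jv: "superjet (U \<times> {0<..<T}) (\<lambda>z. - v z) (y, s) q Y"
    using jet_v by (rule superjet_open_subset) (use S in auto)
  have xt: "x \<in> U" "t \<in> {0<..<T}" and ys: "y \<in> U" "s \<in> {0<..<T}" using S by auto
  \<comment> \<open>The gradient of \<open>u\<close> itself, after undoing the penalty and the
    factor 1 - \<delta>. Thus the spatial part of \<open>p\<close> is the combination of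
    \<open>P\<close> with -x / <x>, a vector of norm at most 1, to which the convexity gain
    applies.\<close>
  define P where "P = (1 / l) *\<^sub>R fst (p + pp)"
  define SX where "SX = (\<Sum>i\<in>UNIV. X (\<sigma> x $ i, 0) \<bullet> (\<sigma> x $ i, 0))"
  define SY where "SY = (\<Sum>i\<in>UNIV. Y (\<sigma> y $ i, 0) \<bullet> (\<sigma> y $ i, 0))"
  have SXp: "(\<Sum>i\<in>UNIV. ((1 / l) *\<^sub>R (X (\<sigma> x $ i, 0)
      + Xp (\<sigma> x $ i, 0))) \<bullet> (\<sigma> x $ i, 0))
      = (1 / l) * (SX + \<delta> / bracket x * (norm (\<sigma> x))\<^sup>2)"
    unfolding norm_matrix_sq SX_def
    by (simp add: Xp_def inner_add_left sum.distrib sum_distrib_left distrib_left power2_norm_eq_inner)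
  have "linear (\<lambda>h. (1 / l) *\<^sub>R (X h + Xp h))"
    using X Xp by (intro linear_compose_scale_right linear_compose_add)
  from viscosity_subsolution_superjet[OF sub xt ju this]
  have "(1 / l) * (snd p + snd pp) - (1 / l) * (SX
      + \<delta> / bracket x * (norm (\<sigma> x))\<^sup>2) / 2 + H P x \<le> 0"
    unfolding SXp by (simp add: P_def)
  from mult_left_mono[OF this, of l] l
  have sub': "snd p + snd pp - (SX + \<delta> / bracket x * (norm (\<sigma> x))\<^sup>2) / 2
      + l * H P x \<le> 0"
    by (simp add: algebra_simps)
  have super': "snd q - SY / 2 - H (- fst q) y \<le> 0"
    using viscosity_supersolution_superjet[OF super ys jv Y] by (simp add: SY_def)
  have "(norm (\<sigma> x))\<^sup>2 \<le> \<Lambda>2\<^sup>2"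
    using sigma_bounded[of x] by (intro power_mono) auto
  moreover have "\<delta> / bracket x \<le> \<delta>"
    using \<delta> b by (simp add: divide_le_eq mult_le_cancel_left1)
  ultimately have pen_tr: "\<delta> / bracket x * (norm (\<sigma> x))\<^sup>2
      \<le> \<delta> * \<Lambda>2\<^sup>2"
    using \<delta> by (intro mult_mono) auto
  \<comment> \<open>The matrix inequality is applied to corresponding rows of \<sigma> at
    \<open>x\<close> and at \<open>y\<close>; their difference is controlled by the Lipschitz bound,
    which turns \<alpha> into \<alpha> |x - y|^2.\<close>
  have "SX + SY \<le> (\<Sum>i\<in>UNIV. 2 * \<alpha> * (norm ((\<sigma> x - \<sigma> y) $ i))\<^sup>2)"
    unfolding SX_def SY_def sum.distrib[symmetric]
  proof (rule sum_mono)
    fix i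
    have "norm ((\<sigma> x $ i, 0::real) - (\<sigma> y $ i, 0)) = norm ((\<sigma> x - \<sigma> y) $ i)"
      by (simp add: norm_Pair)
    then show "X (\<sigma> x $ i, 0) \<bullet> (\<sigma> x $ i, 0)
        + Y (\<sigma> y $ i, 0) \<bullet> (\<sigma> y $ i, 0)
            \<le> 2 * \<alpha> * (norm ((\<sigma> x - \<sigma> y) $ i))\<^sup>2"
      using hess[of "(\<sigma> x $ i, 0)" "(\<sigma> y $ i, 0)"] by simp
  qed
  also have "\<dots> = 2 * \<alpha> * (norm (\<sigma> x - \<sigma> y))\<^sup>2"
    unfolding norm_matrix_sq sum_distrib_left ..
  also have "\<dots> \<le> 2 * \<alpha> * (\<Lambda>2 * D)\<^sup>2"
    using sigma_lipschitz[of x y] D \<Lambda>2 \<alpha>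
    by (intro mult_left_mono power_mono) (auto intro: order_trans mult_left_mono)
  finally have tr: "SX + SY \<le> 2 * (\<Lambda>2\<^sup>2 * (\<alpha> * D\<^sup>2))"
    by (simp add: power_mult_distrib algebra_simps)
  have snd_pp: "\<delta> * C \<le> snd pp" using N by (simp add: pp_def)
  have "snd p + snd q \<ge> - \<theta>"
    using norm_snd_le[of "snd (p + q)" "fst (p + q)"] unfolding prod.collapse by (simp add: \<theta>_def)
  then have main: "\<delta> * C + l * H P x - H (- fst q) y
      \<le> \<theta> + \<Lambda>2\<^sup>2 * (\<alpha> * D\<^sup>2) + \<delta> * \<Lambda>2\<^sup>2 / 2"
    using sub' super' pen_tr tr snd_pp by argo
  define e where "e = - (1 / bracket x) *\<^sub>R x"
  have e: "norm e \<le> 1" using b norm_le_bracket[of x] by (simp add: e_def)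
  have fp: "fst p = (1 - \<delta>) *\<^sub>R P + \<delta> *\<^sub>R e"
    using l unfolding l_def[symmetric] by (simp add: P_def pp_def e_def)
  have g1: "H (fst p) x \<le> l * H P x + \<delta> * (C1 - c * norm P powr m)"
    unfolding fp l_def by (rule gain[OF e])
  define Z where "Z = (norm P + 1) powr m"
  have "Z \<le> 2 powr m * (norm P powr m + 1 powr m)"
    unfolding Z_def using m by (intro powr_add_le) auto
  then have "Z / 2 powr m \<le> norm P powr m + 1" by (simp add: field_simps)
  then have "c * (Z / 2 powr m) \<le> c * (norm P powr m + 1)" using c by (intro mult_left_mono) auto
  then have "c * norm P powr m \<ge> c * Z / 2 powr m - 1/2" using c by (simp add: algebra_simps)
  then have g2: "\<delta> * (C1 - c * norm P powr m)
      \<le> \<delta> * (C1 + 1/2) - \<delta> * c / 2 powr m * Z"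
    using \<delta> mult_left_mono[of "C1 - c * norm P powr m" "C1 + 1/2 - c * Z / 2 powr m" \<delta>]
      by (simp add: algebra_simps)
  have np: "norm (fst p) \<le> norm P + 1"
  proof -
    have "norm (fst p) \<le> norm ((1 - \<delta>) *\<^sub>R P) + norm (\<delta> *\<^sub>R e)"
      unfolding fp by (rule norm_triangle_ineq)
    also have "norm ((1 - \<delta>) *\<^sub>R P) \<le> norm P"
      using \<delta> mult_right_mono[of "1 - \<delta>" 1 "norm P"] by simp
    also have "norm (\<delta> *\<^sub>R e) \<le> 1" using \<delta> e by (simp add: mult_le_one)
    finally show ?thesis by simp
  qed
  have fpq: "norm (fst p - - fst q) \<le> \<theta>"
    using norm_fst_le[of "fst (p + q)" "snd (p + q)"] unfolding prod.collapse by (simp add: \<theta>_def)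
  have nq: "norm (- fst q) \<le> norm P + 2"
    using norm_triangle_ineq2[of "- fst q" "fst p"] fpq np pq
      by (simp add: \<theta>_def norm_minus_commute add.commute)
  have "H (fst p) y - H (fst p) x \<le> (\<Lambda>1 * Z + M) * D"
  proof -
    have "H (fst p) y - H (fst p) x \<le> (\<Lambda>1 * norm (fst p) powr m + M) * norm (x - y)"
      using Hx[of "fst p"] by linarith
    also have "\<dots> \<le> (\<Lambda>1 * Z + M) * D"
      unfolding Z_def using np m \<Lambda>1 M D
      by (intro mult_mono add_mono mult_left_mono powr_mono2) (auto intro!: add_nonneg_nonneg)
    finally show ?thesis .
  qed
  moreover have "H (- fst q) y - H (fst p) y \<le> \<Lambda>1 * 4 powr m * \<theta> * Z"
  proof -
    have "(norm (fst p) + norm (- fst q) + 1) powr (m - 1) \<le> (4 * (norm P + 1)) powr (m - 1)"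
    proof (rule powr_mono2)
      show "norm (fst p) + norm (- fst q) + 1 \<le> 4 * (norm P + 1)"
        using np nq norm_ge_zero[of P] by argo
    qed (use m in \<open>auto intro: add_nonneg_nonneg\<close>)
    \<comment> \<open>The base is at least 1, so the exponent may be raised from m - 1 to
      \<open>m\<close>. The loss is affordable because the factor \<theta> tends to zero.\<close>
    also have "\<dots> \<le> (4 * (norm P + 1)) powr m" by (intro powr_mono) auto
    also have "\<dots> = 4 powr m * Z" by (simp add: Z_def powr_mult del: distrib_left_numeral)
    finally have B: "(norm (fst p) + norm (- fst q) + 1) powr (m - 1) \<le> 4 powr m * Z" .
    have "H (- fst q) y - H (fst p) y
        \<le> \<Lambda>1 * (norm (fst p) + norm (- fst q) + 1) powr (m - 1) * norm (fst p - - fst q)"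
      using Hp[of "fst p" "- fst q"] by linarith
    also have "\<dots> \<le> \<Lambda>1 * (4 powr m * Z) * \<theta>"
      using B fpq \<Lambda>1 by (intro mult_mono mult_left_mono) (auto simp: Z_def)
    finally show ?thesis by (simp add: mult_ac)
  qed
  ultimately have "\<delta> * C + \<delta> * c / 2 powr m * Z
      \<le> \<theta> + \<Lambda>2\<^sup>2 * (\<alpha> * D\<^sup>2) + \<delta> * \<Lambda>2\<^sup>2 / 2
          + \<delta> * (C1 + 1/2)
      + (\<Lambda>1 * Z + M) * D + \<Lambda>1 * 4 powr m * \<theta> * Z"
    using main g1 g2 by argo
  \<comment> \<open>In \<open>C\<close>, the summand \<open>C1\<close> covers the constant of the
    gain and half of the squared bound on \<sigma> covers the trace of the penalty. Of the final 2,
    a half pays for replacing |P|^m by \<open>Z\<close>; the remaining 3/2 is the strict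
    margin.\<close>
  then have "\<delta> + \<delta> / 2 + \<delta> * c / 2 powr m * Z
      \<le> \<theta> + \<Lambda>2\<^sup>2 * (\<alpha> * D\<^sup>2) + M * D + (\<Lambda>1 * D
          + \<Lambda>1 * 4 powr m * \<theta>) * Z"
    unfolding C by (simp add: algebra_simps)
  then show ?thesis using that[of Z] unfolding \<theta>_def D_def by (simp add: Z_def)
qed

text \<open>A positive value forces the limit of the doubled maxima into the open set
  \<open>S\<close>, since the rest of \<open>K\<close> has nonpositive values. There
  \<open>g\<close> coincides with -v and the equations apply. On \<open>K\<close> outside
  \<open>S\<close> the function \<open>g\<close> may differ from -v, which is what the truncation
  exploits.\<close>

lemma comparison_on_cylinder:
  fixes \<sigma> :: "real^'d \<Rightarrow> real^'d^'n"
    and u v g :: "(real^'d) \<times> real \<Rightarrow> real"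
  assumes m: "m > 1" and \<Lambda>1: "\<Lambda>1 \<ge> 1" and \<Lambda>2: "\<Lambda>2 \<ge> 0"
    and sigma_bounded: "\<And>x. norm (\<sigma> x) \<le> \<Lambda>2"
    and sigma_lipschitz: "\<And>x y. norm (\<sigma> x - \<sigma> y) \<le> \<Lambda>2 * norm (x - y)"
    and H_convex: "\<And>x. convex_on UNIV (\<lambda>p. H p x)"
    and H_local: "\<exists>a M. 0 < a \<and> a \<le> 1 \<and> M \<ge> 1 \<and>
      (\<forall>p q. \<forall>x\<in>ball 0 R. \<forall>y\<in>ball 0 R.
         a * norm p powr m - M \<le> H p x \<and>
         H p x \<le> \<Lambda>1 * (norm p powr m + 1) \<and>
         \<bar>H p x - H p y\<bar> \<le> (\<Lambda>1 * norm p powr m + M) * norm (x - y) \<and>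
         \<bar>H p x - H q x\<bar> \<le> \<Lambda>1 * (norm p + norm q + 1) powr (m - 1) * norm (p - q))"
    and sub: "viscosity_subsolution (diffusion \<sigma>) H U T u"
    and super: "viscosity_supersolution (diffusion \<sigma>) H U T v"
    and K: "compact K"
      and S: "open S" "S \<subseteq> U \<times> {0<..<T}" "S \<subseteq> K" "S
          \<subseteq> ball 0 R \<times> UNIV"
    and \<delta>: "0 < \<delta>" "\<delta> \<le> 1/2" and N: "N \<ge> 0"
    and C: "C = 1 + 2 * \<Lambda>1 * (2 powr m + 1) + \<Lambda>2\<^sup>2 / 2 + 2"
    and u_usc: "usc_on K (\<lambda>z. (1 - \<delta>) * u z - penalty \<delta> C0 C N t1 z)"
      and g_usc: "usc_on K g"
    and g_eq: "\<And>z. z \<in> S \<Longrightarrow> g z = - v z"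
    and bdry: "\<And>z. z \<in> K \<Longrightarrow> z \<notin> S
        \<Longrightarrow> (1 - \<delta>) * u z - penalty \<delta> C0 C N t1 z + g z \<le> 0"
    and z0: "z0 \<in> K"
  shows "(1 - \<delta>) * u z0 - penalty \<delta> C0 C N t1 z0 + g z0 \<le> 0"
proof (rule ccontr)
  assume "\<not> ?thesis"
  then have pos: "(1 - \<delta>) * u z0 - penalty \<delta> C0 C N t1 z0 + g z0 > 0" by simp
  obtain a M where a: "0 < a" "a \<le> 1" and M: "M \<ge> 1"
    and HR: "\<And>p q x y. x \<in> ball 0 R \<Longrightarrow> y \<in> ball 0 R \<Longrightarrow>
         a * norm p powr m - M \<le> H p x \<and>
         H p x \<le> \<Lambda>1 * (norm p powr m + 1) \<and>
         \<bar>H p x - H p y\<bar> \<le> (\<Lambda>1 * norm p powr m + M) * norm (x - y) \<and>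
         \<bar>H p x - H q x\<bar> \<le> \<Lambda>1 * (norm p + norm q + 1) powr (m - 1) * norm (p - q)"
    using H_local by blast
  obtain c where c: "0 < c" "c \<le> 1/2" and gain:
    "\<And>h p e \<delta>. convex_on UNIV h
        \<Longrightarrow> (\<And>p. a * norm p powr m - M \<le> h p) \<Longrightarrow>
       (\<And>p. h p \<le> \<Lambda>1 * (norm p powr m + 1)) \<Longrightarrow> norm e \<le> 1
           \<Longrightarrow> 0 < \<delta> \<Longrightarrow> \<delta> \<le> 1/2 \<Longrightarrow>
      h ((1 - \<delta>) *\<^sub>R p + \<delta> *\<^sub>R e :: real^'d) \<le>
        (1 - \<delta>) * h p + \<delta> * (1 + 2 * \<Lambda>1 * (2 powr m + 1) - c * norm p powr m)"
    by (rule convex_coercive_gain[OF m \<Lambda>1 a M]) blast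
  obtain \<alpha> x y p q X Y z where z: "z \<in> K" "(1 - \<delta>) * u z - penalty \<delta> C0 C N t1 z + g z > 0"
    and xK: "\<And>n. x n \<in> K" and yK: "\<And>n. y n \<in> K" and xz: "x \<longlonglongrightarrow> z"
      and yz: "y \<longlonglongrightarrow> z"
    and \<alpha>: "\<And>n. \<alpha> n > 0"
      and pen: "(\<lambda>n. \<alpha> n * (norm (x n - y n))\<^sup>2) \<longlonglongrightarrow> 0"
    and pq: "(\<lambda>n. norm (p n + q n)) \<longlonglongrightarrow> 0"
    and X: "\<And>n. linear (X n)" and Y: "\<And>n. linear (Y n)"
    and jx: "\<And>n. superjet K (\<lambda>z. (1 - \<delta>) * u z - penalty \<delta> C0 C N t1 z) (x n) (p n) (X n)"
    and jy: "\<And>n. superjet K g (y n) (q n) (Y n)"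
    and hess: "\<And>n \<xi> \<zeta>. X n \<xi> \<bullet> \<xi> + Y n \<zeta> \<bullet> \<zeta>
        \<le> 2 * \<alpha> n * (norm (\<xi> - \<zeta>))\<^sup>2"
    by (rule doubling_sequence[OF K u_usc g_usc z0 pos]) blast
  have "z \<in> S" using bdry[OF z(1)] z(2) by linarith
  then have xS: "\<forall>\<^sub>F n in sequentially. x n \<in> S"
    and yS: "\<forall>\<^sub>F n in sequentially. y n \<in> S"
    using topological_tendstoD[OF xz S(1)] topological_tendstoD[OF yz S(1)] by auto
  have D0: "(\<lambda>n. norm (x n - y n)) \<longlonglongrightarrow> 0"
    using tendsto_norm_zero[OF tendsto_diff[OF xz yz, simplified]] by simp
  have lim1: "(\<lambda>n. norm (p n + q n)
      + \<Lambda>2\<^sup>2 * (\<alpha> n * (norm (x n - y n))\<^sup>2) + M * norm (x n - y n))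
          \<longlonglongrightarrow> 0"
    using tendsto_add[OF tendsto_add[OF pq tendsto_mult_left[OF pen]] tendsto_mult_left[OF D0]] by simp
  have lim2: "(\<lambda>n. \<Lambda>1 * norm (x n - y n) + \<Lambda>1 * 4 powr m * norm (p n + q n))
      \<longlonglongrightarrow> 0"
    using tendsto_add[OF tendsto_mult_left[OF D0] tendsto_mult_left[OF pq]] by simp
  \<comment> \<open>Two separate thresholds: the errors free of \<open>Z\<close> must fall below the
    margin, and the coefficient of \<open>Z\<close> below that of the gain. Both are fixed positive
    numbers, so \<open>n\<close> can be chosen without knowing \<open>Z\<close>.\<close>
  have d1: "0 < \<delta> + \<delta> / 2" and d2: "0 < \<delta> * c / 2 powr m" using \<delta> c by auto
  have "\<forall>\<^sub>F n in sequentially. False"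
    using xS yS order_tendstoD(2)[OF lim1 d1] order_tendstoD(2)[OF lim2 d2] order_tendstoD(2)[OF pq zero_less_one]
  proof eventually_elim
    case (elim n)
    obtain xa ta where x: "x n = (xa, ta)" by (cases "x n")
    obtain yb sb where y: "y n = (yb, sb)" by (cases "y n")
    have ball: "xa \<in> ball 0 R" "yb \<in> ball 0 R" using elim(1,2) S(4) by (auto simp: x y)
    have jy': "superjet K (\<lambda>z. - v z) (yb, sb) (q n) (Y n)"
    proof (rule superjet_open_subset)
      show "superjet S (\<lambda>z. - v z) (yb, sb) (q n) (Y n)"
      proof (rule superjet_cong[OF g_eq])
        show "(yb, sb) \<in> S" using elim(2) by (simp add: y)
        then show "superjet S g (yb, sb) (q n) (Y n)"
          using superjet_open_subset[OF jy[of n], of S S] S by (simp add: y)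
      qed
    qed (use S elim(2) in \<open>auto simp: y\<close>)
    obtain Z where Z: "Z \<ge> 0" "\<delta> + \<delta> / 2 + \<delta> * c / 2 powr m * Z \<le>
     norm (p n + q n) + \<Lambda>2\<^sup>2 * (\<alpha> n * (norm ((xa, ta) - (yb, sb)))\<^sup>2)
         + M * norm ((xa, ta) - (yb, sb))
     + (\<Lambda>1 * norm ((xa, ta) - (yb, sb)) + \<Lambda>1 * 4 powr m * norm (p n + q n)) * Z"
    proof (rule doubled_inequality[OF m \<Lambda>1 \<Lambda>2 sigma_bounded sigma_lipschitz sub super S(1-3) _ _ \<delta> N C
          _ X[of n] jy' Y[of n] \<alpha>[of n] hess[of n] _ c _ M])
      show "(xa, ta) \<in> S" "(yb, sb) \<in> S" using elim(1,2) by (simp_all add: x y)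
      show "superjet K (\<lambda>z. (1 - \<delta>) * u z - penalty \<delta> C0 C N t1 z) (xa, ta) (p n) (X n)"
        using jx[of n] by (simp add: x)
      show "H ((1 - \<delta>) *\<^sub>R P + \<delta> *\<^sub>R e) xa
          \<le> (1 - \<delta>) * H P xa + \<delta> * (1 + 2 * \<Lambda>1 * (2 powr m
              + 1) - c * norm P powr m)"
        if "norm e \<le> 1" for P e
        by (rule gain[OF H_convex _ _ that \<delta>]) (use HR[OF ball(1) ball(1)] in auto)
      show "\<bar>H P xa - H P yb\<bar> \<le> (\<Lambda>1 * norm P powr m + M) * norm (xa - yb)" for P
        using HR[OF ball] by blast
      show "\<bar>H P yb - H Q yb\<bar>
          \<le> \<Lambda>1 * (norm P + norm Q + 1) powr (m - 1) * norm (P - Q)" for P Q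
        using HR[OF ball(2) ball(2)] by blast
      show "norm (p n + q n) \<le> 1" using elim(5) by simp
    qed blast
    have "(\<Lambda>1 * norm ((xa, ta) - (yb, sb)) + \<Lambda>1 * 4 powr m * norm (p n + q n)) * Z
        \<le> \<delta> * c / 2 powr m * Z"
      using elim(4) Z(1) unfolding x y by (intro mult_right_mono) auto
    then show False using Z(2) elim(3) unfolding x y by linarith
  qed
  then show False by simp
qed

section \<open>Sublinear growth and the full comparison\<close>

lemma eventually_at_infinity_in:
  "eventually P (at_infinity_in U)
      \<longleftrightarrow> (\<exists>R. \<forall>x\<in>U. R \<le> norm x \<longrightarrow> P x)"
  unfolding at_infinity_in_def eventually_inf_principal eventually_at_infinity by blast

lemma sublinear_upper_bound:
  fixes f :: "'a::real_normed_vector \<times> real \<Rightarrow> real"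
  assumes "Limsup (at_infinity_in U) (\<lambda>x. SUP t\<in>I. ereal (f (x, t) / (1 + norm x))) \<le> 0"
    and e: "e > 0"
  shows "\<exists>R. \<forall>x\<in>U. R \<le> norm x \<longrightarrow> (\<forall>t\<in>I. f (x, t)
      \<le> e * (1 + norm x))"
proof -
  have "Limsup (at_infinity_in U) (\<lambda>x. SUP t\<in>I. ereal (f (x, t) / (1 + norm x))) < ereal e"
    using e by (intro order_le_less_trans[OF assms(1)]) simp
  then have "\<forall>\<^sub>F x in at_infinity_in U. (SUP t\<in>I. ereal (f (x, t) / (1
      + norm x))) < ereal e"
    by (rule Limsup_lessD)
  then obtain R where R: "\<And>x. x \<in> U \<Longrightarrow> R \<le> norm x
      \<Longrightarrow> (SUP t\<in>I. ereal (f (x, t) / (1 + norm x))) < ereal e"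
    unfolding eventually_at_infinity_in by blast
  have "f (x, t) \<le> e * (1 + norm x)" if "x \<in> U" "R \<le> norm x" "t \<in> I" for x t
  proof -
    have "ereal (f (x, t) / (1 + norm x)) \<le> (SUP t\<in>I. ereal (f (x, t) / (1 + norm x)))"
      using that(3) by (rule SUP_upper)
    then have "ereal (f (x, t) / (1 + norm x)) < ereal e"
      using R[OF that(1,2)] by (rule order_le_less_trans)
    then have "f (x, t) / (1 + norm x) < e" by simp
    then show ?thesis by (simp add: divide_less_eq add_pos_nonneg less_imp_le)
  qed
  then show ?thesis by blast
qed

lemma sublinear_lower_bound:
  fixes f :: "'a::real_normed_vector \<times> real \<Rightarrow> real"
  assumes "0 \<le> Liminf (at_infinity_in U) (\<lambda>x. INF t\<in>I. ereal (f (x, t) / (1 + norm x)))"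
    and e: "e > 0"
  shows "\<exists>R. \<forall>x\<in>U. R
      \<le> norm x \<longrightarrow> (\<forall>t\<in>I. - e * (1 + norm x) \<le> f (x, t))"
proof -
  have "ereal (- e) < Liminf (at_infinity_in U) (\<lambda>x. INF t\<in>I. ereal (f (x, t) / (1
      + norm x)))"
    using e by (intro order_less_le_trans[OF _ assms(1)]) simp
  then have "\<forall>\<^sub>F x in at_infinity_in U. ereal (- e) < (INF t\<in>I. ereal (f (x, t) / (1
      + norm x)))"
    by (rule less_LiminfD)
  then obtain R where R: "\<And>x. x \<in> U \<Longrightarrow> R \<le> norm x
      \<Longrightarrow> ereal (- e) < (INF t\<in>I. ereal (f (x, t) / (1 + norm x)))"
    unfolding eventually_at_infinity_in by blast
  have "- e * (1 + norm x) \<le> f (x, t)" if "x \<in> U" "R \<le> norm x" "t \<in> I" for x t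
  proof -
    have "(INF t\<in>I. ereal (f (x, t) / (1 + norm x))) \<le> ereal (f (x, t) / (1 + norm x))"
      using that(3) by (rule INF_lower)
    with R[OF that(1,2)] have "ereal (- e) < ereal (f (x, t) / (1 + norm x))"
      by (rule order_less_le_trans)
    then have "- e < f (x, t) / (1 + norm x)" by simp
    then show ?thesis by (simp add: less_divide_eq add_pos_nonneg less_imp_le)
  qed
  then show ?thesis by blast
qed

theorem theorem2p3:
  fixes m \<Lambda>\<^sub>1 \<Lambda>\<^sub>2 T :: real
    and \<sigma> :: "real^'d \<Rightarrow> real^'d^'n"
    and H :: "real^'d \<Rightarrow> real^'d \<Rightarrow> real"
    and U :: "(real^'d) set"
    and u v :: "(real^'d) \<times> real \<Rightarrow> real"
  assumes m: "m > 1" and \<Lambda>1: "\<Lambda>\<^sub>1 \<ge> 1" and \<Lambda>2: "\<Lambda>\<^sub>2 \<ge> 0"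
    and sigma_bounded: "\<And>x. norm (\<sigma> x) \<le> \<Lambda>\<^sub>2"
    and sigma_lipschitz: "\<And>x y. norm (\<sigma> x - \<sigma> y) \<le> \<Lambda>\<^sub>2 * norm (x - y)"
    and H_convex: "\<And>x. convex_on UNIV (\<lambda>p. H p x)"
    and H_local: "\<And>R. R > 0 \<Longrightarrow> \<exists>a M. 0 < a \<and> a \<le> 1 \<and> M \<ge> 1 \<and>
      (\<forall>p q. \<forall>x\<in>ball 0 R. \<forall>y\<in>ball 0 R.
         a * norm p powr m - M \<le> H p x \<and>
         H p x \<le> \<Lambda>\<^sub>1 * (norm p powr m + 1) \<and>
         \<bar>H p x - H p y\<bar> \<le> (\<Lambda>\<^sub>1 * norm p powr m + M) * norm (x - y) \<and>
         \<bar>H p x - H q x\<bar> \<le> \<Lambda>\<^sub>1 * (norm p + norm q + 1) powr (m - 1) * norm (p - q))"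
    and U: "open U" and T: "T > 0"
    and u_usc: "usc_on (closure U \<times> {0..<T}) u"
    and v_lsc: "usc_on (closure U \<times> {0..<T}) (\<lambda>z. - v z)"
    and sub: "viscosity_subsolution (diffusion \<sigma>) H U T u"
    and super: "viscosity_supersolution (diffusion \<sigma>) H U T v"
    and initial: "\<And>x. x \<in> closure U \<Longrightarrow> u (x, 0) \<le> v (x, 0)"
    and lateral: "\<And>x t. x \<in> frontier U \<Longrightarrow> t \<in> {0..<T} \<Longrightarrow> u (x, t) \<le> v (x, t)"
    and u_growth: "Limsup (at_infinity_in U)
      (\<lambda>x. SUP t\<in>{0..<T}. ereal (u (x, t) / (1 + norm x))) \<le> 0"
    and v_growth: "0 \<le> Liminf (at_infinity_in U)
      (\<lambda>x. INF t\<in>{0..<T}. ereal (v (x, t) / (1 + norm x)))"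
  shows "\<forall>x\<in>U. \<forall>t\<in>{0..<T}. u (x, t) \<le> v (x, t)"
proof (intro ballI)
  fix x1 t1 assume x1: "x1 \<in> U" and t1: "t1 \<in> {0..<T}"
  \<comment> \<open>Nothing is known at time \<open>T\<close>, so the argument uses a compact
    cylinder ending strictly between \<open>t1\<close> and \<open>T\<close>; its top is handled by
    the penalty in time.\<close>
  define T' where "T' = (t1 + T) / 2"
  have T': "t1 < T'" "T' < T" "0 < T'" using t1 by (auto simp: T'_def)
  define C where "C = 1 + 2 * \<Lambda>\<^sub>1 * (2 powr m + 1) + \<Lambda>\<^sub>2\<^sup>2 / 2 + 2"
  have C0: "0 \<le> C" using \<Lambda>1 by (simp add: C_def add_nonneg_nonneg)
  define Cyl where "Cyl r = (closure U \<inter> cball 0 r) \<times> {0..T'}" for r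
  have Cyl_compact: "compact (Cyl r)" for r
    unfolding Cyl_def by (intro compact_Times closed_Int_compact) auto
  have Cyl_sub: "Cyl r \<subseteq> closure U \<times> {0..<T}" for r using T' by (auto simp: Cyl_def)
  obtain R0 where R0: "\<And>x t. x \<in> U \<Longrightarrow> R0 \<le> norm x
      \<Longrightarrow> t \<in> {0..<T} \<Longrightarrow> - (1/2) * (1 + norm x) \<le> v (x, t)"
    using sublinear_lower_bound[OF v_growth half_gt_zero[OF zero_less_one]] by blast
  obtain B where B: "\<And>z. z \<in> Cyl R0 \<Longrightarrow> - v z \<le> B"
  proof (cases "Cyl R0 = {}")
    case False
    then show thesis
      using that usc_on_attains_sup[OF Cyl_compact _ usc_on_subset[OF v_lsc Cyl_sub], of R0] by blast
  qed (use that in blast)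
  define B0 where "B0 = max 0 B"
  have B0: "0 \<le> B0" "B \<le> B0" by (simp_all add: B0_def)
  \<comment> \<open>The truncation from above is inactive over \<open>U\<close>: far out -v is at
    most half of 1 + |x|, and on the remaining compact part it is at most \<open>B\<close>. It bites
    only on the frontier, where growth of \<open>v\<close> is not assumed.\<close>
  define g where "g z = min (- v z) (bracket (fst z) + B0)" for z
  have half: "(1 + norm x) / 2 \<le> bracket x" for x :: "real^'d"
    using bracket_ge_1[of x] norm_le_bracket[of x] by simp
  have g_eq: "g (x, t) = - v (x, t)" if "x \<in> U" "t \<in> {0..T'}" for x t
  proof -
    have "- v (x, t) \<le> bracket x + B0"
    proof (cases "R0 \<le> norm x")
      case True
      then have "- (1/2) * (1 + norm x) \<le> v (x, t)" using R0[of x t] that T' by auto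
      then show ?thesis using half[of x] B0 by argo
    next
      case False
      then have "(x, t) \<in> Cyl R0" using that closure_subset by (auto simp: Cyl_def)
      then show ?thesis using B[of "(x, t)"] bracket_ge_1[of x] B0 by linarith
    qed
    then show ?thesis by (simp add: g_def)
  qed
  have est: "(1 - \<delta>) * u (x1, t1) - v (x1, t1) \<le> \<delta> * (bracket x1 + B0 + C * t1)"
    if \<delta>: "0 < \<delta>" "\<delta> \<le> 1/2" for \<delta>
  proof -
    \<comment> \<open>At radius \<open>R\<close> both \<open>u\<close> and -v contribute at most
      \<delta> / 4 times 1 + |x|; the sum stays below \<delta> times the bracket.\<close>
    have d4: "\<delta> / 4 > 0" using \<delta> by simp
    obtain R1 where R1: "\<And>x t. x \<in> U \<Longrightarrow> R1 \<le> norm x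
        \<Longrightarrow> t \<in> {0..<T} \<Longrightarrow> u (x, t) \<le> \<delta> / 4 * (1 + norm x)"
      using sublinear_upper_bound[OF u_growth d4] by blast
    obtain R2 where R2: "\<And>x t. x \<in> U \<Longrightarrow> R2 \<le> norm x
        \<Longrightarrow> t \<in> {0..<T}
            \<Longrightarrow> - (\<delta> / 4) * (1 + norm x) \<le> v (x, t)"
      using sublinear_lower_bound[OF v_growth d4] by blast
    define R where "R = max (max R1 R2) (norm x1 + 1)"
    have R: "R > 0" "R1 \<le> R" "R2 \<le> R" "norm x1 < R"
      using norm_ge_zero[of x1] by (auto simp: R_def max_def simp del: norm_ge_zero)
    define K where "K = Cyl R"
    define S where "S = (U \<inter> ball 0 R) \<times> {0<..<T'}"
    have g_usc: "usc_on K g"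
      unfolding g_def K_def
      by (intro usc_on_min usc_on_subset[OF v_lsc Cyl_sub] continuous_on_imp_usc_on continuous_intros continuous_on_bracket)
    have w_usc: "usc_on K (\<lambda>z. (1 - \<delta>) * u z - penalty \<delta> B0 C N t1 z)" for N
    proof -
      have "usc_on K (\<lambda>z. (1 - \<delta>) * u z + - penalty \<delta> B0 C N t1 z)"
        unfolding K_def using \<delta>
        by (intro usc_on_add usc_on_cmult usc_on_subset[OF u_usc Cyl_sub] continuous_on_imp_usc_on
            continuous_intros continuous_on_penalty) auto
      then show ?thesis by simp
    qed
    have z1: "(x1, t1) \<in> K" using x1 t1 T' R closure_subset by (auto simp: K_def Cyl_def)
    then have "K \<noteq> {}" by auto
    then obtain b where b: "\<And>z. z \<in> K
        \<Longrightarrow> (1 - \<delta>) * u z - penalty \<delta> B0 C 0 t1 z + g z \<le> b"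
      using usc_on_attains_sup[OF Cyl_compact _ usc_on_add[OF w_usc[of 0, unfolded K_def] g_usc[unfolded K_def]]]
      unfolding K_def by blast
    \<comment> \<open>With this value the time penalty at \<open>T'\<close> equals |b|, where
      \<open>b\<close> bounds the difference before that term is added.\<close>
    define N where "N = \<bar>b\<bar> / (T' - t1)\<^sup>2"
    have N: "N \<ge> 0" by (simp add: N_def)
    have NT: "N * (T' - t1)\<^sup>2 = \<bar>b\<bar>" using T' by (simp add: N_def)
    have pen_lower: "\<delta> * (bracket x + B0) \<le> penalty \<delta> B0 C N t1 (x, t)" if "0 \<le> t"
      for x :: "real^'d" and t
      using \<delta> C0 N that mult_left_mono[of 0 "C * t" \<delta>]
        by (simp add: penalty_def distrib_left)
    have bdry: "(1 - \<delta>) * u z - penalty \<delta> B0 C N t1 z + g z \<le> 0"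
      if z: "z \<in> K" "z \<notin> S" for z
    proof -
      obtain x t where xt: "z = (x, t)" by (cases z)
      have x: "x \<in> closure U" "norm x \<le> R" and t: "0 \<le> t" "t \<le> T'"
        using z(1) by (auto simp: xt K_def Cyl_def)
      have tT: "t \<in> {0..<T}" using t T' by simp
      consider "u (x, t) \<le> v (x, t)" | "x \<in> U" "norm x = R" | "t = T'"
      proof -
        have "x \<in> frontier U \<or> x \<in> U" using x(1) U by (auto simp: frontier_def interior_open)
        then show thesis
          using that z(2) x t tT initial lateral by (force simp: xt S_def)
      qed
      then show ?thesis
      proof cases
        case 1
        \<comment> \<open>From u \<le> v \<le> -g only \<delta> g survives in the difference, and
          the truncation bounds it by the penalty. With -v in place of \<open>g\<close> this
          remainder would be uncontrolled.\<close>
        have g: "g (x, t) \<le> - v (x, t)" "g (x, t) \<le> bracket x + B0" by (auto simp: g_def)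
        have "(1 - \<delta>) * u (x, t) \<le> (1 - \<delta>) * (- g (x, t))"
          using 1 g \<delta> by (intro mult_left_mono) auto
        moreover have "\<delta> * g (x, t) \<le> \<delta> * (bracket x + B0)"
          using g \<delta> by (intro mult_left_mono) auto
        ultimately show ?thesis using pen_lower[OF t(1), of x] by (simp add: xt algebra_simps)
      next
        case 2
        have "(1 - \<delta>) * u (x, t) \<le> (1 - \<delta>) * (\<delta> / 4 * (1 + norm x))"
          using R1[OF 2(1) _ tT] R 2 \<delta> by (intro mult_left_mono) auto
        also have "\<dots> \<le> 1 * (\<delta> / 4 * (1 + norm x))"
          using \<delta> by (intro mult_right_mono) auto
        finally have "(1 - \<delta>) * u (x, t) \<le> \<delta> / 4 * (1 + norm x)" by simp
        moreover have "g (x, t) \<le> \<delta> / 4 * (1 + norm x)"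
        proof -
          have "g (x, t) \<le> - v (x, t)" by (simp add: g_def)
          then show ?thesis using R2[OF 2(1) _ tT] R 2 by auto
        qed
        moreover have "\<delta> * ((1 + norm x) / 2) \<le> \<delta> * (bracket x + B0)"
          using half[of x] \<delta> B0 by (intro mult_left_mono) auto
        ultimately show ?thesis using pen_lower[OF t(1), of x] by (simp add: xt)
      next
        case 3
        have "penalty \<delta> B0 C N t1 z = penalty \<delta> B0 C 0 t1 z + \<bar>b\<bar>"
          using T' NT by (simp add: penalty_def xt 3)
        then show ?thesis using b[OF z(1)] by linarith
      qed
    qed
    have "(1 - \<delta>) * u (x1, t1) - penalty \<delta> B0 C N t1 (x1, t1) + g (x1, t1) \<le> 0"
    proof (rule comparison_on_cylinder[OF m \<Lambda>1 \<Lambda>2 sigma_bounded sigma_lipschitz H_convex H_local[OF R(1)] sub super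
          _ _ _ _ _ \<delta> N C_def w_usc g_usc _ bdry z1, where S = S])
      show "compact K" unfolding K_def by (rule Cyl_compact)
      show "open S" unfolding S_def by (intro open_Times open_Int U) auto
      show "S \<subseteq> U \<times> {0<..<T}" "S \<subseteq> K" "S \<subseteq> ball 0 R \<times> UNIV"
        using T' closure_subset by (auto simp: S_def K_def Cyl_def)
      show "g z = - v z" if "z \<in> S" for z using that g_eq by (auto simp: S_def)
    qed
    then show ?thesis using g_eq[OF x1, of t1] t1 T' by (simp add: penalty_def)
  qed
  have "u (x1, t1) - v (x1, t1) \<le> 0"
  proof (rule le_zero_of_le_eps_mult)
    fix \<delta> :: real assume "0 < \<delta>" "\<delta> \<le> 1/2"
    from est[OF this] show "u (x1, t1) - v (x1, t1)
        \<le> \<delta> * (bracket x1 + B0 + C * t1 + u (x1, t1))"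
      by (simp add: algebra_simps)
  qed
  then show "u (x1, t1) \<le> v (x1, t1)" by simp
qed

end
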